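(* Let $n,m\ge 1$, let $K\subset\mathbb{R}^{2n}$ and $T\subset\mathbb{R}^{2m}$ be convex bodies containing the origin, and let $1\le p\le\infty$. Then $$ \mathrm{sys}_{n+m}(K\times_p T)^{\,n+m}\ \le\ \mathrm{sys}_n(K)^n\,\mathrm{sys}_m(T)^m, $$ and equality holds if and only if $c_{\rm EHZ}(K)=c_{\rm EHZ}(T)$ and $p=2$.
   Context: A convex body in $\mathbb{R}^d$ is a compact convex set with non-empty interior. The space $\mathbb{R}^{2n}$ carries the standard symplectic form $\omega_n=dq\wedge dp$, and $\mathbb{R}^{2n}\times\mathbb{R}^{2m}\cong\mathbb{R}^{2(n+m)}$ carries the product symplectic form; $J$ is the standard linear complex structure. $p$-product: for $1\le p<\infty$, $K\times_p T=\bigcup_{0\le t\le1}\big((1-t)^{1/p}K\times t^{1/p}T\big)\subset\mathbb{R}^{2n}\times\mathbb{R}^{2m}$, and $K\times_\infty T=K\times T$. Equivalently, in terms of gauge functions, $\|(x,y)\|_{K\times_pT}^p=\|x\|_K^p+\|y\|_T^p$ for $p<\infty$ and $\|(x,y)\|_{K\times_\infty T}=\max\{\|x\|_K,\|y\|_T\}$. Capacity: for a convex body $K\subset\mathbb{R}^{2n}$ with smooth boundary, $c_{\rm EHZ}(K)$ is the minimal symplectic action $A(\gamma)=\int_\gamma\lambda$ ($d\lambda=\omega_n$) among closed characteristics $\gamma$ on $\partial K$, i.e. closed integral curves of the line field $\ker\omega_n|_{\partial K}$ (oriented along $J n_K$, with $n_K$ the outer unit normal). For a general convex body, $c_{\rm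 EHZ}$ is the extension of this by continuity in the Hausdorff metric; equivalently it is the minimal action among generalized closed characteristics, i.e. non-constant absolutely continuous closed curves $\gamma\subset\partial K$ with $\dot\gamma(t)\in J N_K(\gamma(t))$ for almost every $t$, where $N_K(x)$ is the outer normal cone of $K$ at $x$. Systolic ratio: $\mathrm{sys}_n(K)=\dfrac{c_{\rm EHZ}(K)}{(n!\,\mathrm{Vol}(K))^{1/n}}$ for a convex body $K\subset\mathbb{R}^{2n}$, where $\mathrm{Vol}$ is Lebesgue measure. *)

theory Defs
  imports "HOL-Analysis.Analysis"
begin

text \<open>
  The space R^(2n) is modelled as the type of pairs (q, p) of vectors in R^n, with n = CARD('n);
  index types are non-empty, so n is at least 1.
\<close>

type_synonym 'n phase = "(real ^ 'n) \<times> (real ^ 'n)"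

definition omega :: "'n::finite phase \<Rightarrow> 'n phase \<Rightarrow> real" where
  "omega z w = fst z \<bullet> snd w - snd z \<bullet> fst w"

definition cstruct :: "'n::finite phase \<Rightarrow> 'n phase" where
  "cstruct z = (- snd z, fst z)"

text \<open>
  The sign conventions match: the form is compatible with the complex structure, so curves running
  along J applied to the outer normal have positive action.
\<close>

lemma omega_cstruct: "omega z (cstruct w) = z \<bullet> w"
  by (simp add: omega_def cstruct_def inner_prod_def)

definition convex_body :: "'a::euclidean_space set \<Rightarrow> bool" where
  "convex_body K \<longleftrightarrow> compact K \<and> convex K \<and> interior K \<noteq> {}"

definition normal_cone :: "'a::real_inner set \<Rightarrow> 'a \<Rightarrow> 'a set" where
  "normal_cone K x = {v. \<forall>y\<in>K. v \<bullet> (y - x) \<le> 0}"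

text \<open>Absolute continuity of a curve on a compact interval (each pair is an interval u, v).\<close>

definition abs_continuous_on :: "real \<Rightarrow> real \<Rightarrow> (real \<Rightarrow> 'a::metric_space) \<Rightarrow> bool" where
  "abs_continuous_on a b f \<longleftrightarrow>
     (\<forall>\<epsilon>>0. \<exists>\<delta>>0. \<forall>I :: (real \<times> real) set.
        finite I \<longrightarrow> (\<forall>(u, v)\<in>I. a \<le> u \<and> u \<le> v \<and> v \<le> b) \<longrightarrow>
        disjoint_family_on (\<lambda>(u, v). {u<..<v}) I \<longrightarrow>
        (\<Sum>(u, v)\<in>I. v - u) < \<delta> \<longrightarrow> (\<Sum>(u, v)\<in>I. dist (f u) (f v)) < \<epsilon>)"

text \<open>
  Since the normal cone is invariant under positive scaling, the parameter interval may be
  normalised to [0, 1].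
\<close>

definition gen_closed_characteristic :: "'n::finite phase set \<Rightarrow> (real \<Rightarrow> 'n phase) \<Rightarrow> bool" where
  "gen_closed_characteristic K \<gamma> \<longleftrightarrow>
     abs_continuous_on 0 1 \<gamma> \<and> \<gamma> 0 = \<gamma> 1 \<and> \<not> \<gamma> constant_on {0..1} \<and>
     \<gamma> ` {0..1} \<subseteq> frontier K \<and>
     (AE t in lebesgue_on {0..1}. \<exists>v \<in> normal_cone K (\<gamma> t).
        (\<gamma> has_vector_derivative cstruct v) (at t within {0..1}))"

text \<open>
  The integral over the curve of the primitive (q dp - p dq) / 2 of dq \<open>\<and>\<close> dp; for closed curves
  the choice of the primitive does not matter.
\<close>

definition action :: "(real \<Rightarrow> 'n::finite phase) \<Rightarrow> real" where
  "action \<gamma> = integral {0..1}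
     (\<lambda>t. omega (\<gamma> t) (vector_derivative \<gamma> (at t within {0..1})) / 2)"

text \<open>
  For convex bodies the set of actions is non-empty, bounded below by 0 and its infimum is attained,
  so this is the minimal action.
\<close>

definition c_EHZ :: "'n::finite phase set \<Rightarrow> real" where
  "c_EHZ K = Inf (action ` {\<gamma>. gen_closed_characteristic K \<gamma>})"

definition sys_ratio :: "'n::finite phase set \<Rightarrow> real" where
  "sys_ratio K = c_EHZ K / root CARD('n) (fact CARD('n) * measure lebesgue K)"

text \<open>
  The identification of R^(2n) x R^(2m) with R^(2(n+m)) is ((q, p), (q', p')) |-> ((q, q'), (p, p')),
  where vectors in R^(n+m) are indexed by the sum type.
\<close>

definition vec_join :: "real ^ 'n \<Rightarrow> real ^ 'm \<Rightarrow> real ^ ('n + 'm)" where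
  "vec_join x y = (\<chi> i. case i of Inl a \<Rightarrow> x $ a | Inr b \<Rightarrow> y $ b)"

definition phase_join :: "'n::finite phase \<Rightarrow> 'm::finite phase \<Rightarrow> ('n + 'm) phase" where
  "phase_join z w = (vec_join (fst z) (fst w), vec_join (snd z) (snd w))"

lemma inner_vec_join:
  fixes x x' :: "real ^ 'n" and y y' :: "real ^ 'm"
  shows "vec_join x y \<bullet> vec_join x' y' = x \<bullet> x' + y \<bullet> y'"
  by (simp add: vec_join_def inner_vec_def UNIV_Plus_UNIV [symmetric] sum.Plus del: UNIV_Plus_UNIV)

lemma inner_phase_join: "phase_join z w \<bullet> phase_join z' w' = z \<bullet> z' + w \<bullet> w'"
  by (simp add: phase_join_def inner_prod_def inner_vec_join)

lemma omega_phase_join: "omega (phase_join z w) (phase_join z' w') = omega z z' + omega w w'"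
  by (simp add: phase_join_def omega_def inner_vec_join)

lemma vec_join_eq_iff:
  fixes x x' :: "real ^ 'n" and y y' :: "real ^ 'm"
  shows "vec_join x y = vec_join x' y' \<longleftrightarrow> x = x' \<and> y = y'"
proof
  assume "vec_join x y = vec_join x' y'"
  then have *: "vec_join x y $ i = vec_join x' y' $ i" for i
    by simp
  show "x = x' \<and> y = y'"
    using *[of "Inl _"] *[of "Inr _"] by (simp add: vec_join_def vec_eq_iff)
qed simp

lemma bij_phase_join: "bij (case_prod (phase_join :: 'n::finite phase \<Rightarrow> 'm::finite phase \<Rightarrow> _))"
proof (rule bijI)
  show "inj (case_prod (phase_join :: 'n phase \<Rightarrow> 'm phase \<Rightarrow> _))"
    by (auto simp: inj_def phase_join_def vec_join_eq_iff)
  show "surj (case_prod (phase_join :: 'n phase \<Rightarrow> 'm phase \<Rightarrow> _))"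
  proof (rule surjI)
    have "vec_join (\<chi> a. x $ Inl a) (\<chi> b. x $ Inr b) = x" for x :: "real ^ ('n + 'm)"
      by (simp add: vec_join_def vec_eq_iff split: sum.split)
    then show "case_prod phase_join
        ((\<lambda>u. (((\<chi> a. fst u $ Inl a), (\<chi> a. snd u $ Inl a)),
              ((\<chi> b. fst u $ Inr b), (\<chi> b. snd u $ Inr b)))) u) = u" for u :: "('n + 'm) phase"
      by (simp add: phase_join_def)
  qed
qed

text \<open>Note that 0 powr a = 0, so the end points t = 0 and t = 1 are treated correctly.\<close>

definition p_product :: "ereal \<Rightarrow> 'n::finite phase set \<Rightarrow> 'm::finite phase set \<Rightarrow> ('n + 'm) phase set"
  where
  "p_product p K T =
     (if p = \<infinity> then {phase_join x y | x y. x \<in> K \<and> y \<in> T}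
      else (\<Union>t\<in>{0..1}. {phase_join ((1 - t) powr (1 / real_of_ereal p) *\<^sub>R x)
                                  (t powr (1 / real_of_ereal p) *\<^sub>R y) | x y. x \<in> K \<and> y \<in> T}))"

end

theory Submission
  imports Defs "HOL-Complex_Analysis.Great_Picard" "HOL-Probability.Distributions"
begin

text \<open>
  Everything rests on an isoperimetric description of the capacity: among closed curves with rotated
  velocity \<open>v\<close>, the smallest value of \<open>(\<integral> h\<^sub>K(v))\<^sup>2 / (4 area)\<close> is \<open>c\<^sub>E\<^sub>H\<^sub>Z(K)\<close>, where \<open>h\<^sub>K\<close> is the
  support function. An area maximiser among curves with \<open>h\<^sub>K(v) \<le> 1\<close> exists by Arzela-Ascoli; by its
  first-order condition (with a Lagrange multiplier for the closing condition) a suitable translate,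
  rescaled, is a generalised closed characteristic. Conversely a closed characteristic has
  \<open>\<integral> h\<^sub>K(v) = 2 area\<close>.

  This description is invariant under translations and monotone, and it behaves well for products.
  It bounds the capacity \<open>c\<close> of the p-product by the number \<open>r2\<close> for which the ellipse
  \<open>c\<^sub>E\<^sub>H\<^sub>Z(K) a\<^sup>2 + c\<^sub>E\<^sub>H\<^sub>Z(T) b\<^sup>2 \<le> r2\<close> is inscribed in the planar unit ball of the p-norm. The p-product
  therefore contains the 2-product of the rescaled bodies \<open>(r2 / c\<^sub>E\<^sub>H\<^sub>Z(K))\<^sup>1\<^sup>/\<^sup>2 K\<close> and
  \<open>(r2 / c\<^sub>E\<^sub>H\<^sub>Z(T))\<^sup>1\<^sup>/\<^sup>2 T\<close>, whose volume is computed from the integral of \<open>exp (- gauge\<^sup>2)\<close>; the inequality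
  is the comparison of the two volumes, and no Gamma functions are needed. The inclusion is strict,
  also in volume, unless \<open>p = 2\<close> and the capacities agree, and in that case Minkowski's inequality
  for the support functions gives equality.
\<close>

subsection \<open>Absolutely continuous and Lipschitz functions\<close>

text \<open>The same number \<open>r2\<close> settles both sides. Join \<open>a0\<close> times a
  minimal loop of \<open>K\<close> with \<open>b0\<close> times one of \<open>T\<close>: the area is
  \<open>k * a0\<^sup>2 + \<tau> * b0\<^sup>2\<close>, and the support length is about twice the
  maximum over the planar ball of the linear form \<open>k * a0 * a + \<tau> * b0 * b\<close>. Where
  the ellipse touches the ball this maximum is again \<open>r2\<close>, so the capacity is at most
  \<open>(2 * r2)\<^sup>2 / (4 * r2)\<close>. The same ellipse fits the rescaled 2-product into the
  p-product, and n! Vol is multiplicative for 2-products. Length is measured with the support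
  function because the origin may lie on the boundary of \<open>K\<close>: moving the origin adds a
  linear term, which integrates to zero over a closed loop. The obstacle throughout is low
  regularity. Characteristics are only absolutely continuous, so areas are compared through
  Riemann-Stieltjes sums of increments, and bounds on velocities travel through bounds on
  increments, which survive limits and changes of parameter.\<close>

text \<open>Tags in \<open>N\<close> get as gauge an open set \<open>U\<close> of measure below the
  \<open>\<delta>\<close> of absolute continuity, so that the increments over their intervals are
  small in total; at other tags the gauge is a radius of differentiability. Integrability of
  \<open>f'\<close> is part of the conclusion, but in the Henstock-Kurzweil sense only.\<close>

lemma abs_continuous_on_FTC:
  fixes f :: "real \<Rightarrow> 'a::euclidean_space"
  assumes ac: "abs_continuous_on a b f" and "a \<le> b" and N: "negligible N"
    and der: "\<And>t. t \<in> {a..b} - N \<Longrightarrow> (f has_vector_derivative f' t) (at t within {a..b})"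
  shows "(f' has_integral f b - f a) {a..b}"
proof -
  define g where "g t = (if t \<in> N then 0 else f' t)" for t
  have "(g has_integral (f b - f a)) {a..b}"
    unfolding has_integral_real
  proof (intro allI impI)
    fix e :: real assume e: "0 < e"
    define e1 where "e1 = e / (2 * (b - a + 1))"
    have e1: "e1 > 0" using e \<open>a \<le> b\<close> by (simp add: e1_def)
    have "e1 * (b - a) \<le> e1 * (b - a + 1)" using e1 by simp
    also have "\<dots> = e/2" unfolding e1_def using \<open>a \<le> b\<close> by (simp add: field_simps)
    finally have e1e: "e1 * (b - a) \<le> e/2" .
    obtain \<delta> where \<delta>: "\<delta> > 0" "\<And>I :: (real \<times> real) set.
        finite I \<Longrightarrow> (\<forall>(u, v)\<in>I. a \<le> u \<and> u \<le> v \<and> v \<le> b) \<Longrightarrow>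
        disjoint_family_on (\<lambda>(u, v). {u<..<v}) I \<Longrightarrow>
        (\<Sum>(u, v)\<in>I. v - u) < \<delta> \<Longrightarrow> (\<Sum>(u, v)\<in>I. dist (f u) (f v)) < e/2"
    proof -
      have "e/2 > 0" using e by simp
      from ac[unfolded abs_continuous_on_def, THEN spec, THEN mp, OF this] show thesis
        using that by blast
    qed
    have "N \<in> sets lebesgue" "measure lebesgue N = 0"
      using N by (auto simp: negligible_imp_sets negligible_imp_measure0)
    obtain U where U: "open U" "N \<subseteq> U" "U \<in> lmeasurable" "measure lebesgue U < \<delta>"
    proof -
      obtain U where U: "open U" "N \<subseteq> U" "U - N \<in> lmeasurable" "emeasure lebesgue (U - N) < ennreal \<delta>"
        using sets_lebesgue_outer_open[OF \<open>N \<in> sets lebesgue\<close> \<delta>(1)] by metis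
      have "U = (U - N) \<union> N" using U by auto
      then have l: "U \<in> lmeasurable"
        using U N by (metis fmeasurable.Un negligible_imp_measurable)
      have "measure lebesgue (U - N) = measure lebesgue U"
        using N U l by (simp add: measure_Diff_null_set negligible_iff_null_sets fmeasurableD)
      moreover have "measure lebesgue (U - N) < \<delta>"
        using U(3,4) by (metis emeasure_eq_measure2 ennreal_leI not_less)
      ultimately show ?thesis using that U l by auto
    qed
    have "\<forall>x. \<exists>d>0. x \<in> {a..b} - N \<longrightarrow>
         (\<forall>y\<in>{a..b}. norm (y-x) < d \<longrightarrow> norm (f y - f x - (y-x) *\<^sub>R f' x) \<le> e1 * norm (y-x))"
      using der e1 unfolding has_vector_derivative_def has_derivative_within_alt by (metis zero_less_one)
    then obtain d where d: "\<And>x. 0 < d x"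
                 "\<And>x y. \<lbrakk>x \<in> {a..b} - N; y \<in> {a..b}; norm (y-x) < d x\<rbrakk>
                        \<Longrightarrow> norm (f y - f x - (y-x) *\<^sub>R f' x) \<le> e1 * norm (y-x)"
      by metis
    define \<gamma> where "\<gamma> x = (if x \<in> N then U else ball x (d x))" for x
    have "gauge \<gamma>" using U d by (auto simp: gauge_def \<gamma>_def)
    have *: "norm ((\<Sum>(x,k)\<in>p. measure lborel k *\<^sub>R g x) - (f b - f a)) < e"
      if p: "p tagged_division_of {a..b}" and fine: "\<gamma> fine p" for p
    proof -
      have finp: "finite p" using p by blast
      define p1 where "p1 = {(x,K) \<in> p. x \<in> N}"
      define p2 where "p2 = {(x,K) \<in> p. x \<notin> N}"
      have pp: "p = p1 \<union> p2" "p1 \<inter> p2 = {}" by (auto simp: p1_def p2_def)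
      have fin: "finite p1" "finite p2" using finp pp by auto
      have ba: "b - a = (\<Sum>(x,K)\<in>p. Sup K - Inf K)" "f b - f a = (\<Sum>(x,K)\<in>p. f(Sup K) - f(Inf K))"
        using additive_tagged_division_1[where f= "\<lambda>x. x"] additive_tagged_division_1[where f= f]
            \<open>a \<le> b\<close> p by auto
      have intv: "\<exists>u v. K = {u..v} \<and> u \<le> v \<and> x \<in> K \<and> a \<le> u \<and> v \<le> b" if "(x,K) \<in> p" for x K
      proof -
        have "x \<in> K" "K \<subseteq> {a..b}" "\<exists>u v. K = cbox u v"
          using tagged_division_ofD(2-4)[OF p that] by auto
        then obtain u v where "K = {u..v}" by auto
        with \<open>x \<in> K\<close> \<open>K \<subseteq> {a..b}\<close> show ?thesis by (intro exI[of _ u] exI[of _ v]) auto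
      qed
      have "norm (\<Sum>(x,K)\<in>p2. measure lborel K *\<^sub>R g x - (f (Sup K) - f (Inf K))) \<le> (\<Sum>(x,K)\<in>p2. e1 * (Sup K - Inf K))"
      proof (rule sum_norm_le, clarify)
        fix x K assume "(x,K) \<in> p2"
        then have xK: "(x,K) \<in> p" "x \<notin> N" by (auto simp: p2_def)
        obtain u v where K: "K = {u..v}" "u \<le> v" "x \<in> K" "a \<le> u" "v \<le> b" using intv[OF xK(1)] by blast
        have "K \<subseteq> \<gamma> x" using fine xK unfolding fine_def by blast
        then have sub: "K \<subseteq> ball x (d x)" using xK by (simp add: \<gamma>_def)
        have x: "x \<in> {a..b} - N" using xK K by auto
        have "v \<in> ball x (d x)" "u \<in> ball x (d x)" using sub K by (auto simp del: mem_ball)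
        then have "norm (v - x) < d x" "norm (u - x) < d x" by (auto simp: dist_norm norm_minus_commute)
        then have 1: "norm (f v - f x - (v-x) *\<^sub>R f' x) \<le> e1 * (v-x)"
          and 2: "norm (f u - f x - (u-x) *\<^sub>R f' x) \<le> e1 * (x-u)"
          using d(2)[OF x, of v] d(2)[OF x, of u] K by auto
        have "measure lborel K *\<^sub>R g x - (f (Sup K) - f (Inf K))
            = (f u - f x - (u-x) *\<^sub>R f' x) - (f v - f x - (v-x) *\<^sub>R f' x)"
          using K xK by (simp add: g_def algebra_simps)
        also have "norm \<dots> \<le> e1 * (x-u) + e1 * (v-x)"
          using norm_triangle_ineq4 1 2 by (smt (verit))
        also have "\<dots> = e1 * (Sup K - Inf K)" using K by (simp add: algebra_simps)
        finally show "norm (measure lborel K *\<^sub>R g x - (f (Sup K) - f (Inf K))) \<le> e1 * (Sup K - Inf K)" .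
      qed
      also have "\<dots> \<le> (\<Sum>(x,K)\<in>p. e1 * (Sup K - Inf K))"
      proof (rule sum_mono2[OF finp])
        show "p2 \<subseteq> p" using pp by auto
        fix z assume "z \<in> p - p2"
        then obtain x K where z: "z = (x,K)" "(x,K) \<in> p" by (metis DiffD1 surj_pair)
        show "0 \<le> (case z of (x,K) \<Rightarrow> e1 * (Sup K - Inf K))"
          using intv[OF z(2)] z(1) e1 by auto
      qed
      also have "\<dots> = e1 * (b - a)" unfolding ba(1) by (simp add: sum_distrib_left case_prod_unfold)
      finally have S2: "norm (\<Sum>(x,K)\<in>p2. measure lborel K *\<^sub>R g x - (f (Sup K) - f (Inf K))) \<le> e/2"
        using e1e by simp
      \<comment> \<open>Different tags can carry the same degenerate interval, so passing from
        tagged intervals to pairs of end points is not injective. Such pairs have zero increment,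
        which is why \<open>sum1\<close> asks for \<open>h u u = 0\<close>.\<close>
      define I where "I = (\<lambda>(x,K). (Inf K, Sup K)) ` p1"
      have disj: "{Inf K<..<Sup K} \<inter> {Inf K'<..<Sup K'} = {}"
        if xK: "(x,K) \<in> p" "(x',K') \<in> p" "(x,K) \<noteq> (x',K')" for x K x' K'
      proof -
        have "interior K \<inter> interior K' = {}" using tagged_division_ofD(5)[OF p xK] .
        moreover obtain u v where "K = {u..v}" "u \<le> v" using intv[OF xK(1)] by blast
        moreover obtain u' v' where "K' = {u'..v'}" "u' \<le> v'" using intv[OF xK(2)] by blast
        ultimately show ?thesis by simp
      qed
      have sum1: "(\<Sum>(u,v)\<in>I. h u v) = (\<Sum>(x,K)\<in>p1. h (Inf K) (Sup K))" if h: "\<And>u. h u u = 0" for h :: "real \<Rightarrow> real \<Rightarrow> real"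
      proof -
        have "(\<Sum>(u,v)\<in>I. h u v) = sum ((\<lambda>(u,v). h u v) \<circ> (\<lambda>(x,K). (Inf K, Sup K))) p1"
          unfolding I_def
        proof (rule sum.reindex_nontrivial[OF fin(1)])
          fix y z assume "y \<in> p1" "z \<in> p1" "y \<noteq> z" and eq: "(case y of (x, K) \<Rightarrow> (Inf K, Sup K)) = (case z of (x, K) \<Rightarrow> (Inf K, Sup K))"
          then obtain x K x' K' where yz: "y = (x,K)" "z = (x',K')" "(x,K) \<in> p" "(x',K') \<in> p" "(x,K) \<noteq> (x',K')"
            using pp by (metis UnI1 surj_pair)
          have "{Inf K<..<Sup K} = {}" using disj[OF yz(3-5)] eq yz by simp
          moreover have "Inf K \<le> Sup K" using intv[OF yz(3)] by auto
          ultimately have "Inf K = Sup K" by simp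
          then show "(case case y of (x, K) \<Rightarrow> (Inf K, Sup K) of (u, v) \<Rightarrow> h u v) = 0" using yz h by simp
        qed
        then show ?thesis by (simp add: case_prod_unfold o_def)
      qed
      have "(\<Sum>(u, v)\<in>I. dist (f u) (f v)) < e/2"
      proof (rule \<delta>(2))
        show "finite I" using fin by (simp add: I_def)
        show "\<forall>(u, v)\<in>I. a \<le> u \<and> u \<le> v \<and> v \<le> b"
        proof (clarsimp simp: I_def)
          fix x K assume "(x,K) \<in> p1"
          then have "(x,K) \<in> p" using pp by auto
          from intv[OF this] show "a \<le> Inf K \<and> Inf K \<le> Sup K \<and> Sup K \<le> b" by auto
        qed
        show "disjoint_family_on (\<lambda>(u, v). {u<..<v}) I"
          unfolding disjoint_family_on_def
        proof (intro ballI impI)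
          fix m n assume "m \<in> I" "n \<in> I" "m \<noteq> n"
          then obtain x K x' K' where "(x,K) \<in> p1" "(x',K') \<in> p1" "m = (Inf K, Sup K)" "n = (Inf K', Sup K')"
            unfolding I_def by fastforce
          moreover then have "(x,K) \<noteq> (x',K')" using \<open>m \<noteq> n\<close> by auto
          ultimately show "(case m of (u, v) \<Rightarrow> {u<..<v}) \<inter> (case n of (u, v) \<Rightarrow> {u<..<v}) = {}"
            using disj pp by auto
        qed
        have "(\<Sum>(u,v)\<in>I. v - u) = (\<Sum>(x,K)\<in>p1. Sup K - Inf K)" using sum1[of "\<lambda>u v. v - u"] by simp
        also have "\<dots> = (\<Sum>z\<in>p1. measure lebesgue {Inf (snd z)<..<Sup (snd z)})"
        proof (rule sum.cong[OF refl], clarify)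
          fix x K assume "(x,K) \<in> p1"
          then have "(x,K) \<in> p" using pp by auto
          from intv[OF this] show "Sup K - Inf K = measure lebesgue {Inf (snd (x,K))<..<Sup (snd (x,K))}" by auto
        qed
        also have "\<dots> = measure lebesgue (\<Union>z\<in>p1. {Inf (snd z)<..<Sup (snd z)})"
        proof (rule measure_UNION'[symmetric, OF fin(1)])
          show "\<And>z. z \<in> p1 \<Longrightarrow> {Inf (snd z)<..<Sup (snd z)} \<in> lmeasurable"
            using lmeasurable_box[of "Inf _" "Sup _"] by (metis box_real(1))
          show "pairwise (\<lambda>y z. disjnt {Inf (snd y)<..<Sup (snd y)} {Inf (snd z)<..<Sup (snd z)}) p1"
            unfolding pairwise_def disjnt_def using disj pp by (metis UnI1 prod.collapse)
        qed
        also have "\<dots> \<le> measure lebesgue U"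
        proof (rule measure_mono_fmeasurable[OF _ _ U(3)])
          show "(\<Union>z\<in>p1. {Inf (snd z)<..<Sup (snd z)}) \<subseteq> U"
          proof (clarify)
            fix x K t assume xK: "(x,K) \<in> p1" and t: "t \<in> {Inf (snd (x,K))<..<Sup (snd (x,K))}"
            then have "(x,K) \<in> p" "x \<in> N" by (auto simp: p1_def)
            then have "K \<subseteq> \<gamma> x" "\<gamma> x = U" using fine unfolding fine_def by (blast, simp add: \<gamma>_def)
            then have "K \<subseteq> U" by simp
            moreover obtain u v where "K = {u..v}" "u \<le> v" using intv[OF \<open>(x,K) \<in> p\<close>] by blast
            ultimately show "t \<in> U" using t by auto
          qed
        qed (use fin in auto)
        finally show "(\<Sum>(u,v)\<in>I. v - u) < \<delta>" using U by simp
      qed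
      moreover have "(\<Sum>(u, v)\<in>I. dist (f u) (f v)) = (\<Sum>(x,K)\<in>p1. dist (f (Inf K)) (f (Sup K)))"
        using sum1[of "\<lambda>u v. dist (f u) (f v)"] by simp
      moreover have "norm (\<Sum>(x,K)\<in>p1. measure lborel K *\<^sub>R g x - (f (Sup K) - f (Inf K))) \<le> (\<Sum>(x,K)\<in>p1. dist (f (Inf K)) (f (Sup K)))"
        by (rule sum_norm_le) (auto simp: p1_def g_def dist_norm)
      ultimately have S1: "norm (\<Sum>(x,K)\<in>p1. measure lborel K *\<^sub>R g x - (f (Sup K) - f (Inf K))) < e/2" by simp
      have "(\<Sum>(x,k)\<in>p. measure lborel k *\<^sub>R g x) - (f b - f a) = (\<Sum>(x,K)\<in>p. measure lborel K *\<^sub>R g x - (f (Sup K) - f (Inf K)))"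
        unfolding ba(2) by (simp add: sum_subtractf case_prod_unfold)
      also have "\<dots> = (\<Sum>(x,K)\<in>p1. measure lborel K *\<^sub>R g x - (f (Sup K) - f (Inf K))) + (\<Sum>(x,K)\<in>p2. measure lborel K *\<^sub>R g x - (f (Sup K) - f (Inf K)))"
        unfolding pp(1) by (rule sum.union_disjoint) (use fin pp in auto)
      finally have eq: "(\<Sum>(x,k)\<in>p. measure lborel k *\<^sub>R g x) - (f b - f a) = (\<Sum>(x,K)\<in>p1. measure lborel K *\<^sub>R g x - (f (Sup K) - f (Inf K))) + (\<Sum>(x,K)\<in>p2. measure lborel K *\<^sub>R g x - (f (Sup K) - f (Inf K)))" .
      show ?thesis unfolding eq by (rule norm_triangle_lt) (use S1 S2 in linarith)
    qed
    show "\<exists>\<gamma>. gauge \<gamma> \<and> (\<forall>\<D>. \<D> tagged_division_of {a..b} \<and> \<gamma> fine \<D> \<longrightarrow>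
          norm ((\<Sum>(x, k)\<in>\<D>. measure lborel k *\<^sub>R g x) - (f b - f a)) < e)"
      by (intro exI[of _ \<gamma>] conjI allI impI \<open>gauge \<gamma>\<close> *) simp_all
  qed
  then show ?thesis
    by (rule has_integral_spike[OF N, rotated]) (auto simp: g_def)
qed

section \<open>Almost everywhere differentiability of Lipschitz curves by Vitali coverings\<close>

text \<open>The covering theorem for closed balls only asks that a ball contain the point, so
  intervals that straddle \<open>t\<close> off centre are admissible; midpoints and half lengths
  serve as centres and radii.\<close>

lemma Vitali_covering_intervals:
  fixes P :: "real \<Rightarrow> real \<Rightarrow> bool"
  assumes "open U" "E \<subseteq> U"
    and P: "\<And>t \<epsilon>. t \<in> E \<Longrightarrow> \<epsilon> > 0 \<Longrightarrow> \<exists>u v. u < t \<and> t < v \<and> v - u < \<epsilon> \<and> P u v"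
  obtains C where "countable C" "\<And>u v. (u, v) \<in> C \<Longrightarrow> u < v \<and> {u..v} \<subseteq> U \<and> P u v"
    "disjoint_family_on (\<lambda>(u, v). {u..v}) C" "negligible (E - (\<Union>(u, v)\<in>C. {u..v}))"
proof -
  define K where "K = {(u,v). u < v \<and> {u..v} \<subseteq> U \<and> P u v}"
  define a :: "real \<times> real \<Rightarrow> real" where "a = (\<lambda>(u,v). (u+v)/2)"
  define r :: "real \<times> real \<Rightarrow> real" where "r = (\<lambda>(u,v). (v-u)/2)"
  have cb: "cball (a i) (r i) = (case i of (u,v) \<Rightarrow> {u..v})" for i
    by (cases i) (auto simp: a_def r_def cball_def dist_real_def abs_if field_simps split: if_splits)
  obtain C where C: "countable C" "C \<subseteq> K"
     "pairwise (\<lambda>i j. disjnt (cball (a i) (r i)) (cball (a j) (r j))) C"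
     "negligible (E - (\<Union>i \<in> C. cball (a i) (r i)))"
  proof (rule Vitali_covering_theorem_cballs)
    show "0 < r i" if "i \<in> K" for i using that by (auto simp: K_def r_def)
    show "\<exists>i. i \<in> K \<and> x \<in> cball (a i) (r i) \<and> r i < d" if x: "x \<in> E" and d: "0 < d" for x d
    proof -
      obtain e where e: "e > 0" "ball x e \<subseteq> U" using assms x by (meson open_contains_ball subsetD)
      obtain u v where uv: "u < x" "x < v" "v - u < min d e" "P u v"
        using P[OF x, of "min d e"] d e by auto
      have "{u..v} \<subseteq> ball x e" using uv by (auto simp: dist_real_def)
      then have "(u,v) \<in> K" using uv e unfolding K_def by auto
      moreover have "x \<in> cball (a (u,v)) (r (u,v))" unfolding cb using uv by auto
      moreover have "r (u,v) < d" using uv unfolding r_def by auto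
      ultimately show ?thesis by blast
    qed
  qed
  show thesis
  proof (rule that[OF C(1)])
    show "\<And>u v. (u, v) \<in> C \<Longrightarrow> u < v \<and> {u..v} \<subseteq> U \<and> P u v" using C(2) by (auto simp: K_def)
    show "disjoint_family_on (\<lambda>(u, v). {u..v}) C"
      using C(3) by (auto simp: disjoint_family_on_def pairwise_def cb disjnt_def)
    show "negligible (E - (\<Union>(u, v)\<in>C. {u..v}))" using C(4) by (simp add: cb)
  qed
qed

lemma emeasure_disjoint_intervals_mono:
  fixes M1 M2 :: "real measure"
  assumes "sets M1 = sets borel" "sets M2 = sets borel" "countable C"
    "disjoint_family_on (\<lambda>(u, v). {u..v}) C"
    "\<And>u v. (u, v) \<in> C \<Longrightarrow> emeasure M1 {u..v} \<le> emeasure M2 {u..v}"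
  shows "emeasure M1 (\<Union>(u, v)\<in>C. {u..v}) \<le> emeasure M2 (\<Union>(u, v)\<in>C. {u..v})"
proof -
  have "emeasure M (\<Union>(u, v)\<in>C. {u..v}) = (\<integral>\<^sup>+i. emeasure M (case i of (u,v) \<Rightarrow> {u..v}) \<partial>count_space C)"
    if "sets M = sets borel" for M :: "real measure"
    by (rule emeasure_UN_countable) (use that assms in auto)
  then show ?thesis using assms
    by (auto intro!: nn_integral_mono)
qed

text \<open>Because the straddling is strict, the points straddled by pairs of length below
  \<open>1 / (n + 1)\<close> form an open set, whatever \<open>P\<close> is; the set in question is
  the countable intersection of these.\<close>

lemma straddle_set_borel:
  fixes P :: "real \<Rightarrow> real \<Rightarrow> bool"
  shows "{t. \<forall>\<epsilon>>0. \<exists>u v. u < t \<and> t < v \<and> v - u < \<epsilon> \<and> P u v} \<in> sets borel"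
proof -
  have "{t. \<forall>\<epsilon>>0. \<exists>u v. u < t \<and> t < v \<and> v - u < \<epsilon> \<and> P u v}
      = (\<Inter>n::nat. \<Union>(u,v)\<in>{(u,v). v - u < 1 / real (Suc n) \<and> P u v}. {u<..<v})" (is "?L = ?R")
  proof (intro set_eqI iffI)
    fix t assume "t \<in> ?L"
    have *: "\<exists>u v. u < t \<and> t < v \<and> v - u < 1 / real (Suc n) \<and> P u v" for n
      using \<open>t \<in> ?L\<close> by simp
    have "\<exists>i\<in>{(u,v). v - u < 1 / real (Suc n) \<and> P u v}. t \<in> (case i of (u,v) \<Rightarrow> {u<..<v})" for n
    proof -
      from *[of n] obtain u v where "u < t" "t < v" "v - u < 1 / real (Suc n)" "P u v" by blast
      then show ?thesis by (intro bexI[of _ "(u, v)"]) auto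
    qed
    then show "t \<in> ?R" by simp
  next
    fix t assume t: "t \<in> ?R"
    show "t \<in> ?L"
    proof (intro CollectI allI impI)
      fix \<epsilon> :: real assume "\<epsilon> > 0"
      then obtain n where "1 / real (Suc n) < \<epsilon>" using nat_approx_posE by blast
      moreover obtain u v where "v - u < 1 / real (Suc n)" "P u v" "u < t" "t < v" using t by fastforce
      ultimately show "\<exists>u v. u < t \<and> t < v \<and> v - u < \<epsilon> \<and> P u v"
        by (meson less_trans)
    qed
  qed
  moreover have "open (\<Union>(u,v)\<in>{(u,v). v - u < 1 / real (Suc n) \<and> P u v}. {u<..<v})" for n :: nat
    by (rule open_UN) auto
  then have "?R \<in> sets borel"
    by (intro sets.countable_INT) (auto intro: borel_open simp del: of_nat_Suc)
  ultimately show ?thesis by simp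
qed

text \<open>Lebesgue's argument with two coverings: intervals of quotient below \<open>r\<close>
  cover \<open>E\<close> inside \<open>U\<close>, and intervals of quotient above \<open>s\<close>
  cover it again inside the first ones. Comparing the two gives
  \<open>s * |E| \<le> r * (|E| + \<eta>)\<close> for every \<open>\<eta> > 0\<close>, hence
  \<open>|E| = 0\<close>. Straddling quotients play the part of Dini derivates.\<close>

lemma mono_straddle_quotients_negligible:
  fixes f :: "real \<Rightarrow> real"
  assumes f: "mono f" "continuous_on UNIV f" and "r < s"
  shows "negligible ({t. \<forall>\<epsilon>>0. \<exists>u v. u < t \<and> t < v \<and> v - u < \<epsilon> \<and> f v - f u < r * (v - u)} \<inter>
                     {t. \<forall>\<epsilon>>0. \<exists>u v. u < t \<and> t < v \<and> v - u < \<epsilon> \<and> f v - f u > s * (v - u)})"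
    (is "negligible (?A \<inter> ?B)")
proof (cases "r > 0")
  case False
  have "?A = {}"
  proof -
    have "\<not> (f v - f u < r * (v - u))" if "u < v" for u v
    proof -
      have "f u \<le> f v" "r * (v - u) \<le> 0" using f(1) that False by (auto simp: mono_def mult_nonpos_nonneg)
      then show ?thesis by simp
    qed
    then show ?thesis by (auto intro!: exI[of _ "1::real"])
  qed
  then show ?thesis by (simp only: Int_empty_left negligible_empty)
next
  case True
  \<comment> \<open>The Stieltjes measure of \<open>f\<close> turns sums of increments over disjoint
    intervals into measures of sets, so that the two coverings are compared by the inclusion
    \<open>W \<subseteq> V\<close>.\<close>
  define \<mu> where "\<mu> = interval_measure f"
  have sets\<mu>: "sets \<mu> = sets borel" by (simp add: \<mu>_def)
  have \<mu>: "emeasure \<mu> {u..v} = ennreal (f v - f u)" if "u \<le> v" for u v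
    unfolding \<mu>_def by (rule emeasure_interval_measure_Icc) (use f that in \<open>auto simp: mono_def\<close>)
  show ?thesis
  proof (subst negligible_on_intervals, intro allI)
    fix a b :: real
    define E where "E = ?A \<inter> ?B \<inter> {a..b}"
    have E: "E \<in> sets borel" unfolding E_def by (intro sets.Int straddle_set_borel) auto
    have "emeasure lborel E \<le> emeasure lborel {a..b}" by (rule emeasure_mono) (auto simp: E_def)
    also have "\<dots> < \<infinity>" by (simp add: emeasure_lborel_Icc_eq)
    finally have fin: "emeasure lborel E < \<infinity>" .
    have "ennreal s * emeasure lborel E \<le> ennreal r * (emeasure lborel E + ennreal \<eta>)" if \<eta>: "\<eta> > 0" for \<eta>
    proof -
      obtain U where U: "open U" "E \<subseteq> U" "emeasure lborel (U - E) < ennreal \<eta>"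
      proof -
        have "E \<in> sets lebesgue" by (rule sets_completionI_sets) (simp add: E)
        from sets_lebesgue_outer_open[OF this \<eta>] obtain U
          where U: "open U" "E \<subseteq> U" "emeasure lebesgue (U - E) < ennreal \<eta>" by metis
        have "U - E \<in> sets lborel" using E U(1) by simp
        then have "emeasure lebesgue (U - E) = emeasure lborel (U - E)" by simp
        with U that show ?thesis by simp
      qed
      obtain C where C: "countable C" "\<And>u v. (u, v) \<in> C \<Longrightarrow> u < v \<and> {u..v} \<subseteq> U \<and> f v - f u < r * (v - u)"
        "disjoint_family_on (\<lambda>(u, v). {u..v}) C" "negligible (E - (\<Union>(u, v)\<in>C. {u..v}))"
        by (rule Vitali_covering_intervals[OF U(1,2), of "\<lambda>u v. f v - f u < r * (v - u)"]) (auto simp: E_def)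
      define V where "V = (\<Union>(u, v)\<in>C. {u..v})"
      \<comment> \<open>The second covering has to live in an open set; dropping the countably many
        end points loses only a null set.\<close>
      define V' where "V' = (\<Union>(u, v)\<in>C. {u<..<v})"
      have V'V: "V' \<subseteq> V" unfolding V_def V'_def by (rule UN_mono) auto
      have oV': "open V'" by (auto simp: V'_def)
      have bV: "V \<in> sets borel" unfolding V_def using C(1) by (intro sets.countable_UN') auto
      have "V - V' \<subseteq> fst ` C \<union> snd ` C" by (force simp: V_def V'_def)
      then have "negligible (V - V')" using C(1)
        by (intro negligible_subset[OF _ \<open>V - V' \<subseteq> _\<close>])
          (simp add: negligible_iff_null_sets countable_imp_null_set_lborel null_sets_completionI)
      then have "negligible ((E - V) \<union> (V - V'))" using C(4) by (simp add: V_def)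
      then have neg: "negligible (E - V')" by (rule negligible_subset) auto
      have 1: "emeasure \<mu> V \<le> emeasure (scale_measure (ennreal r) lborel) V"
        unfolding V_def
      proof (rule emeasure_disjoint_intervals_mono[OF sets\<mu> _ C(1,3)])
        fix u v assume "(u,v) \<in> C"
        then have "u < v" "f v - f u < r * (v - u)" using C(2) by auto
        then show "emeasure \<mu> {u..v} \<le> emeasure (scale_measure (ennreal r) lborel) {u..v}"
          using True by (simp add: \<mu> ennreal_mult[symmetric] ennreal_leI)
      qed simp
      obtain D where D: "countable D" "\<And>u v. (u, v) \<in> D \<Longrightarrow> u < v \<and> {u..v} \<subseteq> V' \<and> f v - f u > s * (v - u)"
        "disjoint_family_on (\<lambda>(u, v). {u..v}) D" "negligible (E \<inter> V' - (\<Union>(u, v)\<in>D. {u..v}))"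
        by (rule Vitali_covering_intervals[OF oV', of "E \<inter> V'" "\<lambda>u v. f v - f u > s * (v - u)"]) (auto simp: E_def)
      define W where "W = (\<Union>(u, v)\<in>D. {u..v})"
      have bW: "W \<in> sets borel" unfolding W_def using D(1) by (intro sets.countable_UN') auto
      have WV: "W \<subseteq> V" using D(2) V'V by (fastforce simp: W_def)
      have 2: "emeasure (scale_measure (ennreal s) lborel) W \<le> emeasure \<mu> W"
        unfolding W_def
      proof (rule emeasure_disjoint_intervals_mono[OF _ sets\<mu> D(1,3)])
        fix u v assume "(u,v) \<in> D"
        then have "u < v" "f v - f u > s * (v - u)" using D(2) by auto
        then show "emeasure (scale_measure (ennreal s) lborel) {u..v} \<le> emeasure \<mu> {u..v}"
          using True assms(3) by (simp add: \<mu> ennreal_mult[symmetric] ennreal_leI)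
      qed simp
      have "negligible ((E - V') \<union> (E \<inter> V' - W))" using neg D(4) by (simp add: W_def)
      then have "negligible (E - W)" by (rule negligible_subset) auto
      then have "E - W \<in> null_sets lborel"
        using E bW by (simp add: negligible_iff_null_sets null_sets_completion_iff)
      have "emeasure lborel E \<le> emeasure lborel (W \<union> (E - W))" by (rule emeasure_mono) (use E bW in auto)
      also have "\<dots> = emeasure lborel W"
        by (rule emeasure_Un_null_set) (use \<open>E - W \<in> null_sets lborel\<close> bW in auto)
      finally have EW: "emeasure lborel E \<le> emeasure lborel W" .
      have "V \<subseteq> U" using C(2) by (fastforce simp: V_def)
      then have "emeasure lborel V \<le> emeasure lborel U" using U by (intro emeasure_mono) auto
      also have "U = E \<union> (U - E)" using U by auto
      also have "emeasure lborel \<dots> \<le> emeasure lborel E + emeasure lborel (U - E)"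
        by (rule emeasure_subadditive) (use E U in auto)
      also have "\<dots> \<le> emeasure lborel E + ennreal \<eta>" using U by (intro add_left_mono) auto
      finally have VU: "emeasure lborel V \<le> emeasure lborel E + ennreal \<eta>" .
      have "ennreal s * emeasure lborel E \<le> ennreal s * emeasure lborel W" using EW by (rule mult_left_mono) simp
      also have "\<dots> \<le> emeasure \<mu> W" using 2 by simp
      also have "\<dots> \<le> emeasure \<mu> V" using WV bV sets\<mu> by (intro emeasure_mono) auto
      also have "\<dots> \<le> ennreal r * emeasure lborel V" using 1 by simp
      also have "\<dots> \<le> ennreal r * (emeasure lborel E + ennreal \<eta>)" using VU by (rule mult_left_mono) simp
      finally show ?thesis .
    qed
    then have *: "s * measure lborel E \<le> r * (measure lborel E + \<eta>)" if "\<eta> > 0" for \<eta>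
      using that fin True assms(3)
      by (simp add: emeasure_eq_ennreal_measure less_top ennreal_mult[symmetric] ennreal_plus[symmetric] del: ennreal_plus)
    have "s * measure lborel E \<le> r * measure lborel E"
    proof (rule field_le_epsilon)
      fix e :: real assume "e > 0"
      then show "s * measure lborel E \<le> r * measure lborel E + e" using *[of "e / r"] True by (simp add: distrib_left)
    qed
    then have "measure lborel E = 0" using assms(3) by (smt (verit) measure_nonneg mult_strict_right_mono)
    then have "E \<in> null_sets lborel"
      using fin E by (simp add: null_sets_def emeasure_eq_ennreal_measure less_top)
    then show "negligible (?A \<inter> ?B \<inter> cbox a b)"
      using E by (simp add: E_def negligible_iff_null_sets null_sets_completion_iff)
  qed
qed

text \<open>Off the exceptional sets for rational \<open>r < s\<close>, all straddling quotients at
  \<open>t\<close> converge to the infimum \<open>D\<close> of \<open>S\<close>. The Lipschitz bound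
  makes \<open>S\<close> nonempty and monotonicity bounds it below.\<close>

lemma mono_lipschitz_ae_differentiable:
  fixes f :: "real \<Rightarrow> real"
  assumes "mono f" and lip: "\<And>s t. \<bar>f s - f t\<bar> \<le> L * \<bar>s - t\<bar>"
  obtains N where "negligible N" "\<And>t. t \<notin> N \<Longrightarrow> \<exists>d. (f has_real_derivative d) (at t)"
proof -
  have "0 \<le> L" using lip[of 1 0] by simp
  then have cont: "continuous_on A f" for A
    by (intro lipschitz_on_continuous_on[of L]) (auto simp: lipschitz_on_def dist_real_def lip)
  define A where "A r = {t. \<forall>\<epsilon>>0. \<exists>u v. u < t \<and> t < v \<and> v - u < \<epsilon> \<and> f v - f u < r * (v - u)}" for r
  define B where "B s = {t. \<forall>\<epsilon>>0. \<exists>u v. u < t \<and> t < v \<and> v - u < \<epsilon> \<and> f v - f u > s * (v - u)}" for s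
  define N where "N = (\<Union>(r,s)\<in>{(r,s). r \<in> \<rat> \<and> s \<in> \<rat> \<and> r < s}. A r \<inter> B s)"
  have "negligible N"
  proof -
    have "countable {(r,s). r \<in> \<rat> \<and> s \<in> \<rat> \<and> r < (s::real)}"
      by (rule countable_subset[of _ "\<rat> \<times> \<rat>"]) (auto intro: countable_rat)
    moreover have "negligible (A r \<inter> B s)" if "r < s" for r s
      unfolding A_def B_def by (rule mono_straddle_quotients_negligible[OF assms(1) cont that])
    ultimately show ?thesis
      unfolding N_def by (intro negligible_countable_Union) auto
  qed
  moreover have "\<exists>d. (f has_real_derivative d) (at t)" if t: "t \<notin> N" for t
  proof -
    define S where "S = {s\<in>\<rat>. t \<notin> B s}"
    have Lmem: "s \<in> S" if "s \<in> \<rat>" "s \<ge> L" for s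
    proof -
      have "\<not> (f v - f u > s * (v - u))" if "u < v" for u v
      proof -
        have "f v - f u \<le> L * \<bar>v - u\<bar>" using lip[of v u] by linarith
        also have "\<dots> \<le> s * (v - u)" using \<open>s \<ge> L\<close> \<open>u < v\<close> by (simp add: mult_right_mono)
        finally show ?thesis by simp
      qed
      then show ?thesis using that unfolding S_def B_def by (auto intro!: exI[of _ 1])
    qed
    obtain s0 where "s0 \<in> \<rat>" "L < s0" using Rats_no_top_le Rats_dense_in_real by (metis less_add_one)
    then have ne: "S \<noteq> {}" using Lmem[of s0] by auto
    have lb: "0 \<le> s" if "s \<in> S" for s
    proof (rule ccontr)
      assume "\<not> 0 \<le> s"
      then have *: "f v - f u > s * (v - u)" if "u < v" for u v
        using assms(1) that mult_neg_pos[of s "v - u"] by (smt (verit) monoD)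
      have "t \<in> B s" unfolding B_def
      proof (intro CollectI allI impI)
        fix \<epsilon> :: real assume "\<epsilon> > 0"
        then have "t - \<epsilon>/3 < t" "t < t + \<epsilon>/3" "(t + \<epsilon>/3) - (t - \<epsilon>/3) < \<epsilon>" by simp_all
        moreover from this have "s * ((t + \<epsilon>/3) - (t - \<epsilon>/3)) < f (t + \<epsilon>/3) - f (t - \<epsilon>/3)"
          by (intro *) linarith
        ultimately show "\<exists>u v. u < t \<and> t < v \<and> v - u < \<epsilon> \<and> s * (v - u) < f v - f u"
          by (intro exI conjI)
      qed
      with that show False by (simp add: S_def)
    qed
    have bdd: "bdd_below S" by (rule bdd_belowI[of _ 0]) (rule lb)
    define D where "D = Inf S"
    have straddle: "\<exists>\<delta>>0. \<forall>u v. u < t \<longrightarrow> t < v \<longrightarrow> v - u < \<delta> \<longrightarrow> \<bar>f v - f u - D * (v - u)\<bar> \<le> \<epsilon> * (v - u)"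
      if \<epsilon>: "\<epsilon> > 0" for \<epsilon>
    proof -
      obtain s where s: "s \<in> S" "s < D + \<epsilon>"
        using cInf_lessD[OF ne, of "D + \<epsilon>"] \<epsilon> by (auto simp: D_def)
      obtain \<delta>1 where \<delta>1: "\<delta>1 > 0" "\<And>u v. u < t \<Longrightarrow> t < v \<Longrightarrow> v - u < \<delta>1 \<Longrightarrow> f v - f u \<le> s * (v - u)"
        using s(1) unfolding S_def B_def by (force simp: not_less)
      \<comment> \<open>\<open>s'\<close> is below the infimum of \<open>S\<close>, so quotients
        above \<open>s'\<close> occur arbitrarily close to \<open>t\<close>; as \<open>t\<close>
        avoids \<open>N\<close>, quotients below the smaller rational \<open>r\<close>
        cannot.\<close>
      obtain s' where s': "s' \<in> \<rat>" "D - \<epsilon>/2 < s'" "s' < D"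
        using Rats_dense_in_real[of "D - \<epsilon>/2" D] \<epsilon> by auto
      obtain r where r: "r \<in> \<rat>" "D - \<epsilon> < r" "r < s'"
        using Rats_dense_in_real[of "D - \<epsilon>" s'] \<epsilon> s' by force
      have "s' \<notin> S" using s' cInf_lower[OF _ bdd, of s'] by (auto simp: D_def)
      then have "t \<in> B s'" using s' by (simp add: S_def)
      then have "t \<notin> A r" using t r s' unfolding N_def by blast
      then obtain \<delta>2 where \<delta>2: "\<delta>2 > 0" "\<And>u v. u < t \<Longrightarrow> t < v \<Longrightarrow> v - u < \<delta>2 \<Longrightarrow> f v - f u \<ge> r * (v - u)"
        unfolding A_def by (force simp: not_less)
      show ?thesis
      proof (intro exI[of _ "min \<delta>1 \<delta>2"] conjI allI impI)
        fix u v assume uv: "u < t" "t < v" "v - u < min \<delta>1 \<delta>2"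
        have "f v - f u \<le> s * (v - u)" "f v - f u \<ge> r * (v - u)" using \<delta>1(2) \<delta>2(2) uv by auto
        moreover have "s * (v - u) \<le> (D + \<epsilon>) * (v - u)" "(D - \<epsilon>) * (v - u) \<le> r * (v - u)"
          using s r uv by (auto intro!: mult_right_mono)
        ultimately show "\<bar>f v - f u - D * (v - u)\<bar> \<le> \<epsilon> * (v - u)"
          by (simp add: abs_le_iff algebra_simps)
      qed (use \<delta>1 \<delta>2 in auto)
    qed
    have "(f has_derivative (\<lambda>h. D * h)) (at t)"
      unfolding has_derivative_within_alt
    proof (intro conjI allI impI)
      show "bounded_linear ((*) D)" by (rule bounded_linear_mult_right)
      fix \<epsilon> :: real assume "\<epsilon> > 0"
      then obtain \<delta> where \<delta>: "\<delta> > 0" "\<And>u v. u < t \<Longrightarrow> t < v \<Longrightarrow> v - u < \<delta> \<Longrightarrow> \<bar>f v - f u - D * (v - u)\<bar> \<le> \<epsilon> * (v - u)"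
        using straddle[of \<epsilon>] by auto
      have "\<bar>f y - f t - D * (y - t)\<bar> \<le> \<epsilon> * \<bar>y - t\<bar>" if "\<bar>y - t\<bar> < \<delta>" for y
      proof -
        consider "y = t" | "y > t" | "y < t" by linarith
        then show ?thesis
        proof cases
          \<comment> \<open>Put \<open>v = y\<close> in the straddling estimate and let
            \<open>u\<close> tend to \<open>t\<close> from the left; continuity of \<open>f\<close>
            turns it into an estimate for the one-sided quotient.\<close>
          case 2
          have lim: "(f \<longlongrightarrow> f t) (at_left t)"
            using cont[of UNIV] by (simp add: continuous_on_eq_continuous_at isCont_def filterlim_at_split)
          have "((\<lambda>u. \<bar>f y - f u - D * (y - u)\<bar>) \<longlongrightarrow> \<bar>f y - f t - D * (y - t)\<bar>) (at_left t)"
            by (intro tendsto_intros lim)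
          moreover have "((\<lambda>u. \<epsilon> * (y - u)) \<longlongrightarrow> \<epsilon> * (y - t)) (at_left t)" by (intro tendsto_intros)
          moreover have "\<forall>\<^sub>F u in at_left t. \<bar>f y - f u - D * (y - u)\<bar> \<le> \<epsilon> * (y - u)"
            using eventually_at_left_real[of "y - \<delta>" t] that 2
            by (auto elim!: eventually_mono intro!: \<delta>(2))
          ultimately show ?thesis using 2 tendsto_le[OF trivial_limit_at_left_real] by fastforce
        next
          case 3
          have lim: "(f \<longlongrightarrow> f t) (at_right t)"
            using cont[of UNIV] by (simp add: continuous_on_eq_continuous_at isCont_def filterlim_at_split)
          have "((\<lambda>v. \<bar>f v - f y - D * (v - y)\<bar>) \<longlongrightarrow> \<bar>f t - f y - D * (t - y)\<bar>) (at_right t)"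
            by (intro tendsto_intros lim)
          moreover have "((\<lambda>v. \<epsilon> * (v - y)) \<longlongrightarrow> \<epsilon> * (t - y)) (at_right t)" by (intro tendsto_intros)
          moreover have "\<forall>\<^sub>F v in at_right t. \<bar>f v - f y - D * (v - y)\<bar> \<le> \<epsilon> * (v - y)"
            using eventually_at_right_real[of t "y + \<delta>"] that 3
            by (auto elim!: eventually_mono intro!: \<delta>(2))
          ultimately have "\<bar>f t - f y - D * (t - y)\<bar> \<le> \<epsilon> * (t - y)"
            using tendsto_le[OF trivial_limit_at_right_real] by fastforce
          moreover have "f t - f y - D * (t - y) = - (f y - f t - D * (y - t))" by (simp add: algebra_simps)
          ultimately show ?thesis using 3 by simp
        qed simp
      qed
      then show "\<exists>d>0. \<forall>y\<in>UNIV. norm (y - t) < d \<longrightarrow> norm (f y - f t - D * (y - t)) \<le> \<epsilon> * norm (y - t)"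
        using \<delta>(1) by (intro exI[of _ \<delta>]) simp
    qed
    then show ?thesis by (auto simp: has_field_derivative_def)
  qed
  ultimately show thesis using that by blast
qed

theorem lipschitz_on_ae_differentiable:
  fixes f :: "real \<Rightarrow> 'a::euclidean_space"
  assumes "L-lipschitz_on {a..b} f"
  obtains N where "negligible N" "\<And>t. t \<in> {a..b} - N \<Longrightarrow> \<exists>d. (f has_vector_derivative d) (at t within {a..b})"
proof (cases "a \<le> b")
  case False
  then show thesis by (intro that[of "{}"]) auto
next
  case True
  \<comment> \<open>Clamping the argument extends \<open>f\<close> to the whole line with the same
    Lipschitz constant, and the summand \<open>L * t\<close> makes every coordinate
    nondecreasing.\<close>
  define g where "g i t = f (max a (min b t)) \<bullet> i + L * t" for i t
  have "0 \<le> L" using assms lipschitz_on_nonneg by blast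
  have lip: "\<bar>f (max a (min b s)) \<bullet> i - f (max a (min b t)) \<bullet> i\<bar> \<le> L * \<bar>s - t\<bar>" if "i \<in> Basis" for i s t
  proof -
    have "\<bar>f (max a (min b s)) \<bullet> i - f (max a (min b t)) \<bullet> i\<bar> \<le> dist (f (max a (min b s))) (f (max a (min b t)))"
      using Basis_le_norm[OF that, of "f (max a (min b s)) - f (max a (min b t))"]
      by (simp add: inner_diff_left dist_norm)
    also have "\<dots> \<le> L * dist (max a (min b s)) (max a (min b t))"
      using True by (intro lipschitz_onD[OF assms]) auto
    also have "\<dots> \<le> L * \<bar>s - t\<bar>" using \<open>0 \<le> L\<close> by (intro mult_left_mono) (auto simp: dist_real_def)
    finally show ?thesis .
  qed
  have Nex: "\<exists>N. negligible N \<and> (\<forall>t. t \<notin> N \<longrightarrow> (\<exists>d. (g i has_real_derivative d) (at t)))" if "i \<in> Basis" for i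
  proof -
    have m: "mono (g i)"
    proof (rule monoI)
      fix s t :: real assume "s \<le> t"
      then have "\<bar>s - t\<bar> = t - s" by simp
      then show "g i s \<le> g i t" using lip[OF that, of s t] by (simp add: g_def abs_le_iff right_diff_distrib)
    qed
    have l: "\<bar>g i s - g i t\<bar> \<le> (2 * L) * \<bar>s - t\<bar>" for s t
    proof -
      have "g i s - g i t = (f (max a (min b s)) \<bullet> i - f (max a (min b t)) \<bullet> i) + L * (s - t)"
        by (simp add: g_def algebra_simps)
      moreover have "\<bar>L * (s - t)\<bar> = L * \<bar>s - t\<bar>" using \<open>0 \<le> L\<close> by (simp add: abs_mult)
      ultimately show ?thesis using lip[OF that, of s t]
          abs_triangle_ineq[of "f (max a (min b s)) \<bullet> i - f (max a (min b t)) \<bullet> i" "L * (s - t)"] by simp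
    qed
    obtain N where "negligible N" "\<And>t. t \<notin> N \<Longrightarrow> \<exists>d. (g i has_real_derivative d) (at t)"
      by (rule mono_lipschitz_ae_differentiable[OF m l]) (rule that)
    then show ?thesis by (intro exI[of _ N] conjI allI impI)
  qed
  have "\<exists>N. \<forall>i\<in>Basis. negligible (N i) \<and> (\<forall>t. t \<notin> N i \<longrightarrow> (\<exists>d. (g i has_real_derivative d) (at t)))"
    by (rule bchoice) (intro ballI Nex)
  then obtain N where N: "\<forall>i\<in>Basis. negligible (N i) \<and> (\<forall>t. t \<notin> N i \<longrightarrow> (\<exists>d. (g i has_real_derivative d) (at t)))" ..
  show thesis
  proof (rule that)
    show "negligible (\<Union>i\<in>Basis. N i)" using N by (intro negligible_Union) auto
    fix t assume t: "t \<in> {a..b} - (\<Union>i\<in>Basis. N i)"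
    then have "\<exists>d. (g i has_real_derivative d) (at t)" if "i \<in> Basis" for i using N[rule_format, OF that] that by simp
    then have "\<exists>d. \<forall>i\<in>Basis. (g i has_real_derivative d i) (at t)" by (intro bchoice) simp
    then obtain d where "\<forall>i\<in>Basis. (g i has_real_derivative d i) (at t)" ..
    then have d: "(g i has_real_derivative d i) (at t)" if "i \<in> Basis" for i using that by simp
    have "((\<lambda>s. f s \<bullet> i) has_derivative (\<lambda>h. (h *\<^sub>R (\<Sum>i\<in>Basis. (d i - L) *\<^sub>R i)) \<bullet> i)) (at t within {a..b})" if i: "i \<in> Basis" for i
    proof -
      have "((\<lambda>s. g i s - L * s) has_real_derivative d i - L) (at t within {a..b})"
        by (auto intro!: derivative_eq_intros has_field_derivative_at_within[OF d[OF i]])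
      then have "((\<lambda>s. f s \<bullet> i) has_real_derivative d i - L) (at t within {a..b})"
        by (rule has_field_derivative_transform_within[where d = 1]) (use t in \<open>auto simp: g_def max_def min_def\<close>)
      then show ?thesis using i
        by (simp add: has_field_derivative_def mult_commute_abs)
    qed
    then have "(f has_vector_derivative (\<Sum>i\<in>Basis. (d i - L) *\<^sub>R i)) (at t within {a..b})"
      unfolding has_vector_derivative_def by (subst has_derivative_componentwise_within) auto
    then show "\<exists>d. (f has_vector_derivative d) (at t within {a..b})" by blast
  qed
qed

subsection \<open>Support functions\<close>

definition support_fun :: "'a::real_inner set \<Rightarrow> 'a \<Rightarrow> real" where
  "support_fun K u = Sup ((\<lambda>w. u \<bullet> w) ` K)"

lemma bdd_above_inner_image: "bounded K \<Longrightarrow> bdd_above ((\<lambda>w. u \<bullet> w) ` K)"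
  by (intro bounded_imp_bdd_above bounded_linear_image[of K "\<lambda>w. u \<bullet> w"] bounded_linear_inner_right)

lemma support_fun_ge: "bounded K \<Longrightarrow> w \<in> K \<Longrightarrow> u \<bullet> w \<le> support_fun K u"
  unfolding support_fun_def by (rule cSup_upper) (auto intro: bdd_above_inner_image)

lemma support_fun_le: "K \<noteq> {} \<Longrightarrow> (\<And>w. w \<in> K \<Longrightarrow> u \<bullet> w \<le> c) \<Longrightarrow> support_fun K u \<le> c"
  unfolding support_fun_def by (rule cSup_least) auto

lemma support_fun_attained:
  assumes "compact K" "K \<noteq> {}"
  obtains w where "w \<in> K" "support_fun K u = u \<bullet> w"
proof -
  have "continuous_on K (\<lambda>w. u \<bullet> w)" by (intro continuous_intros)
  from continuous_attains_sup[OF assms this] obtain w where w: "w \<in> K" "\<And>y. y \<in> K \<Longrightarrow> u \<bullet> y \<le> u \<bullet> w"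
    by auto
  have "support_fun K u = u \<bullet> w"
    using support_fun_le[OF assms(2) w(2)] support_fun_ge[OF compact_imp_bounded[OF assms(1)] w(1)]
    by (rule antisym)
  with w(1) show thesis by (rule that)
qed

lemma support_fun_nonneg: "bounded K \<Longrightarrow> 0 \<in> K \<Longrightarrow> 0 \<le> support_fun K u"
  using support_fun_ge[of K 0 u] by simp

lemma support_fun_scaleR:
  assumes "compact K" "K \<noteq> {}" "0 \<le> c"
  shows "support_fun K (c *\<^sub>R u) = c * support_fun K u"
proof (rule antisym)
  show "support_fun K (c *\<^sub>R u) \<le> c * support_fun K u"
    using assms by (intro support_fun_le) (auto intro!: mult_left_mono support_fun_ge compact_imp_bounded)
  obtain w where "w \<in> K" "support_fun K u = u \<bullet> w" using support_fun_attained assms by blast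
  then show "c * support_fun K u \<le> support_fun K (c *\<^sub>R u)"
    using support_fun_ge[of K w "c *\<^sub>R u"] assms by (simp add: compact_imp_bounded)
qed

lemma support_fun_lipschitz:
  assumes "compact K" "K \<noteq> {}" "\<And>w. w \<in> K \<Longrightarrow> norm w \<le> R"
  shows "\<bar>support_fun K u - support_fun K v\<bar> \<le> R * norm (u - v)"
proof -
  have *: "support_fun K u - support_fun K v \<le> R * norm (u - v)" for u v
  proof -
    obtain w where w: "w \<in> K" "support_fun K u = u \<bullet> w" using support_fun_attained assms by blast
    have "support_fun K u - support_fun K v \<le> u \<bullet> w - v \<bullet> w"
      using w support_fun_ge[of K w v] assms(1) by (simp add: compact_imp_bounded)
    also have "\<dots> = (u - v) \<bullet> w" by (simp add: inner_diff_left)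
    also have "\<dots> \<le> norm (u - v) * norm w" by (rule norm_cauchy_schwarz)
    also have "\<dots> \<le> R * norm (u - v)" using assms(3)[OF w(1)] by (simp add: mult.commute mult_right_mono)
    finally show ?thesis .
  qed
  show ?thesis using *[of u v] *[of v u] by (simp add: abs_le_iff norm_minus_commute)
qed

lemma compact_norm_bound:
  assumes "compact (K :: 'a::real_normed_vector set)"
  obtains R where "R > 0" "\<And>w. w \<in> K \<Longrightarrow> norm w \<le> R"
  using compact_imp_bounded[OF assms] unfolding bounded_pos by blast

lemma continuous_on_support_fun:
  assumes "compact K" "K \<noteq> {}" shows "continuous_on A (support_fun K)"
proof -
  obtain R where "R > 0" "\<And>w. w \<in> K \<Longrightarrow> norm w \<le> R" using compact_norm_bound[OF assms(1)] by blast
  then have "R-lipschitz_on A (support_fun K)"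
    using support_fun_lipschitz[OF assms] by (auto simp: lipschitz_on_def dist_norm)
  then show ?thesis by (rule lipschitz_on_continuous_on)
qed

lemma absolutely_integrable_support_fun:
  fixes v :: "real \<Rightarrow> 'a::euclidean_space"
  assumes "compact K" "K \<noteq> {}" "v absolutely_integrable_on {a..b}"
  shows "(\<lambda>t. support_fun K (v t)) absolutely_integrable_on {a..b}"
proof -
  obtain R where R: "R > 0" "\<And>w. w \<in> K \<Longrightarrow> norm w \<le> R" using compact_norm_bound[OF assms(1)] by blast
  have v: "v integrable_on {a..b}" "(\<lambda>t. norm (v t)) integrable_on {a..b}"
    using assms(3) by (auto simp: absolutely_integrable_on_def)
  have s0: "support_fun K 0 = 0" using support_fun_scaleR[of K 0 0] assms by simp
  show ?thesis
  proof (rule measurable_bounded_by_integrable_imp_absolutely_integrable)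
    show "(\<lambda>t. support_fun K (v t)) \<in> borel_measurable (lebesgue_on {a..b})"
      by (rule borel_measurable_continuous_on[OF continuous_on_support_fun[OF assms(1,2)]])
        (rule integrable_imp_measurable[OF v(1)])
    show "(\<lambda>t. R * norm (v t)) integrable_on {a..b}" using integrable_on_cmult_left[OF v(2)] by simp
    show "norm (support_fun K (v t)) \<le> R * norm (v t)" for t
      using support_fun_lipschitz[OF assms(1,2) R(2), of "v t" 0] s0 by simp
  qed simp
qed

lemma absolutely_integrable_inner:
  fixes y v :: "real \<Rightarrow> 'a::euclidean_space"
  assumes "continuous_on {a..b} y" "v absolutely_integrable_on {a..b}"
  shows "(\<lambda>t. y t \<bullet> v t) absolutely_integrable_on {a..b}"
proof -
  have "compact (y ` {a..b})" using assms(1) by (intro compact_continuous_image) auto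
  then obtain R where R: "R > 0" "\<And>w. w \<in> y ` {a..b} \<Longrightarrow> norm w \<le> R"
    by (rule compact_norm_bound) (rule that)
  have v: "v integrable_on {a..b}" "(\<lambda>t. norm (v t)) integrable_on {a..b}"
    using assms(2) by (auto simp: absolutely_integrable_on_def)
  show ?thesis
  proof (rule measurable_bounded_by_integrable_imp_absolutely_integrable)
    show "(\<lambda>t. y t \<bullet> v t) \<in> borel_measurable (lebesgue_on {a..b})"
      using assms(1) by (intro borel_measurable_inner integrable_imp_measurable[OF v(1)]
          continuous_imp_measurable_on_sets_lebesgue) auto
    show "(\<lambda>t. R * norm (v t)) integrable_on {a..b}" using integrable_on_cmult_left[OF v(2)] by simp
    fix t assume t: "t \<in> {a..b}"
    have "norm (y t \<bullet> v t) \<le> norm (y t) * norm (v t)" using Cauchy_Schwarz_ineq2 by simp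
    also have "\<dots> \<le> R * norm (v t)" using R t by (intro mult_right_mono) auto
    finally show "norm (y t \<bullet> v t) \<le> R * norm (v t)" .
  qed simp
qed

subsection \<open>Curves and their area\<close>

lemma linear_cstruct: "linear cstruct"
  by (rule linearI) (auto simp: cstruct_def)

lemma bounded_linear_cstruct: "bounded_linear cstruct"
  by (rule linear_conv_bounded_linear[THEN iffD1, OF linear_cstruct])

lemmas cstruct_simps [simp] =
  linear_0[OF linear_cstruct] linear_add[OF linear_cstruct] linear_diff[OF linear_cstruct]
  linear_neg[OF linear_cstruct] linear_cmul[OF linear_cstruct]

lemma cstruct_cstruct [simp]: "cstruct (cstruct z) = - z"
  by (simp add: cstruct_def prod_eq_iff)

lemma inner_cstruct: "cstruct z \<bullet> w = - (z \<bullet> cstruct w)"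
  by (simp add: cstruct_def inner_prod_def)

lemma inner_cstruct_self [simp]: "z \<bullet> cstruct z = 0"
  using inner_cstruct[of z z] by (simp add: inner_commute)

lemma norm_cstruct [simp]: "norm (cstruct z) = norm z"
  by (simp add: norm_eq_sqrt_inner inner_cstruct)

lemma omega_minus_cstruct: "omega z w = - (z \<bullet> cstruct w)"
  using omega_cstruct[of z "cstruct w"] by (simp add: omega_def)

lemma omega_diff_right: "omega z (w - w') = omega z w - omega z w'"
  by (simp add: omega_minus_cstruct inner_diff_right)

lemma omega_self [simp]: "omega z z = 0"
  by (simp add: omega_minus_cstruct)

lemma omega_commute: "omega z w = - omega w z"
  by (simp add: omega_def inner_commute)

text \<open>
  Velocities are recorded after rotation by \<open>- J\<close>: a closed characteristic has its rotated velocity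
  in the normal cone, and the area form becomes an inner product.
\<close>

definition rot_velocity :: "(real \<Rightarrow> 'n::finite phase) \<Rightarrow> (real \<Rightarrow> 'n phase) \<Rightarrow> bool" where
  "rot_velocity x v \<longleftrightarrow> v absolutely_integrable_on {0..1} \<and>
     (\<forall>t\<in>{0..1}. x t = x 0 + cstruct (integral {0..t} v))"

definition area :: "(real \<Rightarrow> 'n::finite phase) \<Rightarrow> (real \<Rightarrow> 'n phase) \<Rightarrow> real" where
  "area x v = integral {0..1} (\<lambda>t. x t \<bullet> v t) / 2"

lemma rot_velocity_eq: "rot_velocity x v \<Longrightarrow> t \<in> {0..1} \<Longrightarrow> x t = x 0 + cstruct (integral {0..t} v)"
  unfolding rot_velocity_def by blast

lemma rot_velocity_integrable:
  assumes "rot_velocity x v" "0 \<le> a" "b \<le> 1"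
  shows "v absolutely_integrable_on {a..b}" "v integrable_on {a..b}" "(\<lambda>t. norm (v t)) integrable_on {a..b}"
proof -
  show *: "v absolutely_integrable_on {a..b}"
    using assms by (auto simp: rot_velocity_def intro: absolutely_integrable_on_subinterval)
  then show "v integrable_on {a..b}" "(\<lambda>t. norm (v t)) integrable_on {a..b}"
    by (auto simp: absolutely_integrable_on_def)
qed

lemma rot_velocity_diff:
  assumes "rot_velocity x v" "0 \<le> a" "a \<le> b" "b \<le> 1"
  shows "x b - x a = cstruct (integral {a..b} v)"
proof -
  have "integral {0..a} v + integral {a..b} v = integral {0..b} v"
    using assms rot_velocity_integrable(2)[OF assms(1), of 0 b]
    by (intro Henstock_Kurzweil_Integration.integral_combine) auto
  moreover have "x a = x 0 + cstruct (integral {0..a} v)" "x b = x 0 + cstruct (integral {0..b} v)"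
    using assms by (auto intro: rot_velocity_eq)
  ultimately have "x b - x a = cstruct (integral {0..a} v + integral {a..b} v) - cstruct (integral {0..a} v)"
    by simp
  then show ?thesis by simp
qed

lemma rot_velocity_continuous:
  assumes "rot_velocity x v" shows "continuous_on {0..1} x"
proof -
  have "continuous_on {0..1} (\<lambda>t. x 0 + cstruct (integral {0..t} v))"
    by (intro continuous_intros bounded_linear.continuous_on[OF bounded_linear_cstruct]
        indefinite_integral_continuous_1 rot_velocity_integrable[OF assms]) auto
  then show ?thesis
    by (rule continuous_on_eq) (rule rot_velocity_eq[OF assms, symmetric])
qed

lemma rot_velocity_closed: "rot_velocity x v \<Longrightarrow> x 0 = x 1 \<Longrightarrow> integral {0..1} v = 0"
  using rot_velocity_diff[of x v 0 1] norm_cstruct[of "integral {0..1} v"] by simp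

section \<open>Riemann-Stieltjes sums and the symmetry of the area form\<close>

lemma integral_partition:
  fixes f :: "real \<Rightarrow> 'a::banach"
  assumes "\<And>i. i < N \<Longrightarrow> p i \<le> p (Suc i)" "f integrable_on {p 0..p N}"
  shows "integral {p 0..p N} f = (\<Sum>i<N. integral {p i..p (Suc i)} f)" "p 0 \<le> p N"
proof -
  have "integral {p 0..p n} f = (\<Sum>i<n. integral {p i..p (Suc i)} f) \<and> p 0 \<le> p n" if "n \<le> N" for n
    using that
  proof (induction n)
    case (Suc n)
    have m: "p (Suc n) \<le> p N"
    proof -
      have "p (Suc n) \<le> p k" if "Suc n \<le> k" "k \<le> N" for k
        using that
      proof (induction k rule: dec_induct)
        case (step k)
        then show ?case using assms(1)[of k] by simp
      qed simp
      then show ?thesis using Suc by simp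
    qed
    have "integral {p 0..p n} f + integral {p n..p (Suc n)} f = integral {p 0..p (Suc n)} f"
      using Suc m assms by (intro Henstock_Kurzweil_Integration.integral_combine)
        (auto intro: integrable_on_subinterval)
    then show ?case using Suc assms(1)[of n] by auto
  qed simp
  then show "integral {p 0..p N} f = (\<Sum>i<N. integral {p i..p (Suc i)} f)" "p 0 \<le> p N" by auto
qed

text \<open>The sum sees \<open>y\<close> only through its increments. This makes areas comparable
  between different parametrisations of a curve and between a limit curve and its approximations.
  The sample values \<open>\<zeta>\<close> are free, and steps of length zero are allowed.\<close>

lemma riemann_stieltjes_sum:
  fixes p :: "nat \<Rightarrow> real"
  assumes y: "rot_velocity y w" and z: "continuous_on {0..1} z"
    and p: "p 0 = 0" "p N = 1" "\<And>i. i < N \<Longrightarrow> p i \<le> p (Suc i)"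
    and \<epsilon>: "\<And>i s. i < N \<Longrightarrow> s \<in> {p i..p (Suc i)} \<Longrightarrow> norm (z s - \<zeta> i) \<le> \<epsilon>"
  shows "\<bar>integral {0..1} (\<lambda>t. z t \<bullet> w t) - (\<Sum>i<N. omega (\<zeta> i) (y (p (Suc i)) - y (p i)))\<bar>
           \<le> \<epsilon> * integral {0..1} (\<lambda>t. norm (w t))"
proof -
  have mono: "p i \<le> p j" if "i \<le> j" "j \<le> N" for i j
    using that
  proof (induction j rule: dec_induct)
    case (step k)
    then show ?case using p(3)[of k] by simp
  qed simp
  have rng: "0 \<le> p i" "p i \<le> 1" if "i \<le> N" for i
    using mono[of 0 i] mono[of i N] p that by auto
  have zw: "(\<lambda>t. z t \<bullet> w t) integrable_on {0..1}"
    using absolutely_integrable_inner[OF z rot_velocity_integrable(1)[OF y, of 0 1]]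
    by (auto simp: absolutely_integrable_on_def)
  have nw: "(\<lambda>t. norm (w t)) integrable_on {0..1}" using rot_velocity_integrable(3)[OF y] by simp
  have 1: "integral {0..1} (\<lambda>t. z t \<bullet> w t) = (\<Sum>i<N. integral {p i..p (Suc i)} (\<lambda>t. z t \<bullet> w t))"
    using integral_partition(1)[of N p "\<lambda>t. z t \<bullet> w t"] p zw by auto
  have 2: "integral {0..1} (\<lambda>t. norm (w t)) = (\<Sum>i<N. integral {p i..p (Suc i)} (\<lambda>t. norm (w t)))"
    using integral_partition(1)[of N p "\<lambda>t. norm (w t)"] p nw by auto
  have "\<bar>integral {p i..p (Suc i)} (\<lambda>t. z t \<bullet> w t) - omega (\<zeta> i) (y (p (Suc i)) - y (p i))\<bar>
      \<le> \<epsilon> * integral {p i..p (Suc i)} (\<lambda>t. norm (w t))" if i: "i < N" for i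
  proof -
    have r: "0 \<le> p i" "p i \<le> p (Suc i)" "p (Suc i) \<le> 1" using rng[of i] rng[of "Suc i"] p(3) i by auto
    then have sub: "{p i..p (Suc i)} \<subseteq> {0..1}" by auto
    note wi = rot_velocity_integrable[OF y r(1,3)]
    have zwi: "(\<lambda>t. z t \<bullet> w t) integrable_on {p i..p (Suc i)}" using integrable_on_subinterval[OF zw sub] .
    have \<zeta>w: "((\<lambda>t. \<zeta> i \<bullet> w t) has_integral \<zeta> i \<bullet> integral {p i..p (Suc i)} w) {p i..p (Suc i)}"
      using has_integral_linear[OF integrable_integral[OF wi(2)] bounded_linear_inner_right[of "\<zeta> i"]]
      by (simp add: o_def)
    have "omega (\<zeta> i) (y (p (Suc i)) - y (p i)) = \<zeta> i \<bullet> integral {p i..p (Suc i)} w"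
      using rot_velocity_diff[OF y r] by (simp add: omega_cstruct)
    also have "\<dots> = integral {p i..p (Suc i)} (\<lambda>t. \<zeta> i \<bullet> w t)" using \<zeta>w by (simp add: integral_unique)
    finally have "integral {p i..p (Suc i)} (\<lambda>t. z t \<bullet> w t) - omega (\<zeta> i) (y (p (Suc i)) - y (p i))
        = integral {p i..p (Suc i)} (\<lambda>t. (z t - \<zeta> i) \<bullet> w t)"
      using Henstock_Kurzweil_Integration.integral_diff[OF zwi has_integral_integrable[OF \<zeta>w]]
      by (simp add: inner_diff_left)
    moreover have "norm (integral {p i..p (Suc i)} (\<lambda>t. (z t - \<zeta> i) \<bullet> w t))
        \<le> integral {p i..p (Suc i)} (\<lambda>t. \<epsilon> * norm (w t))"
    proof (rule Henstock_Kurzweil_Integration.integral_norm_bound_integral)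
      show "(\<lambda>t. (z t - \<zeta> i) \<bullet> w t) integrable_on {p i..p (Suc i)}"
        using Henstock_Kurzweil_Integration.integrable_diff[OF zwi has_integral_integrable[OF \<zeta>w]]
        by (simp add: inner_diff_left)
      show "(\<lambda>t. \<epsilon> * norm (w t)) integrable_on {p i..p (Suc i)}"
        using integrable_on_cmult_left[OF wi(3)] by simp
      fix t assume t: "t \<in> {p i..p (Suc i)}"
      have "norm ((z t - \<zeta> i) \<bullet> w t) \<le> norm (z t - \<zeta> i) * norm (w t)" using Cauchy_Schwarz_ineq2 by simp
      also have "\<dots> \<le> \<epsilon> * norm (w t)" using \<epsilon>[OF i t] by (rule mult_right_mono) simp
      finally show "norm ((z t - \<zeta> i) \<bullet> w t) \<le> \<epsilon> * norm (w t)" .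
    qed
    ultimately show ?thesis by simp
  qed
  then have "(\<Sum>i<N. \<bar>integral {p i..p (Suc i)} (\<lambda>t. z t \<bullet> w t) - omega (\<zeta> i) (y (p (Suc i)) - y (p i))\<bar>)
      \<le> (\<Sum>i<N. \<epsilon> * integral {p i..p (Suc i)} (\<lambda>t. norm (w t)))"
    by (intro sum_mono) auto
  then show ?thesis unfolding 1 2
    using sum_abs[of "\<lambda>i. integral {p i..p (Suc i)} (\<lambda>t. z t \<bullet> w t) - omega (\<zeta> i) (y (p (Suc i)) - y (p i))" "{..<N}"]
    by (simp add: sum_subtractf sum_distrib_left)
qed

lemma uniform_partition:
  fixes x :: "real \<Rightarrow> 'a::real_normed_vector"
  assumes "continuous_on {0..1} x" "\<epsilon> > 0"
  obtains N :: nat where "N > 0"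
    "\<And>s t. s \<in> {0..1} \<Longrightarrow> t \<in> {0..1} \<Longrightarrow> \<bar>s - t\<bar> \<le> 1 / real N \<Longrightarrow> norm (x s - x t) \<le> \<epsilon>"
proof -
  have "uniformly_continuous_on {0..1} x" using assms by (intro compact_uniformly_continuous) auto
  then obtain d where d: "d > 0" "\<And>s t. s \<in> {0..1} \<Longrightarrow> t \<in> {0..1} \<Longrightarrow> dist s t < d \<Longrightarrow> dist (x s) (x t) < \<epsilon>"
    unfolding uniformly_continuous_on_def using assms(2) by metis
  obtain n where "1 / real (Suc n) < d" using d nat_approx_posE by blast
  then show thesis
    using d(2) by (intro that[of "Suc n"]) (force simp: dist_norm intro: less_imp_le)+
qed

text \<open>Integration by parts, carried out as summation by parts. Sampling \<open>x\<close> at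
  left end points and \<open>y\<close> at right end points makes the difference of the two sums
  telescope exactly, and the boundary term vanishes because both curves close up.\<close>

lemma area_bilinear_commute:
  assumes x: "rot_velocity x v" "x 0 = x 1" and y: "rot_velocity y w" "y 0 = y 1"
  shows "integral {0..1} (\<lambda>t. x t \<bullet> w t) = integral {0..1} (\<lambda>t. y t \<bullet> v t)"
proof -
  note cx = rot_velocity_continuous[OF x(1)] and cy = rot_velocity_continuous[OF y(1)]
  define A where "A = integral {0..1} (\<lambda>t. norm (w t)) + integral {0..1} (\<lambda>t. norm (v t))"
  have *: "\<bar>integral {0..1} (\<lambda>t. x t \<bullet> w t) - integral {0..1} (\<lambda>t. y t \<bullet> v t)\<bar> \<le> \<epsilon> * A" if \<epsilon>: "\<epsilon> > 0" for \<epsilon>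
  proof -
    obtain N1 :: nat where N1: "N1 > 0"
      "\<And>s t. s \<in> {0..1} \<Longrightarrow> t \<in> {0..1} \<Longrightarrow> \<bar>s - t\<bar> \<le> 1 / real N1 \<Longrightarrow> norm (x s - x t) \<le> \<epsilon>"
      using uniform_partition[OF cx \<epsilon>] by blast
    obtain N2 :: nat where N2: "N2 > 0"
      "\<And>s t. s \<in> {0..1} \<Longrightarrow> t \<in> {0..1} \<Longrightarrow> \<bar>s - t\<bar> \<le> 1 / real N2 \<Longrightarrow> norm (y s - y t) \<le> \<epsilon>"
      using uniform_partition[OF cy \<epsilon>] by blast
    define N where "N = max N1 N2"
    have N: "N > 0" "1 / real N \<le> 1 / real N1" "1 / real N \<le> 1 / real N2"
      using N1(1) N2(1) by (auto simp: N_def intro!: divide_left_mono)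
    define p where "p i = real i / real N" for i
    have p: "p 0 = 0" "p N = 1" "\<And>i. i < N \<Longrightarrow> p i \<le> p (Suc i)"
      using N(1) by (auto simp: p_def divide_right_mono)
    have near: "s \<in> {0..1} \<and> p i \<in> {0..1} \<and> p (Suc i) \<in> {0..1} \<and> \<bar>s - p i\<bar> \<le> 1 / real N \<and> \<bar>s - p (Suc i)\<bar> \<le> 1 / real N"
      if "i < N" "s \<in> {p i..p (Suc i)}" for i s
    proof -
      have "p (Suc i) - p i = 1 / real N" by (simp add: p_def diff_divide_distrib[symmetric])
      moreover have "0 \<le> p i" "p (Suc i) \<le> 1" using that(1) by (auto simp: p_def)
      ultimately show ?thesis using that(2) by auto
    qed
    have 1: "\<bar>integral {0..1} (\<lambda>t. x t \<bullet> w t) - (\<Sum>i<N. omega (x (p i)) (y (p (Suc i)) - y (p i)))\<bar>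
           \<le> \<epsilon> * integral {0..1} (\<lambda>t. norm (w t))"
    proof (rule riemann_stieltjes_sum[OF y(1) cx p])
      fix i s assume "i < N" "s \<in> {p i..p (Suc i)}"
      from near[OF this] show "norm (x s - x (p i)) \<le> \<epsilon>" using N by (intro N1(2)) auto
    qed
    have 2: "\<bar>integral {0..1} (\<lambda>t. y t \<bullet> v t) - (\<Sum>i<N. omega (y (p (Suc i))) (x (p (Suc i)) - x (p i)))\<bar>
           \<le> \<epsilon> * integral {0..1} (\<lambda>t. norm (v t))"
    proof (rule riemann_stieltjes_sum[OF x(1) cy p])
      fix i s assume "i < N" "s \<in> {p i..p (Suc i)}"
      from near[OF this] show "norm (y s - y (p (Suc i))) \<le> \<epsilon>" using N by (intro N2(2)) auto
    qed
    have "(\<Sum>i<N. omega (x (p i)) (y (p (Suc i)) - y (p i))) - (\<Sum>i<N. omega (y (p (Suc i))) (x (p (Suc i)) - x (p i)))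
        = (\<Sum>i<N. omega (x (p (Suc i))) (y (p (Suc i))) - omega (x (p i)) (y (p i)))"
      unfolding sum_subtractf[symmetric]
    proof (rule sum.cong[OF refl])
      fix i show "omega (x (p i)) (y (p (Suc i)) - y (p i)) - omega (y (p (Suc i))) (x (p (Suc i)) - x (p i))
          = omega (x (p (Suc i))) (y (p (Suc i))) - omega (x (p i)) (y (p i))"
        using omega_commute[of "y (p (Suc i))" "x (p (Suc i))"] omega_commute[of "y (p (Suc i))" "x (p i)"]
        by (simp add: omega_diff_right)
    qed
    also have "\<dots> = 0"
      using sum_lessThan_telescope[of "\<lambda>i. omega (x (p i)) (y (p i))" N] p(1,2) x(2) y(2) by simp
    finally show ?thesis using 1 2 unfolding A_def distrib_left by linarith
  qed
  have "\<bar>integral {0..1} (\<lambda>t. x t \<bullet> w t) - integral {0..1} (\<lambda>t. y t \<bullet> v t)\<bar> \<le> 0"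
  proof (rule field_le_epsilon)
    fix e :: real assume "e > 0"
    have "A \<ge> 0" unfolding A_def by (intro add_nonneg_nonneg Henstock_Kurzweil_Integration.integral_nonneg rot_velocity_integrable(3)[OF x(1)] rot_velocity_integrable(3)[OF y(1)]) auto
    then have "e / (A + 1) * A \<le> e" using \<open>e > 0\<close> by (simp add: field_simps)
    then show "\<bar>integral {0..1} (\<lambda>t. x t \<bullet> w t) - integral {0..1} (\<lambda>t. y t \<bullet> v t)\<bar> \<le> 0 + e"
      using *[of "e / (A + 1)"] \<open>e > 0\<close> \<open>A \<ge> 0\<close> by auto
  qed
  then show ?thesis by simp
qed

lemma inner_cstruct_cstruct [simp]: "cstruct z \<bullet> cstruct w = z \<bullet> w"
  by (simp add: inner_cstruct)

section \<open>Lipschitz curves: velocities from increments, and reparametrisation\<close>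

text \<open>Turns a bound on increments into a bound on the derivative. Velocity constraints are
  stored as increment bounds while a curve is reparametrised or passed to a limit, and are recovered
  here.\<close>

lemma vector_derivative_inner_le:
  fixes x :: "real \<Rightarrow> 'a::euclidean_space"
  assumes der: "(x has_vector_derivative d) (at t within {a..b})" and t: "t \<in> {a..b}" "a < b"
    and le: "\<And>s s'. a \<le> s \<Longrightarrow> s \<le> s' \<Longrightarrow> s' \<le> b \<Longrightarrow> w \<bullet> (x s' - x s) \<le> c * (s' - s)"
  shows "w \<bullet> d \<le> c"
proof -
  have "((\<lambda>s. w \<bullet> x s) has_real_derivative w \<bullet> d) (at t within {a..b})"
    using has_derivative_inner_right[OF der[unfolded has_vector_derivative_def], of w]
    by (simp add: has_field_derivative_def mult_commute_abs)
  then have lim: "((\<lambda>s. (w \<bullet> x s - w \<bullet> x t) / (s - t)) \<longlongrightarrow> w \<bullet> d) (at t within {a..b})"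
    by (simp add: has_field_derivative_iff)
  have "(w \<bullet> x s - w \<bullet> x t) / (s - t) \<le> c" if s: "s \<in> {a..b}" "s \<noteq> t" for s
  proof (cases "s < t")
    case True
    have "w \<bullet> (x t - x s) \<le> c * (t - s)" using s t True by (intro le) auto
    then have "(w \<bullet> x t - w \<bullet> x s) / (t - s) \<le> c" using True by (simp add: inner_diff_right divide_le_eq)
    moreover have "(w \<bullet> x s - w \<bullet> x t) / (s - t) = (w \<bullet> x t - w \<bullet> x s) / (t - s)"
      by (metis minus_diff_eq minus_divide_divide)
    ultimately show ?thesis by simp
  next
    case False
    have "w \<bullet> (x s - x t) \<le> c * (s - t)" using s t False by (intro le) auto
    then show ?thesis using False s by (simp add: inner_diff_right divide_le_eq)
  qed
  then have ev: "\<forall>\<^sub>F s in at t within {a..b}. (w \<bullet> x s - w \<bullet> x t) / (s - t) \<le> c"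
    by (auto simp: eventually_at_filter)
  have nt: "at t within {a..b} \<noteq> bot"
    using t by (simp add: trivial_limit_within islimpt_Icc)
  show ?thesis by (rule tendsto_upperbound[OF lim ev nt])
qed

lemma lipschitz_on_abs_continuous:
  fixes f :: "real \<Rightarrow> 'a::metric_space"
  assumes "C-lipschitz_on {a..b} f"
  shows "abs_continuous_on a b f"
  unfolding abs_continuous_on_def
proof (intro allI impI)
  fix \<epsilon> :: real assume \<epsilon>: "\<epsilon> > 0"
  have C: "C \<ge> 0" using assms by (rule lipschitz_on_nonneg)
  show "\<exists>\<delta>>0. \<forall>I. finite I \<longrightarrow> (\<forall>(u, v)\<in>I. a \<le> u \<and> u \<le> v \<and> v \<le> b) \<longrightarrow>
      disjoint_family_on (\<lambda>(u, v). {u<..<v}) I \<longrightarrow>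
      (\<Sum>(u, v)\<in>I. v - u) < \<delta> \<longrightarrow> (\<Sum>(u, v)\<in>I. dist (f u) (f v)) < \<epsilon>"
  proof (intro exI[of _ "\<epsilon> / (C + 1)"] conjI allI impI)
    show "\<epsilon> / (C + 1) > 0" using \<epsilon> C by simp
    fix I :: "(real \<times> real) set"
    assume I: "finite I" "\<forall>(u, v)\<in>I. a \<le> u \<and> u \<le> v \<and> v \<le> b" "(\<Sum>(u, v)\<in>I. v - u) < \<epsilon> / (C + 1)"
    have "(\<Sum>(u, v)\<in>I. dist (f u) (f v)) \<le> (\<Sum>(u, v)\<in>I. C * (v - u))"
    proof (rule sum_mono, clarify)
      fix u v assume "(u, v) \<in> I"
      then have "a \<le> u" "u \<le> v" "v \<le> b" using I(2) by auto
      then show "dist (f u) (f v) \<le> C * (v - u)"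
        using lipschitz_onD[OF assms, of u v] by (simp add: dist_real_def)
    qed
    also have "\<dots> = C * (\<Sum>(u, v)\<in>I. v - u)" by (simp add: sum_distrib_left case_prod_unfold)
    also have "\<dots> \<le> C * (\<epsilon> / (C + 1))" using I(3) C by (intro mult_left_mono) auto
    also have "\<dots> < \<epsilon>" using C \<epsilon> by (simp add: field_simps)
    finally show "(\<Sum>(u, v)\<in>I. dist (f u) (f v)) < \<epsilon>" .
  qed
qed

text \<open>Supplies a velocity for a curve that was obtained only as a map, from Arzela-Ascoli or
  from an inverse function. The value 0 on \<open>N\<close> makes the norm bound hold at every
  \<open>t\<close>, so that later pointwise constraints need no exceptional set.\<close>

lemma lipschitz_rot_velocity:
  fixes y :: "real \<Rightarrow> 'n::finite phase"
  assumes lip: "C-lipschitz_on {0..1} y"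
  obtains u N where "rot_velocity y u" "negligible N"
    "\<And>t. t \<in> {0..1} - N \<Longrightarrow> (y has_vector_derivative cstruct (u t)) (at t within {0..1})"
    "\<And>t. t \<in> N \<Longrightarrow> u t = 0" "\<And>t. t \<in> {0..1} \<Longrightarrow> norm (u t) \<le> C"
proof -
  have C: "C \<ge> 0" using lip by (rule lipschitz_on_nonneg)
  obtain N where N: "negligible N" "\<And>t. t \<in> {0..1} - N \<Longrightarrow> \<exists>d. (y has_vector_derivative d) (at t within {0..1})"
    by (rule lipschitz_on_ae_differentiable[OF lip]) (rule that)
  define d where "d t = (if t \<in> N then 0 else vector_derivative y (at t within {0..1}))" for t
  define u where "u t = - cstruct (d t)" for t
  have der: "(y has_vector_derivative d t) (at t within {0..1})" if t: "t \<in> {0..1} - N" for t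
  proof -
    obtain d' where "(y has_vector_derivative d') (at t within {0..1})" using N(2)[OF t] by blast
    then show ?thesis using t vector_derivative_works[of y "at t within {0..1}"]
      by (auto simp: d_def differentiableI_vector)
  qed
  have nd: "norm (d t) \<le> C" if t: "t \<in> {0..1}" for t
  proof (cases "t \<in> N")
    case False
    have "d t \<bullet> d t \<le> C * norm (d t)"
    proof (rule vector_derivative_inner_le[OF der])
      fix s s' :: real assume s: "0 \<le> s" "s \<le> s'" "s' \<le> 1"
      have "d t \<bullet> (y s' - y s) \<le> norm (d t) * norm (y s' - y s)" by (rule norm_cauchy_schwarz)
      also have "\<dots> \<le> norm (d t) * (C * (s' - s))"
        using lipschitz_onD[OF lip, of s' s] s by (intro mult_left_mono) (auto simp: dist_norm)
      finally show "d t \<bullet> (y s' - y s) \<le> C * norm (d t) * (s' - s)" by (simp add: mult_ac)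
    qed (use t False in auto)
    then show ?thesis
      by (cases "d t = 0") (auto simp: C dot_square_norm power2_eq_square)
  qed (simp add: d_def C)
  have int: "(d has_integral y t - y 0) {0..t}" if t: "t \<in> {0..1}" for t
  proof (rule abs_continuous_on_FTC[OF _ _ N(1)])
    show "abs_continuous_on 0 t y"
      by (rule lipschitz_on_abs_continuous[of C]) (use t in \<open>auto intro: lipschitz_on_subset[OF lip]\<close>)
    show "(y has_vector_derivative d s) (at s within {0..t})" if "s \<in> {0..t} - N" for s
      by (rule has_vector_derivative_within_subset[OF der]) (use t that in auto)
  qed (use t in simp)
  have intu: "(u has_integral - cstruct (y t - y 0)) {0..t}" if t: "t \<in> {0..1}" for t
    using has_integral_neg[OF has_integral_linear[OF int[OF t] bounded_linear_cstruct]]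
    by (simp add: u_def[abs_def] o_def)
  show thesis
  proof (rule that[of u N])
    show "rot_velocity y u" unfolding rot_velocity_def
    proof (intro conjI ballI)
      show "u absolutely_integrable_on {0..1}"
      proof (rule absolutely_integrable_integrable_bound[of _ _ "\<lambda>_. C"])
        show "norm (u t) \<le> C" if "t \<in> {0..1}" for t using nd[OF that] by (simp add: u_def)
        show "u integrable_on {0..1}" using intu[of 1] by auto
      qed (rule integrable_const_ivl)
      fix t :: real assume t: "t \<in> {0..1}"
      have "integral {0..t} u = - cstruct (y t - y 0)" using intu[OF t] by (rule integral_unique)
      then have "cstruct (integral {0..t} u) = cstruct (- cstruct (y t - y 0))" by simp
      also have "\<dots> = y t - y 0" unfolding linear_neg[OF linear_cstruct] cstruct_cstruct by simp
      finally show "y t = y 0 + cstruct (integral {0..t} u)" by simp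
    qed
    show "norm (u t) \<le> C" if "t \<in> {0..1}" for t using nd[OF that] by (simp add: u_def)
    show "(y has_vector_derivative cstruct (u t)) (at t within {0..1})" if "t \<in> {0..1} - N" for t
      using der[OF that] by (simp add: u_def)
  qed (use N in \<open>auto simp: u_def d_def\<close>)
qed

lemma support_fun_velocity_le:
  assumes der: "(y has_vector_derivative cstruct u) (at t within {0..1})" and t: "t \<in> {0..1}" and "K \<noteq> {}"
    and le: "\<And>w a b. w \<in> K \<Longrightarrow> 0 \<le> a \<Longrightarrow> a \<le> b \<Longrightarrow> b \<le> 1 \<Longrightarrow> cstruct w \<bullet> (y b - y a) \<le> \<Lambda> * (b - a)"
  shows "support_fun K u \<le> \<Lambda>"
proof (rule support_fun_le[OF \<open>K \<noteq> {}\<close>])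
  fix w assume w: "w \<in> K"
  have "cstruct w \<bullet> cstruct u \<le> \<Lambda>" by (rule vector_derivative_inner_le[OF der t]) (use le[OF w] in auto)
  then show "u \<bullet> w \<le> \<Lambda>" by (simp add: inner_commute)
qed

text \<open>The direction opposite to \<open>support_fun_velocity_le\<close>: from velocities to
  increments, tested against each point of \<open>K\<close>. The two together carry the constraint
  over to reparametrised curves and to limit curves.\<close>

lemma rot_velocity_inner_le:
  assumes "rot_velocity x v" "0 \<le> a" "a \<le> b" "b \<le> 1" "compact K" "w \<in> K"
  shows "cstruct w \<bullet> (x b - x a) \<le> integral {a..b} (\<lambda>t. support_fun K (v t))"
proof -
  note v = rot_velocity_integrable[OF assms(1,2,4)]
  have w: "((\<lambda>t. w \<bullet> v t) has_integral w \<bullet> integral {a..b} v) {a..b}"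
    using has_integral_linear[OF integrable_integral[OF v(2)] bounded_linear_inner_right[of w]]
    by (simp add: o_def)
  have "cstruct w \<bullet> (x b - x a) = w \<bullet> integral {a..b} v"
    using rot_velocity_diff[OF assms(1-4)] by simp
  also have "\<dots> = integral {a..b} (\<lambda>t. w \<bullet> v t)" using w by (simp add: integral_unique)
  also have "\<dots> \<le> integral {a..b} (\<lambda>t. support_fun K (v t))"
  proof (rule integral_le)
    show "(\<lambda>t. w \<bullet> v t) integrable_on {a..b}" using w by blast
    have "K \<noteq> {}" using assms(6) by auto
    then show "(\<lambda>t. support_fun K (v t)) integrable_on {a..b}"
      using absolutely_integrable_support_fun[OF assms(5) _ v(1)] by (auto simp: absolutely_integrable_on_def)
    show "w \<bullet> v t \<le> support_fun K (v t)" for t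
      using support_fun_ge[OF compact_imp_bounded[OF assms(5)] assms(6), of "v t"] by (simp add: inner_commute)
  qed
  finally show ?thesis .
qed

text \<open>Runs through the curve at nearly constant support speed, which turns the integral of the
  support function into a pointwise bound. The surplus \<open>\<epsilon>\<close> pays for the
  perturbation in \<open>m\<close>: when the origin is on the boundary of \<open>K\<close>, the
  support function can vanish at nonzero velocities, and support length need not increase
  strictly.\<close>

theorem reparametrize:
  fixes x :: "real \<Rightarrow> 'n::finite phase"
  assumes x: "rot_velocity x v" "x 0 = x 1" and K: "compact K" "0 \<in> K" and "\<epsilon> > 0"
  obtains y u C where "rot_velocity y u" "y 0 = y 1" "C-lipschitz_on {0..1} y" "area y u = area x v"
    "\<And>t. t \<in> {0..1} \<Longrightarrow> support_fun K (u t) \<le> integral {0..1} (\<lambda>t. support_fun K (v t)) + \<epsilon>"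
proof -
  have Kne: "K \<noteq> {}" using K by auto
  note bK = compact_imp_bounded[OF K(1)]
  define V where "V = integral {0..1} (\<lambda>t. norm (v t))"
  have nv: "(\<lambda>t. norm (v t)) integrable_on {a..b}" if "0 \<le> a" "b \<le> 1" for a b
    using rot_velocity_integrable(3)[OF x(1)] that by blast
  have V: "V \<ge> 0" unfolding V_def by (rule Henstock_Kurzweil_Integration.integral_nonneg) (auto intro: nv)
  \<comment> \<open>Calibrated so that the perturbation \<open>e * (1 + norm (v t))\<close>
    integrates to exactly \<open>\<epsilon>\<close>.\<close>
  define e where "e = \<epsilon> / (1 + V)"
  have e: "e > 0" "e * (1 + V) = \<epsilon>" using V \<open>\<epsilon> > 0\<close> by (auto simp: e_def)
  define L where "L = integral {0..1} (\<lambda>t. support_fun K (v t))"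
  define \<Lambda> where "\<Lambda> = L + \<epsilon>"
  \<comment> \<open>The summand 1 makes \<open>\<sigma>\<close> strictly increasing and hence
    invertible; the summand \<open>norm (v t)\<close> makes the reparametrised curve Lipschitz with
    constant \<open>\<Lambda> / e\<close>.\<close>
  define m where "m t = support_fun K (v t) + e * (1 + norm (v t))" for t
  have sv: "(\<lambda>t. support_fun K (v t)) integrable_on {a..b}" if "0 \<le> a" "b \<le> 1" for a b
    using absolutely_integrable_support_fun[OF K(1) Kne rot_velocity_integrable(1)[OF x(1) that]]
    by (auto simp: absolutely_integrable_on_def)
  have s0: "0 \<le> support_fun K u" for u using support_fun_nonneg[OF bK K(2)] .
  have L: "L \<ge> 0" unfolding L_def by (rule Henstock_Kurzweil_Integration.integral_nonneg) (auto intro: sv s0)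
  then have \<Lambda>: "\<Lambda> > 0" using \<open>\<epsilon> > 0\<close> by (simp add: \<Lambda>_def)
  have env: "(\<lambda>t. e * (1 + norm (v t))) integrable_on {a..b}" if "0 \<le> a" "b \<le> 1" for a b
    using nv[OF that] by (intro integrable_on_mult_right integrable_add) auto
  have mint: "m integrable_on {a..b}" if "0 \<le> a" "b \<le> 1" for a b
    unfolding m_def[abs_def] by (intro integrable_add sv env that)
  have m\<Lambda>: "integral {0..1} m = \<Lambda>"
  proof -
    have "integral {0..1} m = L + integral {0..1} (\<lambda>t. e * (1 + norm (v t)))"
      unfolding m_def[abs_def] L_def by (rule Henstock_Kurzweil_Integration.integral_add) (auto intro: sv env)
    also have "integral {0..1} (\<lambda>t. e * (1 + norm (v t))) = e * (integral {0..1} (\<lambda>t. 1 + norm (v t)))" by simp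
    also have "integral {0..1} (\<lambda>t. 1 + norm (v t)) = 1 + V"
      unfolding V_def using Henstock_Kurzweil_Integration.integral_add[of "\<lambda>_. 1" "{0..1}" "\<lambda>t. norm (v t)"] nv[of 0 1]
      by (simp add: integrable_const_ivl)
    finally show ?thesis using e by (simp add: \<Lambda>_def)
  qed
  define \<sigma> where "\<sigma> t = integral {0..t} m" for t
  have \<sigma>diff: "\<sigma> b - \<sigma> a = integral {a..b} m" if "0 \<le> a" "a \<le> b" "b \<le> 1" for a b
    using Henstock_Kurzweil_Integration.integral_combine[OF that(1,2) mint[OF _ that(3)]] by (simp add: \<sigma>_def)
  have \<sigma>ge1: "e * (b - a) \<le> \<sigma> b - \<sigma> a" if ab: "0 \<le> a" "a \<le> b" "b \<le> 1" for a b
  proof -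
    have "integral {a..b} (\<lambda>t. e) \<le> integral {a..b} m"
    proof (rule integral_le[OF _ mint[OF ab(1,3)]])
      show "e \<le> m t" for t using s0[of "v t"] e(1) by (simp add: m_def algebra_simps)
    qed auto
    then show ?thesis using \<sigma>diff[OF ab] ab by (simp add: mult.commute)
  qed
  have \<sigma>ge2: "e * integral {a..b} (\<lambda>t. norm (v t)) \<le> \<sigma> b - \<sigma> a" if ab: "0 \<le> a" "a \<le> b" "b \<le> 1" for a b
  proof -
    have "integral {a..b} (\<lambda>t. e * norm (v t)) \<le> integral {a..b} m"
    proof (rule integral_le[OF _ mint[OF ab(1,3)]])
      show "(\<lambda>t. e * norm (v t)) integrable_on {a..b}" by (intro integrable_on_mult_right nv ab)
      show "e * norm (v t) \<le> m t" for t using s0[of "v t"] e(1) by (simp add: m_def algebra_simps)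
    qed
    then show ?thesis using \<sigma>diff[OF ab] by simp
  qed
  have \<sigma>ge3: "integral {a..b} (\<lambda>t. support_fun K (v t)) \<le> \<sigma> b - \<sigma> a" if ab: "0 \<le> a" "a \<le> b" "b \<le> 1" for a b
  proof -
    have "integral {a..b} (\<lambda>t. support_fun K (v t)) \<le> integral {a..b} m"
    proof (rule integral_le[OF sv[OF ab(1,3)] mint[OF ab(1,3)]])
      show "support_fun K (v t) \<le> m t" for t using e(1) by (simp add: m_def)
    qed
    then show ?thesis using \<sigma>diff[OF ab] by simp
  qed
  have \<sigma>01: "\<sigma> 0 = 0" "\<sigma> 1 = \<Lambda>" using m\<Lambda> by (auto simp: \<sigma>_def)
  have c\<sigma>: "continuous_on {0..1} \<sigma>" unfolding \<sigma>_def
    by (rule indefinite_integral_continuous_1) (auto intro: mint)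
  have \<sigma>mono: "\<sigma> a \<le> \<sigma> b" if "0 \<le> a" "a \<le> b" "b \<le> 1" for a b
  proof -
    have "0 \<le> e * (b - a)" using e that by simp
    then show ?thesis using \<sigma>ge1[OF that] by simp
  qed
  have \<sigma>inj: "a \<le> b" if "\<sigma> a \<le> \<sigma> b" "a \<in> {0..1}" "b \<in> {0..1}" for a b
  proof (rule ccontr)
    assume "\<not> a \<le> b"
    then have "e * (a - b) \<le> \<sigma> a - \<sigma> b" "0 < e * (a - b)" using \<sigma>ge1[of b a] that e by auto
    then show False using that by simp
  qed
  have "\<exists>t. t \<in> {0..1} \<and> \<sigma> t = \<Lambda> * s" if "s \<in> {0..1}" for s
  proof -
    have "\<exists>t\<ge>0. t \<le> 1 \<and> \<sigma> t = \<Lambda> * s"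
      by (rule IVT') (use that \<Lambda> \<sigma>01 c\<sigma> in \<open>auto simp: mult_le_cancel_left1\<close>)
    then show ?thesis by auto
  qed
  then have "\<exists>\<tau>. \<forall>s\<in>{0..1}. \<tau> s \<in> {0..1} \<and> \<sigma> (\<tau> s) = \<Lambda> * s" by (intro bchoice ballI)
  then obtain \<tau> where \<tau>': "\<forall>s\<in>{0..1}. \<tau> s \<in> {0..1} \<and> \<sigma> (\<tau> s) = \<Lambda> * s" ..
  have \<tau>: "\<tau> s \<in> {0..1}" "\<sigma> (\<tau> s) = \<Lambda> * s" if "s \<in> {0..1}" for s
    using bspec[OF \<tau>' that] by auto
  have \<tau>mono: "\<tau> a \<le> \<tau> b" if "0 \<le> a" "a \<le> b" "b \<le> 1" for a b
    by (rule \<sigma>inj) (use that \<tau> \<Lambda> in auto)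
  have \<sigma>rng: "\<sigma> t / \<Lambda> \<in> {0..1}" if "t \<in> {0..1}" for t
    using \<sigma>mono[of 0 t] \<sigma>mono[of t 1] that \<sigma>01 \<Lambda> by (auto simp: divide_le_eq)
  have \<tau>\<sigma>: "\<tau> (\<sigma> t / \<Lambda>) = t" if "t \<in> {0..1}" for t
  proof -
    have "\<sigma> (\<tau> (\<sigma> t / \<Lambda>)) = \<sigma> t" using \<tau>(2)[OF \<sigma>rng[OF that]] \<Lambda> by simp
    then show ?thesis using \<sigma>inj[of "\<tau> (\<sigma> t / \<Lambda>)" t] \<sigma>inj[of t "\<tau> (\<sigma> t / \<Lambda>)"] \<tau>(1)[OF \<sigma>rng[OF that]] that
      by (simp add: antisym)
  qed
  define y where "y s = x (\<tau> s)" for s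
  have y01: "y 0 = x 0" "y 1 = x 1"
    using \<tau>\<sigma>[of 0] \<tau>\<sigma>[of 1] \<sigma>01 \<Lambda> by (auto simp: y_def)
  have lip: "(\<Lambda> / e)-lipschitz_on {0..1} y"
  proof -
    have *: "norm (y b - y a) \<le> \<Lambda> / e * (b - a)" if ab: "0 \<le> a" "a \<le> b" "b \<le> 1" for a b
    proof -
      have t: "0 \<le> \<tau> a" "\<tau> a \<le> \<tau> b" "\<tau> b \<le> 1" using \<tau>mono[OF ab] \<tau>(1)[of a] \<tau>(1)[of b] ab by auto
      have "norm (y b - y a) = norm (integral {\<tau> a..\<tau> b} v)"
        using rot_velocity_diff[OF x(1) t] by (simp add: y_def)
      also have "\<dots> \<le> integral {\<tau> a..\<tau> b} (\<lambda>t. norm (v t))"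
        by (rule Henstock_Kurzweil_Integration.integral_norm_bound_integral)
          (use rot_velocity_integrable[OF x(1) t(1,3)] in auto)
      also have "\<dots> \<le> (\<sigma> (\<tau> b) - \<sigma> (\<tau> a)) / e"
        using \<sigma>ge2[OF t] e by (simp add: pos_le_divide_eq mult.commute)
      also have "\<dots> = \<Lambda> / e * (b - a)"
        using \<tau>(2)[of a] \<tau>(2)[of b] ab by (simp add: right_diff_distrib diff_divide_distrib)
      finally show ?thesis .
    qed
    show ?thesis
    proof (rule lipschitz_onI)
      fix s t :: real assume st: "s \<in> {0..1}" "t \<in> {0..1}"
      show "dist (y s) (y t) \<le> \<Lambda> / e * dist s t"
        using *[of s t] *[of t s] st by (cases "s \<le> t") (auto simp: dist_norm norm_minus_commute)
    qed (use \<Lambda> e in simp)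
  qed
  obtain u N where u: "rot_velocity y u" "negligible N"
    "\<And>t. t \<in> {0..1} - N \<Longrightarrow> (y has_vector_derivative cstruct (u t)) (at t within {0..1})"
    "\<And>t. t \<in> N \<Longrightarrow> u t = 0" "\<And>t. t \<in> {0..1} \<Longrightarrow> norm (u t) \<le> \<Lambda> / e"
    by (rule lipschitz_rot_velocity[OF lip]) (rule that)
  have su: "support_fun K (u t) \<le> \<Lambda>" if t: "t \<in> {0..1}" for t
  proof (cases "t \<in> N")
    case True
    then show ?thesis using u(4) support_fun_scaleR[OF K(1) Kne, of 0 0] \<Lambda> by simp
  next
    case False
    show ?thesis
    proof (rule support_fun_velocity_le[OF u(3) t Kne])
      show "t \<in> {0..1} - N" using t False by simp
      fix w a b assume w: "w \<in> K" and ab: "0 \<le> a" "a \<le> b" "b \<le> (1::real)"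
      have t: "0 \<le> \<tau> a" "\<tau> a \<le> \<tau> b" "\<tau> b \<le> 1" using \<tau>mono[OF ab] \<tau>(1)[of a] \<tau>(1)[of b] ab by auto
      have "cstruct w \<bullet> (y b - y a) \<le> \<sigma> (\<tau> b) - \<sigma> (\<tau> a)"
        using rot_velocity_inner_le[OF x(1) t K(1) w] \<sigma>ge3[OF t] by (simp add: y_def)
      also have "\<dots> = \<Lambda> * (b - a)" using \<tau>(2)[of a] \<tau>(2)[of b] ab by (simp add: right_diff_distrib)
      finally show "cstruct w \<bullet> (y b - y a) \<le> \<Lambda> * (b - a)" .
    qed
  qed
  \<comment> \<open>The partition \<open>q i = \<sigma> (p i) / \<Lambda>\<close> puts
    \<open>y\<close> at the very vertices that \<open>x\<close> visits at \<open>p i\<close>, so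
    both integrals are close to one and the same sum.\<close>
  have "\<bar>integral {0..1} (\<lambda>t. y t \<bullet> u t) - integral {0..1} (\<lambda>t. x t \<bullet> v t)\<bar> \<le> 0"
  proof (rule field_le_epsilon)
    fix r :: real assume r: "r > 0"
    define U where "U = integral {0..1} (\<lambda>t. norm (u t))"
    have U: "U \<ge> 0" unfolding U_def
      by (rule Henstock_Kurzweil_Integration.integral_nonneg) (auto intro: rot_velocity_integrable[OF u(1)])
    define \<eta> where "\<eta> = r / (1 + U + V)"
    have "\<eta> > 0" "\<eta> * (1 + U + V) = r" using r U V by (auto simp: \<eta>_def)
    then have \<eta>: "\<eta> > 0" "\<eta> * U + \<eta> * V \<le> r" by (auto simp: distrib_left)
    obtain n :: nat where n: "n > 0"
      "\<And>s t. s \<in> {0..1} \<Longrightarrow> t \<in> {0..1} \<Longrightarrow> \<bar>s - t\<bar> \<le> 1 / real n \<Longrightarrow> norm (x s - x t) \<le> \<eta>"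
      using uniform_partition[OF rot_velocity_continuous[OF x(1)] \<eta>(1)] by blast
    define p where "p i = real i / real n" for i
    have p: "p 0 = 0" "p n = 1" "\<And>i. i < n \<Longrightarrow> p i \<le> p (Suc i)"
      using n(1) by (auto simp: p_def divide_right_mono)
    have prng: "p i \<in> {0..1}" "p (Suc i) \<in> {0..1}" "p (Suc i) - p i = 1 / real n" if "i < n" for i
      using that by (auto simp: p_def diff_divide_distrib[symmetric])
    have near: "norm (x s - x (p i)) \<le> \<eta>" if "i < n" "s \<in> {p i..p (Suc i)}" for i s
      using prng[OF that(1)] that(2) by (intro n(2)) auto
    define q where "q i = \<sigma> (p i) / \<Lambda>" for i
    have q: "q 0 = 0" "q n = 1" "\<And>i. i < n \<Longrightarrow> q i \<le> q (Suc i)"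
      using p \<sigma>01 \<Lambda> prng by (auto simp: q_def divide_right_mono \<sigma>mono)
    have yq: "y (q i) = x (p i)" if "i \<le> n" for i
    proof -
      have "p i \<in> {0..1}" using that n(1) by (auto simp: p_def)
      from \<tau>\<sigma>[OF this] show ?thesis by (simp add: y_def q_def)
    qed
    have 1: "\<bar>integral {0..1} (\<lambda>t. x t \<bullet> v t) - (\<Sum>i<n. omega (x (p i)) (x (p (Suc i)) - x (p i)))\<bar> \<le> \<eta> * V"
      unfolding V_def by (rule riemann_stieltjes_sum[OF x(1) rot_velocity_continuous[OF x(1)] p near])
    have 2: "\<bar>integral {0..1} (\<lambda>t. y t \<bullet> u t) - (\<Sum>i<n. omega (x (p i)) (y (q (Suc i)) - y (q i)))\<bar> \<le> \<eta> * U"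
      unfolding U_def
    proof (rule riemann_stieltjes_sum[OF u(1) rot_velocity_continuous[OF u(1)] q])
      fix i s assume i: "i < n" and s: "s \<in> {q i..q (Suc i)}"
      have qr: "q i \<in> {0..1}" "q (Suc i) \<in> {0..1}" using \<sigma>rng prng[OF i] by (auto simp: q_def)
      have "\<tau> (q i) \<le> \<tau> s" "\<tau> s \<le> \<tau> (q (Suc i))" using s qr by (auto intro!: \<tau>mono)
      moreover have "\<tau> (q i) = p i" "\<tau> (q (Suc i)) = p (Suc i)" using \<tau>\<sigma> prng[OF i] by (auto simp: q_def)
      ultimately show "norm (y s - x (p i)) \<le> \<eta>" using near[OF i, of "\<tau> s"] by (simp add: y_def)
    qed
    have "(\<Sum>i<n. omega (x (p i)) (y (q (Suc i)) - y (q i))) = (\<Sum>i<n. omega (x (p i)) (x (p (Suc i)) - x (p i)))"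
      by (rule sum.cong) (auto simp: yq)
    then show "\<bar>integral {0..1} (\<lambda>t. y t \<bullet> u t) - integral {0..1} (\<lambda>t. x t \<bullet> v t)\<bar> \<le> 0 + r"
      using 1 2 \<eta>(2) by linarith
  qed
  then have "area y u = area x v" by (simp add: area_def)
  with u(1) y01 x(2) lip su show thesis
    by (intro that[of y u "\<Lambda> / e"]) (auto simp: \<Lambda>_def L_def)
qed

lemma rot_velocity_lipschitz:
  assumes "rot_velocity x v" "\<And>t. t \<in> {0..1} \<Longrightarrow> norm (v t) \<le> C" "0 \<le> C"
  shows "C-lipschitz_on {0..1} x"
proof -
  have *: "norm (x b - x a) \<le> C * (b - a)" if ab: "0 \<le> a" "a \<le> b" "b \<le> 1" for a b
  proof -
    have "norm (x b - x a) = norm (integral {a..b} v)" using rot_velocity_diff[OF assms(1) ab] by simp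
    also have "\<dots> \<le> integral {a..b} (\<lambda>t. C)"
      by (rule Henstock_Kurzweil_Integration.integral_norm_bound_integral)
        (use rot_velocity_integrable[OF assms(1) ab(1,3)] assms(2) ab in auto)
    finally show ?thesis using ab by (simp add: mult.commute)
  qed
  show ?thesis
  proof (rule lipschitz_onI[OF _ assms(3)])
    fix s t :: real assume st: "s \<in> {0..1}" "t \<in> {0..1}"
    show "dist (x s) (x t) \<le> C * dist s t"
      using *[of s t] *[of t s] st by (cases "s \<le> t") (auto simp: dist_norm norm_minus_commute)
  qed
qed

lemma area_add_const:
  assumes "rot_velocity x v" "x 0 = x 1"
  shows "rot_velocity (\<lambda>t. x t + c) v" "area (\<lambda>t. x t + c) v = area x v"
proof -
  show "rot_velocity (\<lambda>t. x t + c) v"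
    unfolding rot_velocity_def
  proof (intro conjI ballI)
    show "v absolutely_integrable_on {0..1}" using rot_velocity_integrable(1)[OF assms(1)] by simp
    fix t :: real assume "t \<in> {0..1}"
    from rot_velocity_eq[OF assms(1) this]
    show "x t + c = x 0 + c + cstruct (integral {0..t} v)" by (simp only: ac_simps)
  qed
  have "integral {0..1} (\<lambda>t. (x t + c) \<bullet> v t) = integral {0..1} (\<lambda>t. x t \<bullet> v t + c \<bullet> v t)"
    by (simp add: inner_add_left)
  also have "\<dots> = integral {0..1} (\<lambda>t. x t \<bullet> v t) + integral {0..1} (\<lambda>t. c \<bullet> v t)"
    using absolutely_integrable_inner[OF rot_velocity_continuous[OF assms(1)] rot_velocity_integrable(1)[OF assms(1)]]
      absolutely_integrable_inner[OF continuous_on_const[of _ c] rot_velocity_integrable(1)[OF assms(1)]]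
    by (intro Henstock_Kurzweil_Integration.integral_add) (auto simp: absolutely_integrable_on_def)
  also have "integral {0..1} (\<lambda>t. c \<bullet> v t) = c \<bullet> integral {0..1} v"
    using integral_linear[OF rot_velocity_integrable(2)[OF assms(1)] bounded_linear_inner_right[of c], of 0 1]
    by (simp add: o_def)
  also have "\<dots> = 0" using rot_velocity_closed[OF assms] by simp
  finally show "area (\<lambda>t. x t + c) v = area x v" by (simp add: area_def)
qed

lemma rot_velocity_scaleR:
  assumes "rot_velocity x v"
  shows "rot_velocity (\<lambda>t. c *\<^sub>R x t) (\<lambda>t. c *\<^sub>R v t)"
proof -
  have "c *\<^sub>R x t = c *\<^sub>R x 0 + cstruct (integral {0..t} (\<lambda>s. c *\<^sub>R v s))" if t: "t \<in> {0..1}" for t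
  proof -
    have "c *\<^sub>R x t = c *\<^sub>R (x 0 + cstruct (integral {0..t} v))" by (simp only: rot_velocity_eq[OF assms t, symmetric])
    also have "\<dots> = c *\<^sub>R x 0 + cstruct (integral {0..t} (\<lambda>s. c *\<^sub>R v s))" by (simp add: scaleR_add_right)
    finally show ?thesis .
  qed
  moreover have "(\<lambda>s. c *\<^sub>R v s) absolutely_integrable_on {0..1}"
    using rot_velocity_integrable(1)[OF assms, of 0 1] by auto
  ultimately show ?thesis unfolding rot_velocity_def by blast
qed

lemma area_scaleR: "area (\<lambda>t. c *\<^sub>R x t) (\<lambda>t. c *\<^sub>R v t) = c\<^sup>2 * area x v"
  by (simp add: area_def power2_eq_square mult.assoc)

section \<open>Existence of an area maximiser\<close>

lemma area_le:
  assumes x: "rot_velocity x v" and "0 \<le> C" "\<And>t. t \<in> {0..1} \<Longrightarrow> norm (v t) \<le> C" "x 0 = 0"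
  shows "area x v \<le> C\<^sup>2 / 2"
proof -
  note lip = rot_velocity_lipschitz[OF x assms(3,2)]
  have nx: "norm (x t) \<le> C" if t: "t \<in> {0..1}" for t
  proof -
    have "norm (x t) \<le> C * t" using lipschitz_onD[OF lip t, of 0] t assms(4) by (simp add: dist_norm)
    also have "\<dots> \<le> C * 1" using t assms(2) by (intro mult_left_mono) auto
    finally show ?thesis by simp
  qed
  have "integral {0..1} (\<lambda>t. x t \<bullet> v t) \<le> integral {0..1} (\<lambda>t::real. C\<^sup>2)"
  proof (rule integral_le)
    show "(\<lambda>t. x t \<bullet> v t) integrable_on {0..1}"
      using absolutely_integrable_inner[OF rot_velocity_continuous[OF x] rot_velocity_integrable(1)[OF x]]
      by (auto simp: absolutely_integrable_on_def)
    fix t :: real assume t: "t \<in> {0..1}"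
    have "x t \<bullet> v t \<le> norm (x t) * norm (v t)" by (rule norm_cauchy_schwarz)
    also have "\<dots> \<le> C * C" using nx[OF t] assms(2,3) t by (intro mult_mono) auto
    finally show "x t \<bullet> v t \<le> C\<^sup>2" by (simp add: power2_eq_square)
  qed auto
  then show ?thesis by (simp add: area_def)
qed

text \<open>Positions converge pointwise while velocities may oscillate. The common Lipschitz bound
  gives Riemann-Stieltjes sums with error at most \<open>C\<^sup>2 / n\<close>, uniformly in
  \<open>k\<close>, and for fixed \<open>n\<close> these sums converge.\<close>

lemma area_tendsto:
  assumes x: "\<And>k. rot_velocity (x k) (v k)" "\<And>k t. t \<in> {0..1} \<Longrightarrow> norm (v k t) \<le> C"
    and z: "rot_velocity z u" "\<And>t. t \<in> {0..1} \<Longrightarrow> norm (u t) \<le> C" and "0 \<le> C"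
    and lim: "\<And>t. t \<in> {0..1} \<Longrightarrow> (\<lambda>k. x k t) \<longlonglongrightarrow> z t"
  shows "(\<lambda>k. area (x k) (v k)) \<longlonglongrightarrow> area z u"
proof -
  define S where "S n y = (\<Sum>i<n. omega (y (real i / real n)) (y (real (Suc i) / real n) - y (real i / real n)))"
    for n :: nat and y :: "real \<Rightarrow> 'a phase"
  have S: "\<bar>integral {0..1} (\<lambda>t. y t \<bullet> w t) - S n y\<bar> \<le> C\<^sup>2 / real n"
    if y: "rot_velocity y w" and w: "\<And>t. t \<in> {0..1} \<Longrightarrow> norm (w t) \<le> C" and n: "n > 0" for y w n
  proof -
    note lip = rot_velocity_lipschitz[OF y w \<open>0 \<le> C\<close>]
    have "\<bar>integral {0..1} (\<lambda>t. y t \<bullet> w t) - S n y\<bar> \<le> C / real n * integral {0..1} (\<lambda>t. norm (w t))"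
      unfolding S_def
    proof (rule riemann_stieltjes_sum[OF y rot_velocity_continuous[OF y], where p = "\<lambda>i. real i / real n"])
      fix i s assume i: "i < n" and s: "s \<in> {real i / real n..real (Suc i) / real n}"
      have le1: "real (Suc i) / real n \<le> 1" using i by simp
      have "real (Suc i) / real n - real i / real n = 1 / real n" by (simp add: diff_divide_distrib[symmetric])
      then have d: "dist s (real i / real n) \<le> 1 / real n" using s by (simp add: dist_real_def)
      have i0: "0 \<le> real i / real n" by simp
      have "s \<in> {0..1}" "real i / real n \<in> {0..1}" using s le1 i0 unfolding atLeastAtMost_iff by linarith+
      then have "norm (y s - y (real i / real n)) \<le> C * dist s (real i / real n)"
        using lipschitz_onD[OF lip, of s "real i / real n"] by (simp add: dist_norm)
      also have "\<dots> \<le> C * (1 / real n)" using d \<open>0 \<le> C\<close> by (rule mult_left_mono)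
      finally show "norm (y s - y (real i / real n)) \<le> C / real n" by simp
    qed (use n in \<open>auto simp: divide_right_mono\<close>)
    also have "integral {0..1} (\<lambda>t. norm (w t)) \<le> integral {0..1} (\<lambda>t::real. C)"
      by (rule integral_le) (use w rot_velocity_integrable(3)[OF y] in auto)
    then have "C / real n * integral {0..1} (\<lambda>t. norm (w t)) \<le> C / real n * C"
      using \<open>0 \<le> C\<close> by (intro mult_left_mono) auto
    finally show ?thesis by (simp add: power2_eq_square)
  qed
  have "(\<lambda>k. integral {0..1} (\<lambda>t. x k t \<bullet> v k t)) \<longlonglongrightarrow> integral {0..1} (\<lambda>t. z t \<bullet> u t)"
  proof (rule LIMSEQ_I)
    fix r :: real assume r: "r > 0"
    obtain n :: nat where n: "real n > 3 * C\<^sup>2 / r" using reals_Archimedean2 by blast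
    have "0 \<le> 3 * C\<^sup>2 / r" using r by simp
    then have "n > 0" using n by (metis not_gr_zero of_nat_0 not_le)
    then have n3: "C\<^sup>2 / real n < r / 3" using n r by (simp add: field_simps)
    have "(\<lambda>k. S n (x k)) \<longlonglongrightarrow> S n z"
    proof -
      have l: "(\<lambda>k. x k (real i / real n)) \<longlonglongrightarrow> z (real i / real n)" if "i \<le> n" for i
        using that by (intro lim) (auto simp: divide_le_eq)
      have o: "(\<lambda>k. omega (a k) (b k)) \<longlonglongrightarrow> omega a' b'" if "a \<longlonglongrightarrow> a'" "b \<longlonglongrightarrow> b'"
        for a b and a' b' :: "'a phase"
        unfolding omega_def by (intro tendsto_intros that)
      show ?thesis unfolding S_def by (intro tendsto_sum o tendsto_diff l) auto
    qed
    then obtain k0 where k0: "\<And>k. k \<ge> k0 \<Longrightarrow> \<bar>S n (x k) - S n z\<bar> < r / 3"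
      using LIMSEQ_D[of "\<lambda>k. S n (x k)" "S n z" "r/3"] r by auto
    have "norm (integral {0..1} (\<lambda>t. x k t \<bullet> v k t) - integral {0..1} (\<lambda>t. z t \<bullet> u t)) < r" if "k \<ge> k0" for k
      using S[OF x(1)[of k] x(2) \<open>n > 0\<close>] S[OF z \<open>n > 0\<close>] k0[OF that] n3
      unfolding real_norm_def by linarith
    then show "\<exists>k0. \<forall>k\<ge>k0. norm (integral {0..1} (\<lambda>t. x k t \<bullet> v k t) - integral {0..1} (\<lambda>t. z t \<bullet> u t)) < r"
      by blast
  qed
  then show ?thesis unfolding area_def by (intro tendsto_intros) auto
qed

lemma norm_le_support_fun:
  assumes "bounded K" "cball 0 r \<subseteq> K" "r > 0"
  shows "r * norm u \<le> support_fun K (u :: 'a::real_inner)"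
proof (cases "u = 0")
  case False
  have "(r / norm u) *\<^sub>R u \<in> K" using assms(2,3) False by (auto simp: subset_iff)
  from support_fun_ge[OF assms(1) this, of u] show ?thesis
    using False by (simp add: dot_square_norm power2_eq_square)
next
  case True
  have "0 \<in> K" using assms(2,3) by auto
  from support_fun_ge[OF assms(1) this, of u] show ?thesis using True by simp
qed

text \<open>A circle in the plane of \<open>e\<close> and \<open>J e\<close>; it shows that the
  supremum of areas is positive. The radius \<open>c / (4 * pi)\<close> leaves room for the crude
  bound 2 on \<open>|sin| + |cos|\<close>.\<close>

lemma positive_area_loop:
  fixes c :: real assumes "c > 0"
  obtains x :: "real \<Rightarrow> 'n::finite phase" and v where "rot_velocity x v" "x 0 = 0" "x 1 = 0"
    "\<And>t. norm (v t) \<le> c" "area x v > 0"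
proof -
  obtain e :: "'n phase" where "e \<in> Basis" by (meson ex_in_conv nonempty_Basis)
  then have e: "norm e = 1" "e \<bullet> e = 1" by (auto simp: inner_same_Basis)
  define \<epsilon> where "\<epsilon> = c / (4 * pi)"
  have \<epsilon>: "\<epsilon> > 0" using assms by (simp add: \<epsilon>_def)
  define x where "x t = \<epsilon> *\<^sub>R ((cos (2*pi*t) - 1) *\<^sub>R e + sin (2*pi*t) *\<^sub>R cstruct e)" for t :: real
  define v where "v t = (2*pi*\<epsilon>) *\<^sub>R (sin (2*pi*t) *\<^sub>R cstruct e + cos (2*pi*t) *\<^sub>R e)" for t :: real
  have ec: "e \<bullet> cstruct e = 0" "cstruct e \<bullet> e = 0" "cstruct e \<bullet> cstruct e = 1"
    using e by (simp_all add: inner_commute[of "cstruct e" e])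
  have int: "(v has_integral (- cstruct (x t) - - cstruct (x 0))) {0..t}" if "0 \<le> t" for t
  proof (rule fundamental_theorem_of_calculus[OF that])
    fix s assume "s \<in> {0..t}"
    have "((\<lambda>s. - cstruct (x s)) has_vector_derivative v s) (at s within {0..t})"
      unfolding x_def v_def cstruct_simps cstruct_cstruct
      by (auto intro!: derivative_eq_intros simp: algebra_simps)
    then show "((\<lambda>s. - cstruct (x s)) has_vector_derivative v s) (at s within {0..t})" .
  qed
  have x0: "x 0 = 0" "x 1 = 0" by (auto simp: x_def)
  show thesis
  proof (rule that)
    have cv: "continuous_on A v" for A unfolding v_def by (intro continuous_intros)
    show "rot_velocity x v" unfolding rot_velocity_def
    proof (intro conjI ballI)
      show "v absolutely_integrable_on {0..1}" by (rule absolutely_integrable_continuous_real[OF cv])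
      fix t :: real assume "t \<in> {0..1}"
      then have "integral {0..t} v = - cstruct (x t)" using int[of t] x0 by (simp add: integral_unique)
      then show "x t = x 0 + cstruct (integral {0..t} v)" using x0 by simp
    qed
    show "x 0 = 0" "x 1 = 0" by (fact x0)+
    show "norm (v t) \<le> c" for t
    proof -
      have "norm (sin (2*pi*t) *\<^sub>R cstruct e + cos (2*pi*t) *\<^sub>R e) \<le> \<bar>sin (2*pi*t)\<bar> + \<bar>cos (2*pi*t)\<bar>"
        using norm_triangle_ineq[of "sin (2*pi*t) *\<^sub>R cstruct e" "cos (2*pi*t) *\<^sub>R e"] e by simp
      also have "\<dots> \<le> 2" using abs_sin_le_one[of "2*pi*t"] abs_cos_le_one[of "2*pi*t"] by linarith
      finally have "norm (v t) \<le> (2*pi*\<epsilon>) * 2" using \<epsilon> by (simp add: v_def mult_left_mono)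
      then show ?thesis by (simp add: \<epsilon>_def)
    qed
    have "((\<lambda>t. x t \<bullet> v t) has_integral (\<lambda>t. 2*pi*\<epsilon>\<^sup>2*t - \<epsilon>\<^sup>2 * sin (2*pi*t)) 1 - (\<lambda>t. 2*pi*\<epsilon>\<^sup>2*t - \<epsilon>\<^sup>2 * sin (2*pi*t)) 0) {0..1}"
    proof (rule fundamental_theorem_of_calculus)
      fix t :: real assume "t \<in> {0..1}"
      have "((a - 1) *\<^sub>R e + b *\<^sub>R cstruct e) \<bullet> (b *\<^sub>R cstruct e + a *\<^sub>R e) = (a - 1) * a + b\<^sup>2" for a b
        using e ec by (simp add: inner_add_left inner_add_right power2_eq_square)
      then have "x t \<bullet> v t = 2*pi*\<epsilon>\<^sup>2 * ((cos (2*pi*t) - 1) * cos (2*pi*t) + (sin (2*pi*t))\<^sup>2)"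
        unfolding x_def v_def inner_scaleR_left inner_scaleR_right by (simp add: power2_eq_square)
      also have "(cos (2*pi*t) - 1) * cos (2*pi*t) + (sin (2*pi*t))\<^sup>2 = 1 - cos (2*pi*t)"
        unfolding sin_squared_eq by (simp add: power2_eq_square algebra_simps)
      finally have "x t \<bullet> v t = 2*pi*\<epsilon>\<^sup>2 * (1 - cos (2*pi*t))" .
      then show "((\<lambda>t. 2*pi*\<epsilon>\<^sup>2*t - \<epsilon>\<^sup>2 * sin (2*pi*t)) has_vector_derivative x t \<bullet> v t) (at t within {0..1})"
        by (auto simp: has_real_derivative_iff_has_vector_derivative[symmetric] algebra_simps intro!: derivative_eq_intros)
    qed simp
    then have "integral {0..1} (\<lambda>t. x t \<bullet> v t) = 2*pi*\<epsilon>\<^sup>2" by (simp add: integral_unique)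
    then show "area x v > 0" using \<epsilon> by (simp add: area_def)
  qed
qed

text \<open>Direct method. The inner ball bounds admissible velocities by \<open>1 / r\<close>, so a
  maximising sequence is equi-Lipschitz and has a uniform limit along a subsequence. The constraint
  reaches the limit in the form of increment bounds. Loops in \<open>Q\<close> start at 0, which
  costs nothing because the area of a closed curve ignores translations.\<close>

theorem area_maximizer:
  fixes K :: "'n::finite phase set"
  assumes K: "compact K" "cball 0 r \<subseteq> K" "r > 0"
  obtains z u N where "rot_velocity z u" "z 0 = 0" "z 1 = 0" "negligible N"
    "\<And>t. t \<in> {0..1} \<Longrightarrow> support_fun K (u t) \<le> 1" "area z u > 0"
    "\<And>t. t \<in> {0..1} - N \<Longrightarrow> (z has_vector_derivative cstruct (u t)) (at t within {0..1})"
    "\<And>x v. rot_velocity x v \<Longrightarrow> x 0 = x 1 \<Longrightarrow> \<forall>t\<in>{0..1}. support_fun K (v t) \<le> 1 \<Longrightarrow> area x v \<le> area z u"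
proof -
  note bK = compact_imp_bounded[OF K(1)]
  have K0: "0 \<in> K" using K by auto
  then have Kne: "K \<noteq> {}" by auto
  define Q where "Q = {(x,v). rot_velocity x v \<and> x 0 = (0::'n phase) \<and> x 1 = 0 \<and> (\<forall>t\<in>{0..1}. support_fun K (v t) \<le> 1)}"
  define C where "C = 1 / r"
  have C: "C > 0" using K by (simp add: C_def)
  have nC: "norm u \<le> C" if "support_fun K u \<le> 1" for u
    using norm_le_support_fun[OF bK K(2,3), of u] that K(3) by (simp add: C_def field_simps)
  define AA where "AA = (\<lambda>(x,v). area x v) ` Q"
  have bdd: "bdd_above AA"
  proof (rule bdd_aboveI[of _ "C\<^sup>2/2"])
    fix q assume "q \<in> AA"
    then obtain x v where xv: "(x,v) \<in> Q" "q = area x v" by (auto simp: AA_def)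
    have "area x v \<le> C\<^sup>2/2"
    proof (rule area_le)
      show "norm (v t) \<le> C" if "t \<in> {0..1}" for t using xv(1) that by (intro nC) (simp add: Q_def)
    qed (use xv C in \<open>auto simp: Q_def\<close>)
    then show "q \<le> C\<^sup>2/2" using xv(2) by simp
  qed
  obtain R where R: "R > 0" "\<And>w. w \<in> K \<Longrightarrow> norm w \<le> R" by (rule compact_norm_bound[OF K(1)]) (rule that)
  have sR: "support_fun K u \<le> R * norm u" for u
    using support_fun_lipschitz[OF K(1) Kne R(2), of u 0] support_fun_scaleR[OF K(1) Kne, of 0 0] by simp
  obtain x0 :: "real \<Rightarrow> 'n phase" and v0 where x0: "rot_velocity x0 v0" "x0 0 = 0" "x0 1 = 0" "\<And>t. norm (v0 t) \<le> 1/R" "area x0 v0 > 0"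
    by (rule positive_area_loop[of "1/R", OF _ that]) (use R in auto)
  have "support_fun K (v0 t) \<le> 1" for t
    using sR[of "v0 t"] x0(4)[of t] R(1) by (simp add: field_simps)
  then have x0Q: "(x0,v0) \<in> Q" using x0 by (auto simp: Q_def)
  then have AAne: "AA \<noteq> {}" by (auto simp: AA_def)
  define M where "M = Sup AA"
  have M: "area x v \<le> M" if "(x,v) \<in> Q" for x v
    unfolding M_def by (rule cSup_upper[OF _ bdd]) (use that in \<open>auto simp: AA_def\<close>)
  have "M > 0" using M[OF x0Q] x0(5) by simp
  have "\<exists>y w. (y,w) \<in> Q \<and> area y w > M - 1 / real (Suc k)" for k
  proof -
    have "M - 1 / real (Suc k) < Sup AA" by (simp add: M_def)
    from less_cSupD[OF AAne this] show ?thesis by (auto simp: AA_def)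
  qed
  then have "\<exists>y w. \<forall>k. (y k, w k) \<in> Q \<and> area (y k) (w k) > M - 1 / real (Suc k)" by metis
  then obtain y w where yw: "\<And>k. (y k, w k) \<in> Q" "\<And>k. area (y k) (w k) > M - 1 / real (Suc k)" by auto
  have yQ: "rot_velocity (y k) (w k)" "y k 0 = 0" "y k 1 = 0" "\<And>t. t \<in> {0..1} \<Longrightarrow> support_fun K (w k t) \<le> 1" for k
    using yw(1)[of k] by (auto simp: Q_def)
  have wC: "norm (w k t) \<le> C" if "t \<in> {0..1}" for k t using yQ(4)[OF that] by (rule nC)
  have ylip: "C-lipschitz_on {0..1} (y k)" for k
    by (rule rot_velocity_lipschitz[OF yQ(1)]) (use wC C in auto)
  have ydist: "norm (y k s - y k t) \<le> C * \<bar>s - t\<bar>" if "s \<in> {0..1}" "t \<in> {0..1}" for k s t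
    using lipschitz_onD[OF ylip that] by (simp add: dist_norm)
  obtain z :: "real \<Rightarrow> 'n phase" and j :: "nat \<Rightarrow> nat" where zj: "continuous_on {0..1} z" "strict_mono j"
      "\<And>e. 0 < e \<Longrightarrow> \<exists>N. \<forall>n t. n \<ge> N \<and> t \<in> {0..1} \<longrightarrow> norm (y (j n) t - z t) < e"
  proof (rule Arzela_Ascoli[of "{0..1::real}" y C, OF _ _ _ that])
    show "norm (y k t) \<le> C" if t: "t \<in> {0..1}" for k t
    proof -
      have "norm (y k t) \<le> C * \<bar>t - 0\<bar>" using ydist[OF t, of 0 k] yQ(2) by simp
      also have "\<dots> \<le> C * 1" using C t by (intro mult_left_mono) auto
      finally show ?thesis by simp
    qed
    show "\<exists>d>0. \<forall>n s. s \<in> {0..1} \<and> norm (t - s) < d \<longrightarrow> norm (y n t - y n s) < e" if t: "t \<in> {0..1}" and e: "0 < e" for t e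
    proof (intro exI[of _ "e / C"] conjI allI impI)
      fix n s assume s: "s \<in> {0..1} \<and> norm (t - s) < e / C"
      then have "C * \<bar>t - s\<bar> < e" using C by (simp add: field_simps)
      then show "norm (y n t - y n s) < e" using ydist[OF t, of s n] s by simp
    qed (use e C in simp)
  qed auto
  have lim: "(\<lambda>k. y (j k) t) \<longlonglongrightarrow> z t" if t: "t \<in> {0..1}" for t
  proof (rule LIMSEQ_I)
    fix e :: real assume "e > 0"
    from zj(3)[OF this] show "\<exists>N. \<forall>n\<ge>N. norm (y (j n) t - z t) < e" using t by blast
  qed
  have z01: "z 0 = 0" "z 1 = 0"
    using LIMSEQ_unique[OF lim[of 0], of 0] LIMSEQ_unique[OF lim[of 1], of 0] yQ(2,3) by auto
  have zlip: "C-lipschitz_on {0..1} z"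
  proof (rule lipschitz_onI)
    fix s t :: real assume st: "s \<in> {0..1}" "t \<in> {0..1}"
    have "(\<lambda>k. dist (y (j k) s) (y (j k) t)) \<longlonglongrightarrow> dist (z s) (z t)" by (intro tendsto_intros lim st)
    then show "dist (z s) (z t) \<le> C * dist s t"
      by (rule LIMSEQ_le_const2) (use lipschitz_onD[OF ylip st] in auto)
  qed (use C in simp)
  obtain u N where u: "rot_velocity z u" "negligible N"
    "\<And>t. t \<in> {0..1} - N \<Longrightarrow> (z has_vector_derivative cstruct (u t)) (at t within {0..1})"
    "\<And>t. t \<in> N \<Longrightarrow> u t = 0" "\<And>t. t \<in> {0..1} \<Longrightarrow> norm (u t) \<le> C"
    by (rule lipschitz_rot_velocity[OF zlip]) (rule that)
  have su: "support_fun K (u t) \<le> 1" if t: "t \<in> {0..1}" for t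
  proof (cases "t \<in> N")
    case True
    then show ?thesis using u(4) support_fun_scaleR[OF K(1) Kne, of 0 0] by simp
  next
    case False
    show ?thesis
    proof (rule support_fun_velocity_le[OF u(3) t Kne])
      show "t \<in> {0..1} - N" using t False by simp
      fix q a b assume q: "q \<in> K" and ab: "0 \<le> a" "a \<le> b" "b \<le> (1::real)"
      have lq: "(\<lambda>k. cstruct q \<bullet> (y (j k) b - y (j k) a)) \<longlonglongrightarrow> cstruct q \<bullet> (z b - z a)"
        by (intro tendsto_intros lim) (use ab in auto)
      have yq: "cstruct q \<bullet> (y k b - y k a) \<le> 1 * (b - a)" for k
      proof -
        have "cstruct q \<bullet> (y k b - y k a) \<le> integral {a..b} (\<lambda>t. support_fun K (w k t))"
          by (rule rot_velocity_inner_le[OF yQ(1) ab K(1) q])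
        also have "\<dots> \<le> integral {a..b} (\<lambda>t. 1)"
        proof (rule integral_le)
          show "(\<lambda>t. support_fun K (w k t)) integrable_on {a..b}"
            using absolutely_integrable_support_fun[OF K(1) Kne rot_velocity_integrable(1)[OF yQ(1) ab(1,3)]]
            by (auto simp: absolutely_integrable_on_def)
        qed (use yQ(4) ab in auto)
        finally show ?thesis using ab by simp
      qed
      show "cstruct q \<bullet> (z b - z a) \<le> 1 * (b - a)"
        by (rule LIMSEQ_le_const2[OF lq]) (use yq in blast)
    qed
  qed
  have "(\<lambda>k. area (y (j k)) (w (j k))) \<longlonglongrightarrow> area z u"
    by (rule area_tendsto[of "\<lambda>k. y (j k)" "\<lambda>k. w (j k)" C]) (use yQ(1) wC u C lim in auto)
  moreover have "(\<lambda>k. M - 1 / real (Suc (j k))) \<longlonglongrightarrow> M - 0"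
    by (intro tendsto_diff tendsto_const LIMSEQ_subseq_LIMSEQ[OF LIMSEQ_inverse_real_of_nat[unfolded inverse_eq_divide] zj(2), unfolded o_def])
  ultimately have "M - 0 \<le> area z u"
    by (intro LIMSEQ_le[of "\<lambda>k. M - 1 / real (Suc (j k))" "M - 0" "\<lambda>k. area (y (j k)) (w (j k))" "area z u"]) (use yw(2) in \<open>auto intro: less_imp_le\<close>)
  then have Mle: "M \<le> area z u" by simp
  show thesis
  proof (rule that[OF u(1) z01 u(2) su])
    show "area z u > 0" using Mle \<open>M > 0\<close> by simp
    show "(z has_vector_derivative cstruct (u t)) (at t within {0..1})" if "t \<in> {0..1} - N" for t using u(3)[OF that] .
    fix x v assume x: "rot_velocity x v" "x 0 = x 1" "\<forall>t\<in>{0..1}. support_fun K (v t) \<le> 1"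
    have "(\<lambda>t. x t + (- x 0), v) \<in> Q" using area_add_const(1)[OF x(1,2), of "- x 0"] x by (auto simp: Q_def)
    from M[OF this] show "area x v \<le> area z u"
      using area_add_const(2)[OF x(1,2), of "- x 0"] Mle by simp
  qed
qed

subsection \<open>Polar bodies\<close>

text \<open>The set of admissible rotated velocities, that is, the unit ball of the support
  function. When \<open>K\<close> is compact and convex with 0 in its interior, the support function
  of the polar body is the gauge of \<open>K\<close>.\<close>

definition polar_body :: "'a::real_inner set \<Rightarrow> 'a set" where
  "polar_body K = {u. \<forall>w\<in>K. u \<bullet> w \<le> 1}"

lemma polar_body_iff: "bounded K \<Longrightarrow> K \<noteq> {} \<Longrightarrow> u \<in> polar_body K \<longleftrightarrow> support_fun K u \<le> 1"
proof
  show "support_fun K u \<le> 1" if "bounded K" "K \<noteq> {}" "u \<in> polar_body K"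
    using that by (intro support_fun_le) (auto simp: polar_body_def)
  show "u \<in> polar_body K" if "bounded K" "K \<noteq> {}" "support_fun K u \<le> 1"
    using support_fun_ge[OF that(1), of _ u] that(3) by (force simp: polar_body_def)
qed

lemma zero_in_polar_body [simp]: "0 \<in> polar_body K"
  by (simp add: polar_body_def)

lemma convex_polar_body: "convex (polar_body K)"
proof -
  have "polar_body K = (\<Inter>w\<in>K. {u. w \<bullet> u \<le> 1})" by (auto simp: polar_body_def inner_commute)
  then show ?thesis by (simp add: convex_INT convex_halfspace_le)
qed

lemma closed_polar_body: "closed (polar_body K)"
proof -
  have "polar_body K = (\<Inter>w\<in>K. {u. w \<bullet> u \<le> 1})" by (auto simp: polar_body_def inner_commute)
  then show ?thesis by (simp add: closed_INT closed_halfspace_le)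
qed

lemma compact_polar_body:
  fixes K :: "'a::euclidean_space set"
  assumes "compact K" "cball 0 r \<subseteq> K" "r > 0"
  shows "compact (polar_body K)"
proof -
  have "K \<noteq> {}" using assms by auto
  have "norm u \<le> 1 / r" if "u \<in> polar_body K" for u
    using norm_le_support_fun[OF compact_imp_bounded[OF assms(1)] assms(2,3), of u] that
      polar_body_iff[OF compact_imp_bounded[OF assms(1)] \<open>K \<noteq> {}\<close>, of u] assms(3) by (auto simp: field_simps)
  then have "bounded (polar_body K)" by (auto simp: bounded_iff)
  then show ?thesis by (simp add: compact_eq_bounded_closed closed_polar_body)
qed

text \<open>As 0 lies in \<open>K\<close>, a hyperplane separating \<open>x\<close> from
  \<open>K\<close> has negative level \<open>b\<close>; dividing its normal by \<open>b\<close>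
  gives an element of the polar body whose product with \<open>x\<close> exceeds 1.\<close>

lemma bipolar:
  fixes K :: "'a::euclidean_space set"
  assumes "compact K" "convex K" "0 \<in> K" and x: "\<And>u. u \<in> polar_body K \<Longrightarrow> x \<bullet> u \<le> 1"
  shows "x \<in> K"
proof (rule ccontr)
  assume "x \<notin> K"
  then obtain a b where ab: "a \<bullet> x < b" "\<And>y. y \<in> K \<Longrightarrow> a \<bullet> y > b"
    using separating_hyperplane_closed_point[OF assms(2) compact_imp_closed[OF assms(1)]] by blast
  have b: "b < 0" using ab(2)[OF assms(3)] by simp
  define u where "u = (1 / b) *\<^sub>R a"
  have "u \<in> polar_body K"
    using ab(2) b by (auto simp: polar_body_def u_def field_simps intro: less_imp_le)
  from x[OF this] show False using ab(1) b by (simp add: u_def inner_commute field_simps)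
qed

subsection \<open>Existence of closed characteristics\<close>

lemma has_integral_inner_const:
  fixes w :: "real \<Rightarrow> 'a::euclidean_space"
  assumes "w absolutely_integrable_on {a..b}"
  shows "((\<lambda>t. c \<bullet> w t) has_integral c \<bullet> integral {a..b} w) {a..b}"
proof -
  have "w integrable_on {a..b}" using assms by (auto simp: absolutely_integrable_on_def)
  from has_integral_linear[OF integrable_integral[OF this] bounded_linear_inner_right[of c]]
  show ?thesis by (simp add: o_def)
qed

text \<open>Moves the maximiser along a segment towards the loop \<open>y\<close> with velocity
  \<open>w\<close>; convexity of the polar body keeps the segment admissible. The area is a
  quadratic polynomial in \<open>s\<close> whose two mixed terms agree by
  \<open>area_bilinear_commute\<close>, and its linear coefficient cannot be positive.\<close>

lemma maximizer_first_order:
  assumes z: "rot_velocity z u" "z 0 = 0" "z 1 = 0"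
    and su: "\<And>t. t \<in> {0..1} \<Longrightarrow> u t \<in> polar_body K"
    and max: "\<And>x v. rot_velocity x v \<Longrightarrow> x 0 = x 1 \<Longrightarrow> \<forall>t\<in>{0..1}. v t \<in> polar_body K \<Longrightarrow> area x v \<le> area z u"
    and w: "w absolutely_integrable_on {0..1}" "\<And>t. t \<in> {0..1} \<Longrightarrow> w t \<in> polar_body K" "integral {0..1} w = 0"
  shows "integral {0..1} (\<lambda>t. z t \<bullet> w t) \<le> integral {0..1} (\<lambda>t. z t \<bullet> u t)"
proof -
  define y where "y t = cstruct (integral {0..t} w)" for t :: real
  have y: "rot_velocity y w" "y 0 = 0" "y 1 = 0"
    using w by (auto simp: rot_velocity_def y_def)
  have zi: "(\<lambda>t. z t \<bullet> f t) integrable_on {0..1}" "(\<lambda>t. y t \<bullet> f t) integrable_on {0..1}"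
    if "f absolutely_integrable_on {0..1}" for f
    using absolutely_integrable_inner[OF rot_velocity_continuous[OF z(1)] that]
      absolutely_integrable_inner[OF rot_velocity_continuous[OF y(1)] that]
    by (auto simp: absolutely_integrable_on_def)
  note ui = rot_velocity_integrable(1)[OF z(1), of 0 1, simplified]
  define A where "A = integral {0..1} (\<lambda>t. z t \<bullet> u t)"
  define B where "B = integral {0..1} (\<lambda>t. z t \<bullet> w t)"
  define Q where "Q = integral {0..1} (\<lambda>t. (y t - z t) \<bullet> (w t - u t))"
  have B': "integral {0..1} (\<lambda>t. y t \<bullet> u t) = B"
    unfolding B_def by (rule area_bilinear_commute[OF y(1) _ z(1)]) (use y z in auto)
  have *: "2 * (B - A) + s * Q \<le> 0" if s: "0 < s" "s \<le> 1" for s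
  proof -
    define x where "x t = (1 - s) *\<^sub>R z t + s *\<^sub>R y t" for t
    define v where "v t = (1 - s) *\<^sub>R u t + s *\<^sub>R w t" for t
    have vi: "v absolutely_integrable_on {0..1}" unfolding v_def[abs_def] using ui w(1) by (intro set_integral_add) auto
    have "x t = x 0 + cstruct (integral {0..t} v)" if t: "t \<in> {0..1}" for t
    proof -
      have i: "u integrable_on {0..t}" "w integrable_on {0..t}"
        using rot_velocity_integrable(2)[OF z(1), of 0 t] rot_velocity_integrable(2)[OF y(1), of 0 t] t by auto
      have "integral {0..t} v = (1 - s) *\<^sub>R integral {0..t} u + s *\<^sub>R integral {0..t} w"
        unfolding v_def[abs_def] using i
        by (subst Henstock_Kurzweil_Integration.integral_add) (auto intro: integrable_cmul)
      moreover have "z t = cstruct (integral {0..t} u)" "y t = cstruct (integral {0..t} w)"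
        using rot_velocity_eq[OF z(1) t] rot_velocity_eq[OF y(1) t] z y by auto
      ultimately show ?thesis using z y by (simp add: x_def)
    qed
    with vi have x: "rot_velocity x v" unfolding rot_velocity_def by blast
    have "area x v \<le> area z u"
    proof (rule max[OF x])
      show "x 0 = x 1" using z y by (simp add: x_def)
      have "v t \<in> polar_body K" if "t \<in> {0..1}" for t
        using convexD[OF convex_polar_body su[OF that] w(2)[OF that], of "1 - s" s] s by (simp add: v_def)
      then show "\<forall>t\<in>{0..1}. v t \<in> polar_body K" ..
    qed
    moreover have "integral {0..1} (\<lambda>t. x t \<bullet> v t) = A + s * (2 * (B - A)) + s\<^sup>2 * Q"
    proof -
      have "x t \<bullet> v t = z t \<bullet> u t + s * (z t \<bullet> w t + y t \<bullet> u t - 2 * (z t \<bullet> u t)) + s\<^sup>2 * ((y t - z t) \<bullet> (w t - u t))" for t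
        by (simp add: x_def v_def inner_add_left inner_add_right inner_diff_left inner_diff_right power2_eq_square algebra_simps)
      moreover have "((\<lambda>t. z t \<bullet> u t + s * (z t \<bullet> w t + y t \<bullet> u t - 2 * (z t \<bullet> u t)) + s\<^sup>2 * ((y t - z t) \<bullet> (w t - u t)))
          has_integral A + s * (B + B - 2 * A) + s\<^sup>2 * Q) {0..1}"
      proof (intro has_integral_add has_integral_mult_right has_integral_diff)
        show "((\<lambda>t. z t \<bullet> u t) has_integral A) {0..1}" "((\<lambda>t. z t \<bullet> u t) has_integral A) {0..1}"
          unfolding A_def by (rule integrable_integral[OF zi(1)[OF ui]])+
        show "((\<lambda>t. z t \<bullet> w t) has_integral B) {0..1}" unfolding B_def by (rule integrable_integral[OF zi(1)[OF w(1)]])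
        show "((\<lambda>t. y t \<bullet> u t) has_integral B) {0..1}" unfolding B'[symmetric] by (rule integrable_integral[OF zi(2)[OF ui]])
        have "(\<lambda>t. w t - u t) absolutely_integrable_on {0..1}" using ui w(1) by (intro set_integral_diff)
        from Henstock_Kurzweil_Integration.integrable_diff[OF zi(2)[OF this] zi(1)[OF this]]
        show "((\<lambda>t. (y t - z t) \<bullet> (w t - u t)) has_integral Q) {0..1}"
          unfolding Q_def by (intro integrable_integral) (simp add: inner_diff_left)
      qed
      ultimately show ?thesis by (simp add: integral_unique)
    qed
    ultimately have "s * (2 * (B - A) + s * Q) \<le> 0" by (simp add: area_def A_def[symmetric] power2_eq_square algebra_simps)
    then show ?thesis using s by (simp add: mult_le_0_iff)
  qed
  have "2 * (B - A) \<le> 0"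
  proof (rule tendsto_upperbound[of "\<lambda>s. 2 * (B - A) + s * Q" _ "at_right 0"])
    have "((\<lambda>s. 2 * (B - A) + s * Q) \<longlongrightarrow> 2 * (B - A) + 0 * Q) (at_right 0)" by (intro tendsto_intros)
    then show "((\<lambda>s. 2 * (B - A) + s * Q) \<longlongrightarrow> 2 * (B - A)) (at_right 0)" by simp
    show "\<forall>\<^sub>F s in at_right 0. 2 * (B - A) + s * Q \<le> 0"
    proof (rule eventually_mono[OF eventually_at_right_real[of 0 1]])
      fix s :: real assume "s \<in> {0<..<1}"
      then show "2 * (B - A) + s * Q \<le> 0" by (intro *) auto
    qed simp
  qed simp
  then show ?thesis by (simp add: A_def B_def)
qed

text \<open>
  The closing condition is removed with a Lagrange multiplier \<open>c\<close>, obtained from a hyperplane that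
  separates the attainable pairs (displacement, at most this value) from the larger values at
  displacement 0.
\<close>

lemma maximizer_multiplier:
  fixes z :: "real \<Rightarrow> 'n::finite phase"
  assumes z: "rot_velocity z u" "z 0 = 0" "z 1 = 0" and K: "compact K"
    and su: "\<And>t. t \<in> {0..1} \<Longrightarrow> u t \<in> polar_body K"
    and max: "\<And>x v. rot_velocity x v \<Longrightarrow> x 0 = x 1 \<Longrightarrow> \<forall>t\<in>{0..1}. v t \<in> polar_body K \<Longrightarrow> area x v \<le> area z u"
  obtains c where "\<And>w :: real \<Rightarrow> 'n phase. w absolutely_integrable_on {0..1} \<Longrightarrow> \<forall>t\<in>{0..1}. w t \<in> polar_body K \<Longrightarrow>
    integral {0..1} (\<lambda>t. (z t + c) \<bullet> w t) \<le> integral {0..1} (\<lambda>t. (z t + c) \<bullet> u t)"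
proof -
  define W where "W = {w :: real \<Rightarrow> 'n phase. w absolutely_integrable_on {0..1} \<and> (\<forall>t\<in>{0..1}. w t \<in> polar_body K)}"
  define A where "A = integral {0..1} (\<lambda>t. z t \<bullet> u t)"
  have zi: "(\<lambda>t. z t \<bullet> f t) integrable_on {0..1}" if "f absolutely_integrable_on {0..1}" for f
    using absolutely_integrable_inner[OF rot_velocity_continuous[OF z(1)] that]
    by (auto simp: absolutely_integrable_on_def)
  define S where "S = {(integral {0..1} w, q) | w q. w \<in> W \<and> q \<le> integral {0..1} (\<lambda>t. z t \<bullet> w t)}"
  define T where "T = {(0 :: 'n phase, q) | q :: real. q > A}"
  have "convex S"
  proof (rule convexI)
    fix p1 p2 and a b :: real assume p: "p1 \<in> S" "p2 \<in> S" and ab: "0 \<le> a" "0 \<le> b" "a + b = 1"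
    obtain w1 q1 where 1: "p1 = (integral {0..1} w1, q1)" "w1 \<in> W" "q1 \<le> integral {0..1} (\<lambda>t. z t \<bullet> w1 t)"
      using p(1) by (auto simp: S_def)
    obtain w2 q2 where 2: "p2 = (integral {0..1} w2, q2)" "w2 \<in> W" "q2 \<le> integral {0..1} (\<lambda>t. z t \<bullet> w2 t)"
      using p(2) by (auto simp: S_def)
    define w where "w t = a *\<^sub>R w1 t + b *\<^sub>R w2 t" for t :: real
    have wi: "w1 absolutely_integrable_on {0..1}" "w2 absolutely_integrable_on {0..1}" using 1 2 by (auto simp: W_def)
    have wi': "w1 integrable_on {0..1}" "w2 integrable_on {0..1}" using wi by (auto simp: absolutely_integrable_on_def)
    have "w \<in> W" unfolding W_def
    proof (intro CollectI conjI ballI)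
      show "w absolutely_integrable_on {0..1}" unfolding w_def[abs_def] using wi by (intro set_integral_add) auto
      fix t :: real assume "t \<in> {0..1}"
      then show "w t \<in> polar_body K" unfolding w_def
        using 1 2 ab by (intro convexD[OF convex_polar_body]) (auto simp: W_def)
    qed
    moreover have "integral {0..1} w = a *\<^sub>R integral {0..1} w1 + b *\<^sub>R integral {0..1} w2"
      unfolding w_def[abs_def] using wi'
      by (subst Henstock_Kurzweil_Integration.integral_add) (auto intro: integrable_cmul)
    moreover have "((\<lambda>t. a * (z t \<bullet> w1 t) + b * (z t \<bullet> w2 t)) has_integral
        a * integral {0..1} (\<lambda>t. z t \<bullet> w1 t) + b * integral {0..1} (\<lambda>t. z t \<bullet> w2 t)) {0..1}"
      by (intro has_integral_add has_integral_mult_right integrable_integral zi wi)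
    then have "integral {0..1} (\<lambda>t. z t \<bullet> w t) = a * integral {0..1} (\<lambda>t. z t \<bullet> w1 t) + b * integral {0..1} (\<lambda>t. z t \<bullet> w2 t)"
      by (simp add: w_def inner_add_right integral_unique)
    moreover have "a * q1 + b * q2 \<le> a * integral {0..1} (\<lambda>t. z t \<bullet> w1 t) + b * integral {0..1} (\<lambda>t. z t \<bullet> w2 t)"
      using 1(3) 2(3) ab by (intro add_mono mult_left_mono) auto
    ultimately show "a *\<^sub>R p1 + b *\<^sub>R p2 \<in> S"
      unfolding S_def 1(1) 2(1) by (intro CollectI exI[of _ w] exI[of _ "a * q1 + b * q2"]) auto
  qed
  moreover have "convex T"
  proof -
    have "T = {0} \<times> {A<..}" by (auto simp: T_def)
    then show ?thesis by (simp add: convex_Times)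
  qed
  moreover have "(integral {0..1} u, A) \<in> S"
    using rot_velocity_integrable(1)[OF z(1), of 0 1] su by (auto simp: S_def A_def W_def)
  moreover have "(0, A + 1) \<in> T" by (auto simp: T_def)
  moreover have "S \<inter> T = {}"
  proof -
    have False if w: "w \<in> W" "integral {0..1} w = 0" "A < integral {0..1} (\<lambda>t. z t \<bullet> w t)" for w
    proof -
      have "integral {0..1} (\<lambda>t. z t \<bullet> w t) \<le> integral {0..1} (\<lambda>t. z t \<bullet> u t)"
      proof (rule maximizer_first_order[OF z su max])
        show "w absolutely_integrable_on {0..1}" "integral {0..1} w = 0" using w by (auto simp: W_def)
        show "w t \<in> polar_body K" if "t \<in> {0..1}" for t using w that by (simp add: W_def)
      qed
      then show False using w(3) by (simp add: A_def)
    qed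
    moreover have "\<exists>w. w \<in> W \<and> integral {0..1} w = 0 \<and> A < integral {0..1} (\<lambda>t. z t \<bullet> w t)" if p: "p \<in> S" "p \<in> T" for p
    proof -
      obtain w q where wq: "p = (integral {0..1} w, q)" "w \<in> W" "q \<le> integral {0..1} (\<lambda>t. z t \<bullet> w t)"
        using p(1) unfolding S_def by blast
      with p(2) have "integral {0..1} w = 0" "A < q" by (auto simp: T_def)
      with wq show ?thesis by (intro exI[of _ w]) simp
    qed
    ultimately show ?thesis by blast
  qed
  ultimately obtain \<alpha> b where ab: "\<alpha> \<noteq> 0" "\<And>x. x \<in> S \<Longrightarrow> \<alpha> \<bullet> x \<le> b" "\<And>x. x \<in> T \<Longrightarrow> \<alpha> \<bullet> x \<ge> b"
    using separating_hyperplane_sets[of S T] by blast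
  obtain a \<beta> where \<alpha>: "\<alpha> = (a, \<beta>)" by (cases \<alpha>)
  have S: "a \<bullet> integral {0..1} w + \<beta> * integral {0..1} (\<lambda>t. z t \<bullet> w t) \<le> b" if "w \<in> W" for w
    using ab(2)[of "(integral {0..1} w, integral {0..1} (\<lambda>t. z t \<bullet> w t))"] that \<alpha> by (auto simp: S_def)
  have T: "b \<le> \<beta> * q" if "q > A" for q
    using ab(3)[of "(0, q)"] that \<alpha> by (auto simp: T_def)
  have "u \<in> W" using rot_velocity_integrable(1)[OF z(1), of 0 1] su by (auto simp: W_def)
  have "integral {0..1} u = 0" by (rule rot_velocity_closed[OF z(1)]) (use z in simp)
  have \<beta>A: "\<beta> * A \<le> b" using S[OF \<open>u \<in> W\<close>] \<open>integral {0..1} u = 0\<close> by (simp add: A_def)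
  have "\<beta> \<ge> 0"
  proof -
    have "\<beta> * A \<le> \<beta> * (A + 1)" using T[of "A + 1"] \<beta>A by simp
    then show ?thesis by (simp add: algebra_simps)
  qed
  \<comment> \<open>A vertical hyperplane would bound displacements in direction \<open>a\<close> by
    \<open>b \<le> 0\<close>. Since \<open>K\<close> is bounded, the constant velocity
    \<open>\<delta> *\<^sub>R a\<close> is admissible for small \<open>\<delta>\<close>, and it has
    a positive displacement in that direction.\<close>
  moreover have "\<beta> \<noteq> 0"
  proof
    assume \<beta>: "\<beta> = 0"
    then have "b \<le> 0" using T[of "A + 1"] by simp
    have "(0 :: 'n phase \<times> real) = (0, 0)" by (rule zero_prod_def)
    then have "a \<noteq> 0" using ab(1) \<alpha> \<beta> by metis
    obtain R where R: "R > 0" "\<And>w. w \<in> K \<Longrightarrow> norm w \<le> R" by (rule compact_norm_bound[OF K]) (rule that)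
    define \<delta> where "\<delta> = 1 / (norm a * R)"
    have \<delta>: "\<delta> > 0" using \<open>a \<noteq> 0\<close> R by (simp add: \<delta>_def)
    have "\<delta> *\<^sub>R a \<in> polar_body K" unfolding polar_body_def
    proof (intro CollectI ballI)
      fix w assume "w \<in> K"
      have "a \<bullet> w \<le> norm a * norm w" by (rule norm_cauchy_schwarz)
      also have "\<dots> \<le> norm a * R" using R(2)[OF \<open>w \<in> K\<close>] by (simp add: mult_left_mono)
      finally show "(\<delta> *\<^sub>R a) \<bullet> w \<le> 1" using \<open>a \<noteq> 0\<close> R(1) by (simp add: \<delta>_def divide_le_eq)
    qed
    then have "(\<lambda>t. \<delta> *\<^sub>R a) \<in> W" by (simp add: W_def absolutely_integrable_continuous_real)
    from S[OF this] have "\<delta> * (a \<bullet> a) \<le> b" using \<beta> by simp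
    then show False using \<open>b \<le> 0\<close> \<delta> \<open>a \<noteq> 0\<close> by (smt (verit) inner_gt_zero_iff mult_pos_pos)
  qed
  ultimately have \<beta>: "\<beta> > 0" by simp
  have bA: "b \<le> \<beta> * A"
  proof (rule field_le_epsilon)
    fix e :: real assume "e > 0"
    then have "b \<le> \<beta> * (A + e / \<beta>)" using \<beta> by (intro T) simp
    then show "b \<le> \<beta> * A + e" using \<beta> by (simp add: distrib_left)
  qed
  define c where "c = (1/\<beta>) *\<^sub>R a"
  have zc: "integral {0..1} (\<lambda>t. (z t + c) \<bullet> w t) = integral {0..1} (\<lambda>t. z t \<bullet> w t) + c \<bullet> integral {0..1} w"
    if "w absolutely_integrable_on {0..1}" for w
    using has_integral_add[OF integrable_integral[OF zi[OF that]] has_integral_inner_const[OF that, of c]]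
    by (simp add: inner_add_left integral_unique)
  show thesis
  proof (rule that[of c])
    fix w :: "real \<Rightarrow> 'n phase"
    assume w: "w absolutely_integrable_on {0..1}" "\<forall>t\<in>{0..1}. w t \<in> polar_body K"
    then have "w \<in> W" by (simp add: W_def)
    from S[OF this] bA have "a \<bullet> integral {0..1} w + \<beta> * integral {0..1} (\<lambda>t. z t \<bullet> w t) \<le> \<beta> * A" by simp
    then have "c \<bullet> integral {0..1} w + integral {0..1} (\<lambda>t. z t \<bullet> w t) \<le> A"
      using \<beta> by (simp add: c_def field_simps)
    then show "integral {0..1} (\<lambda>t. (z t + c) \<bullet> w t) \<le> integral {0..1} (\<lambda>t. (z t + c) \<bullet> u t)"
      using zc[OF w(1)] zc[of u] \<open>u \<in> W\<close> \<open>integral {0..1} u = 0\<close> by (simp add: W_def A_def)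
  qed
qed

lemma AE_lebesgue_on_iff_negligible:
  fixes a b :: real
  shows "(AE t in lebesgue_on {a..b}. P t) \<longleftrightarrow> (\<exists>N. negligible N \<and> (\<forall>t\<in>{a..b} - N. P t))"
proof -
  have "(AE t in lebesgue_on {a..b}. P t) \<longleftrightarrow> (AE t in lebesgue. t \<in> {a..b} \<longrightarrow> P t)"
    by (rule AE_restrict_space_iff) simp
  also have "\<dots> \<longleftrightarrow> (\<exists>N\<in>null_sets lebesgue. {t\<in>space lebesgue. \<not> (t \<in> {a..b} \<longrightarrow> P t)} \<subseteq> N)"
    by (simp add: eventually_ae_filter)
  also have "\<dots> \<longleftrightarrow> (\<exists>N. negligible N \<and> (\<forall>t\<in>{a..b} - N. P t))"
    unfolding Bex_def negligible_iff_null_sets by (intro ex_cong1) auto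
  finally show ?thesis .
qed

lemma action_eq_area:
  assumes "negligible N"
    and "\<And>t. t \<in> {0..1} - N \<Longrightarrow> (\<gamma> has_vector_derivative cstruct (v t)) (at t within {0..1})"
  shows "action \<gamma> = area \<gamma> v"
proof -
  have "action \<gamma> = integral {0..1} (\<lambda>t. (\<gamma> t \<bullet> v t) / 2)"
    unfolding action_def
  proof (rule integral_spike[OF assms(1)])
    fix t assume t: "t \<in> {0..1} - N"
    then have "vector_derivative \<gamma> (at t within {0..1}) = cstruct (v t)"
      using vector_derivative_within_closed_interval[OF _ _ assms(2)[OF t]] by simp
    then show "\<gamma> t \<bullet> v t / 2 = omega (\<gamma> t) (vector_derivative \<gamma> (at t within {0..1})) / 2"
      by (simp add: omega_cstruct)
  qed
  then show ?thesis by (simp add: area_def)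
qed

text \<open>Needle variation: replace \<open>u\<close> by \<open>p\<close> on
  \<open>[t, t + h]\<close> alone and divide the resulting inequality by \<open>h\<close>. The
  integral of \<open>u\<close> over that interval is a rotated increment of \<open>z\<close>, so
  differentiability of \<open>z\<close> at \<open>t\<close> gives the limit of its averages.\<close>

lemma multiplier_pointwise:
  fixes z :: "real \<Rightarrow> 'n::finite phase"
  assumes z: "rot_velocity z u" and u: "\<And>t. t \<in> {0..1} \<Longrightarrow> u t \<in> P"
    and P: "\<And>p. p \<in> P \<Longrightarrow> norm p \<le> C"
    and mult: "\<And>w. w absolutely_integrable_on {0..1} \<Longrightarrow> \<forall>t\<in>{0..1}. w t \<in> P \<Longrightarrow>
      integral {0..1} (\<lambda>t. (z t + c) \<bullet> w t) \<le> integral {0..1} (\<lambda>t. (z t + c) \<bullet> u t)"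
    and t: "0 \<le> t" "t < 1" and der: "(z has_vector_derivative cstruct (u t)) (at t within {0..1})" and p: "p \<in> P"
  shows "(z t + c) \<bullet> p \<le> (z t + c) \<bullet> u t"
proof -
  define a where "a = z t + c"
  have C: "0 \<le> C" using P[OF p] norm_ge_zero order_trans by blast
  note lip = rot_velocity_lipschitz[OF z P[OF u] C]
  have *: "a \<bullet> p \<le> a \<bullet> u t + \<epsilon> * (norm a + 2 * C\<^sup>2)" if \<epsilon>: "\<epsilon> > 0" for \<epsilon>
  proof -
    obtain d where d: "d > 0" "\<And>s. s \<in> {0..1} \<Longrightarrow> norm (s - t) < d \<Longrightarrow> norm (z s - z t - (s - t) *\<^sub>R cstruct (u t)) \<le> \<epsilon> * norm (s - t)"
      using der \<epsilon> unfolding has_vector_derivative_def has_derivative_within_alt by blast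
    \<comment> \<open>On the short interval \<open>z\<close> moves by at most \<open>C * h\<close>
      and \<open>p - u s\<close> has norm at most \<open>2 * C\<close>; after division by
      \<open>h\<close> the error \<open>2 * C\<^sup>2 * h\<close> is controlled through
      \<open>h \<le> \<epsilon>\<close>. The bound \<open>1 - t\<close> keeps the interval inside
      \<open>[0, 1]\<close>.\<close>
    define h where "h = min (d/2) (min \<epsilon> (1 - t))"
    have h: "0 < h" "h < d" "h \<le> \<epsilon>" "t + h \<le> 1" using d t \<epsilon> by (auto simp: h_def)
    define I where "I = {t..t+h}"
    have I: "I \<subseteq> {0..1}" using t h by (auto simp: I_def)
    define f where "f s = (if s \<in> I then p - u s else 0)" for s
    define w where "w s = u s + f s" for s
    have ui: "u absolutely_integrable_on {0..1}" "u absolutely_integrable_on {t..t+h}" "u integrable_on {t..t+h}"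
      using rot_velocity_integrable[OF z] t h by auto
    have pu: "(\<lambda>s. p - u s) absolutely_integrable_on I"
      unfolding I_def
      by (rule set_integral_diff(1)[OF absolutely_integrable_continuous_real[OF continuous_on_const] ui(2)])
    then have "f absolutely_integrable_on UNIV"
      unfolding f_def[abs_def] by (simp only: absolutely_integrable_restrict_UNIV)
    then have fi: "f absolutely_integrable_on {0..1}" by (rule absolutely_integrable_on_subinterval) simp
    have wi: "w absolutely_integrable_on {0..1}" unfolding w_def[abs_def] by (rule set_integral_add(1)[OF ui(1) fi])
    have wP: "\<forall>s\<in>{0..1}. w s \<in> P" using u p by (simp add: w_def f_def)
    have zc: "continuous_on {0..1} (\<lambda>s. z s + c)" by (intro continuous_intros rot_velocity_continuous[OF z])
    have zci: "(\<lambda>s. (z s + c) \<bullet> g s) integrable_on {0..1}" if "g absolutely_integrable_on {0..1}" for g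
      using absolutely_integrable_inner[OF zc that] by (auto simp: absolutely_integrable_on_def)
    have "integral {0..1} (\<lambda>s. (z s + c) \<bullet> w s) = integral {0..1} (\<lambda>s. (z s + c) \<bullet> u s) + integral {0..1} (\<lambda>s. (z s + c) \<bullet> f s)"
      using Henstock_Kurzweil_Integration.integral_add[OF zci[OF ui(1)] zci[OF fi]] by (simp add: w_def inner_add_right)
    then have le0: "integral {0..1} (\<lambda>s. (z s + c) \<bullet> f s) \<le> 0" using mult[OF wi wP] by simp
    have "(\<lambda>s. (z s + c) \<bullet> f s) = (\<lambda>s. if s \<in> I then (z s + c) \<bullet> (p - u s) else 0)" by (auto simp: f_def)
    then have "integral I (\<lambda>s. (z s + c) \<bullet> (p - u s)) \<le> 0"
      using le0 integral_restrict_Int[of "{0..1}" I "\<lambda>s. (z s + c) \<bullet> (p - u s)"] Int_absorb2[OF I] by simp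
    moreover have "integral I (\<lambda>s. a \<bullet> (p - u s) - 2 * C\<^sup>2 * h) \<le> integral I (\<lambda>s. (z s + c) \<bullet> (p - u s))"
    proof (rule integral_le)
      show "(\<lambda>s. a \<bullet> (p - u s) - 2 * C\<^sup>2 * h) integrable_on I"
        using has_integral_inner_const[OF pu[unfolded I_def], of a] unfolding I_def
        by (intro Henstock_Kurzweil_Integration.integrable_diff) auto
      show "(\<lambda>s. (z s + c) \<bullet> (p - u s)) integrable_on I"
        using absolutely_integrable_inner[OF continuous_on_subset[OF zc I[unfolded I_def]] pu[unfolded I_def]]
        by (auto simp: absolutely_integrable_on_def I_def)
      fix s assume s: "s \<in> I"
      then have s01: "s \<in> {0..1}" using I by auto
      have t01: "t \<in> {0..1}" using t by simp
      have sI: "t \<le> s" "s \<le> t + h" using s by (auto simp: I_def)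
      have "norm (z s - z t) \<le> C * \<bar>s - t\<bar>" using lipschitz_onD[OF lip s01 t01] by (simp add: dist_norm)
      also have "\<dots> \<le> C * h" using sI C by (intro mult_left_mono) auto
      finally have n1: "norm (z s - z t) \<le> C * h" .
      have n2: "norm (p - u s) \<le> 2 * C" using norm_triangle_ineq4[of p "u s"] P[OF p] P[OF u[OF s01]] by linarith
      have "- ((z s - z t) \<bullet> (p - u s)) \<le> norm (z s - z t) * norm (p - u s)"
        using Cauchy_Schwarz_ineq2[of "z s - z t" "p - u s"] by linarith
      also have "\<dots> \<le> (C * h) * (2 * C)" using n1 n2 C h by (intro mult_mono) auto
      also have "\<dots> = 2 * C\<^sup>2 * h" by (simp add: power2_eq_square)
      finally have "- ((z s - z t) \<bullet> (p - u s)) \<le> 2 * C\<^sup>2 * h" .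
      moreover have "(z s + c) \<bullet> (p - u s) = a \<bullet> (p - u s) + (z s - z t) \<bullet> (p - u s)"
        by (simp add: a_def inner_add_left inner_diff_left)
      ultimately show "a \<bullet> (p - u s) - 2 * C\<^sup>2 * h \<le> (z s + c) \<bullet> (p - u s)" by simp
    qed
    moreover have "integral I (\<lambda>s. a \<bullet> (p - u s) - 2 * C\<^sup>2 * h) = a \<bullet> (h *\<^sub>R p - integral I u) - 2 * C\<^sup>2 * h * h"
    proof -
      have "integral I (\<lambda>s. p - u s) = h *\<^sub>R p - integral I u"
        unfolding I_def using ui(3) h by (subst Henstock_Kurzweil_Integration.integral_diff) auto
      then have "((\<lambda>s. a \<bullet> (p - u s)) has_integral a \<bullet> (h *\<^sub>R p - integral I u)) I"
        using has_integral_inner_const[OF pu[unfolded I_def], of a] by (simp add: I_def)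
      moreover have "((\<lambda>s. 2 * C\<^sup>2 * h) has_integral 2 * C\<^sup>2 * h * h) I"
        using has_integral_const_real[of "2 * C\<^sup>2 * h" t "t+h"] h by (simp add: I_def mult_ac)
      ultimately have "((\<lambda>s. a \<bullet> (p - u s) - 2 * C\<^sup>2 * h) has_integral a \<bullet> (h *\<^sub>R p - integral I u) - 2 * C\<^sup>2 * h * h) I"
        by (rule has_integral_diff)
      then show ?thesis by (rule integral_unique)
    qed
    ultimately have 1: "h * (a \<bullet> p) \<le> a \<bullet> integral I u + 2 * C\<^sup>2 * h * h"
      by (simp add: inner_diff_right)
    define \<Delta> where "\<Delta> = z (t + h) - z t - h *\<^sub>R cstruct (u t)"
    have n\<Delta>: "norm \<Delta> \<le> \<epsilon> * h" using d(2)[of "t + h"] h t by (simp add: \<Delta>_def)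
    have "cstruct (integral I u) = z (t + h) - z t"
      unfolding I_def using rot_velocity_diff[OF z, of t "t + h"] t h by simp
    then have "cstruct (cstruct (integral I u)) = cstruct (\<Delta> + h *\<^sub>R cstruct (u t))" by (simp add: \<Delta>_def)
    then have "integral I u = h *\<^sub>R u t - cstruct \<Delta>" by (simp add: algebra_simps neg_eq_iff_add_eq_0)
    then have "a \<bullet> integral I u = h * (a \<bullet> u t) - a \<bullet> cstruct \<Delta>" by (simp add: inner_diff_right)
    moreover have "- (a \<bullet> cstruct \<Delta>) \<le> norm a * (\<epsilon> * h)"
    proof -
      have "- (a \<bullet> cstruct \<Delta>) \<le> norm a * norm (cstruct \<Delta>)" using Cauchy_Schwarz_ineq2[of a "cstruct \<Delta>"] by linarith
      also have "\<dots> \<le> norm a * (\<epsilon> * h)" using n\<Delta> by (simp add: mult_left_mono)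
      finally show ?thesis .
    qed
    ultimately have "h * (a \<bullet> p) \<le> h * (a \<bullet> u t) + norm a * (\<epsilon> * h) + 2 * C\<^sup>2 * h * h" using 1 by simp
    then have "h * (a \<bullet> p) \<le> h * (a \<bullet> u t + norm a * \<epsilon> + 2 * C\<^sup>2 * h)" by (simp add: algebra_simps)
    then have "a \<bullet> p \<le> a \<bullet> u t + norm a * \<epsilon> + 2 * C\<^sup>2 * h" using h(1) by simp
    also have "2 * C\<^sup>2 * h \<le> 2 * C\<^sup>2 * \<epsilon>" using h(3) by (intro mult_left_mono) auto
    finally show ?thesis by (simp add: algebra_simps)
  qed
  show ?thesis unfolding a_def[symmetric]
  proof (rule field_le_epsilon)
    fix e :: real assume e: "e > 0"
    define D where "D = norm a + 2 * C\<^sup>2 + 1"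
    have D: "D > 0" unfolding D_def by (simp add: add_nonneg_pos)
    have "e / D * (norm a + 2 * C\<^sup>2) \<le> e / D * D" using e D by (intro mult_left_mono) (auto simp: D_def)
    then show "a \<bullet> p \<le> a \<bullet> u t + e" using *[of "e / D"] e D by simp
  qed
qed

text \<open>By the pointwise condition \<open>u t\<close> attains the supremum of
  \<open>(z t + c) \<bullet> p\<close> over the polar body, which makes it normal at
  \<open>z t + c\<close> to a level set of the gauge \<open>g\<close>. The motion runs along
  \<open>J (u t)\<close>, tangentially, so \<open>g\<close> keeps a constant value
  \<open>\<rho> = 2 * M\<close>. Dividing by \<open>\<rho>\<close> puts the curve on the frontier of
  \<open>K\<close> and gives it the action \<open>M / \<rho>\<^sup>2 = 1 / (4 * M)\<close>.\<close>

theorem exists_closed_characteristic: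
  fixes K :: "'n::finite phase set"
  assumes K: "compact K" "convex K" "cball 0 r \<subseteq> K" "r > 0"
  obtains \<gamma> M where "M > 0" "gen_closed_characteristic K \<gamma>" "action \<gamma> = 1 / (4 * M)"
    "\<And>x v. rot_velocity x v \<Longrightarrow> x 0 = x 1 \<Longrightarrow> \<forall>t\<in>{0..1}. support_fun K (v t) \<le> 1 \<Longrightarrow> area x v \<le> M"
proof -
  note bK = compact_imp_bounded[OF K(1)]
  have K0: "0 \<in> K" using K by auto
  then have Kne: "K \<noteq> {}" by auto
  note pol = polar_body_iff[OF bK Kne]
  define P where "P = polar_body K"
  have cP: "compact P" unfolding P_def by (rule compact_polar_body[OF K(1,3,4)])
  note bP = compact_imp_bounded[OF cP]
  have P0: "0 \<in> P" by (simp add: P_def)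
  then have Pne: "P \<noteq> {}" by auto
  obtain C where C: "C > 0" "\<And>p. p \<in> P \<Longrightarrow> norm p \<le> C" by (rule compact_norm_bound[OF cP]) (rule that)
  obtain z u N where z: "rot_velocity z u" "z 0 = 0" "z 1 = 0" "negligible N"
    "\<And>t. t \<in> {0..1} \<Longrightarrow> support_fun K (u t) \<le> 1" "area z u > 0"
    "\<And>t. t \<in> {0..1} - N \<Longrightarrow> (z has_vector_derivative cstruct (u t)) (at t within {0..1})"
    "\<And>x v. rot_velocity x v \<Longrightarrow> x 0 = x 1 \<Longrightarrow> \<forall>t\<in>{0..1}. support_fun K (v t) \<le> 1 \<Longrightarrow> area x v \<le> area z u"
    by (rule area_maximizer[OF K(1,3,4)]) (rule that)
  have uP: "u t \<in> P" if "t \<in> {0..1}" for t using z(5)[OF that] by (simp add: pol P_def)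
  obtain c where c': "\<And>w :: real \<Rightarrow> 'n phase. w absolutely_integrable_on {0..1} \<Longrightarrow> \<forall>t\<in>{0..1}. w t \<in> polar_body K \<Longrightarrow>
    integral {0..1} (\<lambda>t. (z t + c) \<bullet> w t) \<le> integral {0..1} (\<lambda>t. (z t + c) \<bullet> u t)"
    by (rule maximizer_multiplier[OF z(1-3) K(1) uP[unfolded P_def] z(8)[unfolded pol[symmetric]]], assumption+) (rule that)
  note c = c'[folded P_def]
  have ptw: "(z t + c) \<bullet> p \<le> (z t + c) \<bullet> u t" if "t \<in> {0..<1} - N" "p \<in> P" for t p
    by (rule multiplier_pointwise[OF z(1) uP C(2) c]) (use that z(7) in auto)
  define g where "g t = support_fun P (z t + c)" for t
  have gu: "g t = (z t + c) \<bullet> u t" if t: "t \<in> {0..<1} - N" for t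
  proof (rule antisym)
    show "g t \<le> (z t + c) \<bullet> u t" unfolding g_def by (rule support_fun_le[OF Pne ptw[OF t]])
    show "(z t + c) \<bullet> u t \<le> g t" unfolding g_def by (rule support_fun_ge[OF bP uP]) (use t in auto)
  qed
  note zlip = rot_velocity_lipschitz[OF z(1) C(2)[OF uP] less_imp_le[OF C(1)]]
  have glip: "(C * C)-lipschitz_on {0..1} g"
  proof (rule lipschitz_onI)
    fix s t :: real assume st: "s \<in> {0..1}" "t \<in> {0..1}"
    have "dist (g s) (g t) \<le> C * norm (z s - z t)"
      using support_fun_lipschitz[OF cP Pne C(2), of "z s + c" "z t + c"] by (simp add: g_def dist_real_def)
    also have "\<dots> \<le> C * (C * dist s t)"
      using lipschitz_onD[OF zlip st] C(1) by (intro mult_left_mono) (auto simp: dist_norm)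
    finally show "dist (g s) (g t) \<le> C * C * dist s t" by simp
  qed (use C in simp)
  obtain N2 where N2: "negligible N2" "\<And>t. t \<in> {0..1} - N2 \<Longrightarrow> \<exists>d. (g has_vector_derivative d) (at t within {0..1})"
    by (rule lipschitz_on_ae_differentiable[OF glip]) (rule that)
  \<comment> \<open>The end points are removed because the argument uses a two-sided derivative at
    \<open>t\<close> and the needle variation needs room to the right.\<close>
  define N3 where "N3 = N \<union> N2 \<union> {0,1}"
  have N3: "negligible N3" using z(4) N2(1) by (simp add: N3_def)
  have g0: "(g has_vector_derivative 0) (at t within {0..1})" if t: "t \<in> {0..1} - N3" for t
  proof -
    have t': "t \<in> {0..1} - N" "t \<in> {0..1} - N2" "0 < t" "t < 1" using t by (auto simp: N3_def)
    obtain d where d: "(g has_vector_derivative d) (at t within {0..1})" using N2(2)[OF t'(2)] by blast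
    have att: "at t within {0..1} = at t" by (rule at_within_Icc_at) (use t' in auto)
    have gd: "(g has_real_derivative d) (at t)"
      using d unfolding att by (simp add: has_real_derivative_iff_has_vector_derivative)
    have zd: "((\<lambda>s. u t \<bullet> z s) has_real_derivative 0) (at t)"
      using has_derivative_inner_right[OF z(7)[OF t'(1), unfolded has_vector_derivative_def], of "u t"] att
      by (simp add: has_field_derivative_def lambda_zero)
    \<comment> \<open>This function is smallest at \<open>s = t\<close>, since \<open>u t\<close> is
      admissible in the supremum \<open>g s\<close> and attains it at \<open>s = t\<close>. Its
      derivative there equals that of \<open>g\<close>, because the velocity \<open>J (u t)\<close>
      of \<open>z\<close> is orthogonal to \<open>u t\<close>.\<close>
    have \<phi>: "((\<lambda>s. g s - u t \<bullet> z s) has_real_derivative d) (at t)"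
      using DERIV_diff[OF gd zd] by simp
    have "d = 0"
    proof (rule DERIV_local_min[OF \<phi>, of "min t (1 - t)"])
      show "\<forall>s. \<bar>t - s\<bar> < min t (1 - t) \<longrightarrow> g t - u t \<bullet> z t \<le> g s - u t \<bullet> z s"
      proof (intro allI impI)
        fix s assume "\<bar>t - s\<bar> < min t (1 - t)"
        have "(z s + c) \<bullet> u t \<le> g s" unfolding g_def by (rule support_fun_ge[OF bP uP]) (use t' in auto)
        moreover have "g t = (z t + c) \<bullet> u t" by (rule gu) (use t' in auto)
        ultimately show "g t - u t \<bullet> z t \<le> g s - u t \<bullet> z s" by (simp add: inner_add_left inner_commute[of "u t"])
      qed
    qed (use t' in auto)
    with d show ?thesis by simp
  qed
  define \<rho> where "\<rho> = g 0"
  have g\<rho>: "g t = \<rho>" if t: "t \<in> {0..1}" for t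
  proof -
    have "((\<lambda>_. 0) has_integral g t - g 0) {0..t}"
    proof (rule abs_continuous_on_FTC[OF _ _ N3])
      show "abs_continuous_on 0 t g"
        by (rule lipschitz_on_abs_continuous[of "C * C"]) (use t in \<open>auto intro: lipschitz_on_subset[OF glip]\<close>)
      show "(g has_vector_derivative 0) (at s within {0..t})" if "s \<in> {0..t} - N3" for s
        by (rule has_vector_derivative_within_subset[OF g0]) (use t that in auto)
    qed (use t in simp)
    from has_integral_unique[OF this has_integral_0] show ?thesis by (simp add: \<rho>_def)
  qed
  define M where "M = area z u"
  have M: "M > 0" using z(6) by (simp add: M_def)
  have zcu: "rot_velocity (\<lambda>t. z t + c) u" "area (\<lambda>t. z t + c) u = M"
    using area_add_const[OF z(1), of c] z(2,3) by (simp_all add: M_def)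
  have "integral {0..1} (\<lambda>t. (z t + c) \<bullet> u t) = integral {0..1} (\<lambda>t::real. \<rho>)"
  proof (rule integral_spike[OF N3])
    fix t assume "t \<in> {0..1} - N3"
    then have "t \<in> {0..<1} - N" "t \<in> {0..1}" by (auto simp: N3_def)
    then show "\<rho> = (z t + c) \<bullet> u t" using gu g\<rho> by metis
  qed
  \<comment> \<open>The integrand of twice the area is a.e. the constant \<open>\<rho>\<close>, so
    the area of the maximiser determines it.\<close>
  then have \<rho>M: "\<rho> = 2 * M" using zcu(2) by (simp add: area_def)
  have \<rho>: "\<rho> > 0" using M by (simp add: \<rho>M)
  define \<gamma> where "\<gamma> t = (1/\<rho>) *\<^sub>R (z t + c)" for t
  define v where "v t = (1/\<rho>) *\<^sub>R u t" for t
  have \<gamma>v: "rot_velocity \<gamma> v" unfolding \<gamma>_def[abs_def] v_def[abs_def] by (rule rot_velocity_scaleR[OF zcu(1)])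
  have der: "(\<gamma> has_vector_derivative cstruct (v t)) (at t within {0..1})" if t: "t \<in> {0..1} - N" for t
    unfolding \<gamma>_def v_def using z(7)[OF t] by (auto intro!: derivative_eq_intros)
  have s\<gamma>: "support_fun P (\<gamma> t) = 1" if t: "t \<in> {0..1}" for t
    using support_fun_scaleR[OF cP Pne, of "1/\<rho>" "z t + c"] g\<rho>[OF t] \<rho> by (simp add: g_def \<gamma>_def)
  have \<gamma>K: "\<gamma> t \<in> K" if t: "t \<in> {0..1}" for t
    by (rule bipolar[OF K(1,2) K0]) (use support_fun_ge[OF bP, of _ "\<gamma> t"] s\<gamma>[OF t] in \<open>auto simp: P_def\<close>)
  \<comment> \<open>An interior point could be dilated by \<open>1 + \<delta>\<close> within
    \<open>K\<close>, and its gauge would then be at most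
    \<open>1 / (1 + \<delta>) < 1\<close>.\<close>
  have \<gamma>i: "\<gamma> t \<notin> interior K" if t: "t \<in> {0..1}" for t
  proof
    assume "\<gamma> t \<in> interior K"
    then obtain e where e: "e > 0" "cball (\<gamma> t) e \<subseteq> K" by (auto simp: mem_interior_cball)
    define \<delta> where "\<delta> = e / (norm (\<gamma> t) + 1)"
    have \<delta>: "\<delta> > 0" using e by (simp add: \<delta>_def add_nonneg_pos)
    have "\<delta> * norm (\<gamma> t) \<le> \<delta> * (norm (\<gamma> t) + 1)" using \<delta> by simp
    also have "\<dots> = e" by (simp add: \<delta>_def add_nonneg_eq_0_iff)
    finally have "dist (\<gamma> t) ((1 + \<delta>) *\<^sub>R \<gamma> t) \<le> e" using \<delta> by (simp add: dist_norm scaleR_add_left)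
    then have "(1 + \<delta>) *\<^sub>R \<gamma> t \<in> K" by (intro subsetD[OF e(2)]) simp
    then have mem: "p \<bullet> ((1 + \<delta>) *\<^sub>R \<gamma> t) \<le> 1" if "p \<in> P" for p
      using that unfolding P_def polar_body_def by blast
    have "\<gamma> t \<bullet> p \<le> 1 / (1 + \<delta>)" if "p \<in> P" for p
    proof -
      have "(1 + \<delta>) * (\<gamma> t \<bullet> p) \<le> 1" using mem[OF that] by (simp only: inner_scaleR_right inner_commute[of p])
      then show ?thesis using \<delta> by (simp add: pos_le_divide_eq mult.commute)
    qed
    then have "support_fun P (\<gamma> t) \<le> 1 / (1 + \<delta>)" by (rule support_fun_le[OF Pne])
    also have "\<dots> < 1" using \<delta> by simp
    finally show False using s\<gamma>[OF t] by simp
  qed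
  have "gen_closed_characteristic K \<gamma>" unfolding gen_closed_characteristic_def
  proof (intro conjI)
    have vC: "norm (v t) \<le> C / \<rho>" if "t \<in> {0..1}" for t
      using C(2)[OF uP[OF that]] \<rho> by (simp add: v_def divide_right_mono)
    show "abs_continuous_on 0 1 \<gamma>"
      by (rule lipschitz_on_abs_continuous[OF rot_velocity_lipschitz[OF \<gamma>v vC]]) (use C \<rho> in auto)
    show "\<gamma> 0 = \<gamma> 1" using z by (simp add: \<gamma>_def)
    show "\<not> \<gamma> constant_on {0..1}"
    proof
      assume "\<gamma> constant_on {0..1}"
      then obtain q where q: "\<And>t. t \<in> {0..1} \<Longrightarrow> \<gamma> t = q" by (auto simp: constant_on_def)
      have "z t = 0" if t: "t \<in> {0..1}" for t
      proof -
        have "\<gamma> t = \<gamma> 0" using q[OF t] q[of 0] by simp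
        then show ?thesis using z(2) \<rho> by (simp add: \<gamma>_def)
      qed
      then have "integral {0..1} (\<lambda>t. z t \<bullet> u t) = integral {0..1} (\<lambda>t::real. 0)"
        by (intro Henstock_Kurzweil_Integration.integral_cong) simp
      then show False using z(6) by (simp add: area_def)
    qed
    show "\<gamma> ` {0..1} \<subseteq> frontier K"
      using \<gamma>K \<gamma>i closure_subset[of K] by (auto simp: frontier_def)
    show "AE t in lebesgue_on {0..1}. \<exists>v\<in>normal_cone K (\<gamma> t). (\<gamma> has_vector_derivative cstruct v) (at t within {0..1})"
      unfolding AE_lebesgue_on_iff_negligible
    proof (intro exI[of _ N3] conjI ballI)
      fix t assume t: "t \<in> {0..1} - N3"
      then have t': "t \<in> {0..1} - N" "t \<in> {0..<1} - N" "t \<in> {0..1}" by (auto simp: N3_def)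
      have "v t \<in> normal_cone K (\<gamma> t)" unfolding normal_cone_def
      proof (intro CollectI ballI)
        fix y assume y: "y \<in> K"
        have "v t \<bullet> y \<le> 1 / \<rho>" using uP[OF t'(3)] y \<rho> by (auto simp: P_def polar_body_def v_def divide_right_mono)
        moreover have "v t \<bullet> \<gamma> t = 1 / \<rho>"
          using gu[OF t'(2)] g\<rho>[OF t'(3)] \<rho> by (simp add: v_def \<gamma>_def inner_commute)
        ultimately show "v t \<bullet> (y - \<gamma> t) \<le> 0" by (simp add: inner_diff_right)
      qed
      then show "\<exists>v\<in>normal_cone K (\<gamma> t). (\<gamma> has_vector_derivative cstruct v) (at t within {0..1})"
        using der[OF t'(1)] by blast
    qed (rule N3)
  qed
  moreover have "action \<gamma> = 1 / (4 * M)"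
  proof -
    have "action \<gamma> = area \<gamma> v" by (rule action_eq_area[OF z(4) der])
    also have "\<dots> = (1/\<rho>)\<^sup>2 * M" unfolding \<gamma>_def[abs_def] v_def[abs_def] area_scaleR zcu(2) ..
    also have "\<dots> = 1 / (4 * M)" using M by (simp add: \<rho>M power2_eq_square)
    finally show ?thesis .
  qed
  ultimately show thesis using M z(8) by (intro that[of M \<gamma>]) (auto simp: M_def)
qed

subsection \<open>The capacity as an isoperimetric constant\<close>

text \<open>The ball around \<open>c0\<close> yields
  \<open>r * norm (v t) \<le> v t \<bullet> (\<gamma> t - c0)\<close> for normals
  \<open>v t\<close>. It is used twice: for absolute integrability of the velocity, and for
  positivity of the area, as area at most 0 would force the curve to be constant. The length
  identity expresses that a normal at \<open>\<gamma> t\<close> attains its support value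
  there.\<close>

lemma gen_closed_characteristic_curve:
  fixes K :: "'n::finite phase set"
  assumes K: "compact K" "cball c0 r \<subseteq> K" "r > 0" and \<gamma>: "gen_closed_characteristic K \<gamma>"
  obtains v N where "rot_velocity \<gamma> v" "\<gamma> 0 = \<gamma> 1" "negligible N"
    "\<And>t. t \<in> {0..1} - N \<Longrightarrow> (\<gamma> has_vector_derivative cstruct (v t)) (at t within {0..1})"
    "action \<gamma> = area \<gamma> v" "area \<gamma> v > 0"
    "integral {0..1} (\<lambda>t. support_fun K (v t)) = 2 * area \<gamma> v"
proof -
  note bK = compact_imp_bounded[OF K(1)]
  have c0: "c0 \<in> K" using K by auto
  then have Kne: "K \<noteq> {}" by auto
  have ac: "abs_continuous_on 0 1 \<gamma>" and cl: "\<gamma> 0 = \<gamma> 1" and nc: "\<not> \<gamma> constant_on {0..1}" and fr: "\<gamma> ` {0..1} \<subseteq> frontier K"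
    using \<gamma> by (auto simp: gen_closed_characteristic_def)
  have \<gamma>K: "\<gamma> t \<in> K" if "t \<in> {0..1}" for t
    using fr that frontier_subset_closed[OF compact_imp_closed[OF K(1)]] by blast
  obtain N where N: "negligible N"
    "\<forall>t\<in>{0..1} - N. \<exists>v\<in>normal_cone K (\<gamma> t). (\<gamma> has_vector_derivative cstruct v) (at t within {0..1})"
    using \<gamma> unfolding gen_closed_characteristic_def AE_lebesgue_on_iff_negligible by blast
  have "\<forall>t\<in>{0..1} - N. \<exists>v. v \<in> normal_cone K (\<gamma> t) \<and> (\<gamma> has_vector_derivative cstruct v) (at t within {0..1})"
    using N(2) by blast
  then obtain v0 where v0: "\<forall>t\<in>{0..1} - N. v0 t \<in> normal_cone K (\<gamma> t) \<and> (\<gamma> has_vector_derivative cstruct (v0 t)) (at t within {0..1})"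
    by (rule bchoice[THEN exE]) (rule that)
  define v where "v t = (if t \<in> {0..1} - N then v0 t else 0)" for t
  have nc_v: "v t \<in> normal_cone K (\<gamma> t)" for t
    using v0 by (auto simp: v_def normal_cone_def)
  have der: "(\<gamma> has_vector_derivative cstruct (v t)) (at t within {0..1})" if "t \<in> {0..1} - N" for t
    using v0 that by (simp add: v_def)
  have J\<gamma>: "((\<lambda>t. cstruct (v t)) has_integral \<gamma> t - \<gamma> 0) {0..t}" if t: "t \<in> {0..1}" for t
  proof (rule abs_continuous_on_FTC[OF _ _ N(1)])
    show "abs_continuous_on 0 t \<gamma>" unfolding abs_continuous_on_def
    proof (intro allI impI)
      fix \<epsilon> :: real assume "\<epsilon> > 0"
      then obtain \<delta> where \<delta>: "\<delta> > 0" "\<forall>I. finite I \<longrightarrow> (\<forall>(u, v)\<in>I. 0 \<le> u \<and> u \<le> v \<and> v \<le> 1) \<longrightarrow>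
        disjoint_family_on (\<lambda>(u, v). {u<..<v}) I \<longrightarrow> (\<Sum>(u, v)\<in>I. v - u) < \<delta> \<longrightarrow> (\<Sum>(u, v)\<in>I. dist (\<gamma> u) (\<gamma> v)) < \<epsilon>"
        using ac[unfolded abs_continuous_on_def, THEN spec, THEN mp] by blast
      show "\<exists>\<delta>>0. \<forall>I. finite I \<longrightarrow> (\<forall>(u, v)\<in>I. 0 \<le> u \<and> u \<le> v \<and> v \<le> t) \<longrightarrow>
        disjoint_family_on (\<lambda>(u, v). {u<..<v}) I \<longrightarrow> (\<Sum>(u, v)\<in>I. v - u) < \<delta> \<longrightarrow> (\<Sum>(u, v)\<in>I. dist (\<gamma> u) (\<gamma> v)) < \<epsilon>"
      proof (intro exI[of _ \<delta>] conjI allI impI \<delta>(1))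
        fix I :: "(real \<times> real) set"
        assume I: "finite I" "\<forall>(u, v)\<in>I. 0 \<le> u \<and> u \<le> v \<and> v \<le> t" "disjoint_family_on (\<lambda>(u, v). {u<..<v}) I" "(\<Sum>(u, v)\<in>I. v - u) < \<delta>"
        have "\<forall>(u, v)\<in>I. 0 \<le> u \<and> u \<le> v \<and> v \<le> 1" using I(2) t by fastforce
        then show "(\<Sum>(u, v)\<in>I. dist (\<gamma> u) (\<gamma> v)) < \<epsilon>" using \<delta>(2) I by blast
      qed
    qed
    show "(\<gamma> has_vector_derivative cstruct (v s)) (at s within {0..t})" if "s \<in> {0..t} - N" for s
      by (rule has_vector_derivative_within_subset[OF der]) (use t that in auto)
  qed (use t in simp)
  have vi: "(v has_integral - cstruct (\<gamma> t - \<gamma> 0)) {0..t}" if t: "t \<in> {0..1}" for t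
    using has_integral_neg[OF has_integral_linear[OF J\<gamma>[OF t] bounded_linear_cstruct]]
    by (simp add: o_def)
  have rv: "r * norm (v t) \<le> v t \<bullet> (\<gamma> t - c0)" for t
  proof (cases "v t = 0")
    case False
    have "c0 + (r / norm (v t)) *\<^sub>R v t \<in> K"
      by (rule subsetD[OF K(2)]) (use K(3) False in \<open>simp add: dist_norm\<close>)
    then have "v t \<bullet> (c0 + (r / norm (v t)) *\<^sub>R v t - \<gamma> t) \<le> 0" using nc_v[of t] by (auto simp: normal_cone_def)
    moreover have "v t \<bullet> ((r / norm (v t)) *\<^sub>R v t) = r * norm (v t)"
      using False by (simp add: dot_square_norm power2_eq_square)
    ultimately show ?thesis by (simp add: inner_add_right inner_diff_right)
  qed simp
  have c\<gamma>: "continuous_on {0..1} \<gamma>"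
  proof -
    have "continuous_on {0..1} (\<lambda>t. \<gamma> 0 + integral {0..t} (\<lambda>t. cstruct (v t)))"
      using J\<gamma>[of 1] by (intro continuous_intros indefinite_integral_continuous_1) auto
    then show ?thesis
    proof (rule continuous_on_eq)
      show "\<gamma> 0 + integral {0..t} (\<lambda>t. cstruct (v t)) = \<gamma> t" if "t \<in> {0..1}" for t
        using integral_unique[OF J\<gamma>[OF that]] by simp
    qed
  qed
  have vint: "v integrable_on {0..1}" using vi[of 1] by auto
  \<comment> \<open>So far \<open>v\<close> is only Henstock-Kurzweil integrable. On a piece
    \<open>[a, b]\<close> where \<open>\<gamma>\<close> varies by at most \<open>r / 2\<close>,
    replacing \<open>\<gamma> t\<close> by \<open>\<gamma> a\<close> in \<open>rv\<close> costs half
    of the left-hand side and bounds \<open>norm (v t)\<close> by a linear function of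
    \<open>v t\<close>, which is integrable. Finitely many pieces suffice.\<close>
  have "(\<lambda>t. norm (v t)) integrable_on {0..1}"
  proof -
    have "r / 2 > 0" using K(3) by simp
    then obtain n :: nat where n: "n > 0"
      "\<And>s t. s \<in> {0..1} \<Longrightarrow> t \<in> {0..1} \<Longrightarrow> \<bar>s - t\<bar> \<le> 1 / real n \<Longrightarrow> norm (\<gamma> s - \<gamma> t) \<le> r / 2"
      using uniform_partition[OF c\<gamma>] by blast
    have "(\<lambda>t. norm (v t)) integrable_on {0..real i / real n}" if "i \<le> n" for i
      using that
    proof (induction i)
      case (Suc i)
      define a where "a = real i / real n"
      define b where "b = real (Suc i) / real n"
      have "b - a = 1 / real n" by (simp add: a_def b_def diff_divide_distrib[symmetric])
      then have ab: "0 \<le> a" "a \<le> b" "b \<le> 1" "b - a = 1 / real n"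
        using Suc n(1) by (auto simp: a_def b_def divide_right_mono)
      have vab: "v integrable_on {a..b}" by (rule integrable_on_subinterval[OF vint]) (use ab in auto)
      have "v absolutely_integrable_on {a..b}"
      proof (rule absolutely_integrable_integrable_bound[OF _ vab])
        show "(\<lambda>t. 2 / r * ((\<gamma> a - c0) \<bullet> v t)) integrable_on {a..b}"
          using integrable_linear[OF vab bounded_linear_inner_right[of "\<gamma> a - c0"]]
          by (intro integrable_on_mult_right) (simp add: o_def)
        fix t assume t: "t \<in> {a..b}"
        have "norm (\<gamma> t - \<gamma> a) \<le> r / 2" using t ab by (intro n(2)) auto
        then have "norm (v t) * norm (\<gamma> t - \<gamma> a) \<le> norm (v t) * (r / 2)" by (rule mult_left_mono) simp
        then have "v t \<bullet> (\<gamma> t - \<gamma> a) \<le> norm (v t) * (r / 2)" using norm_cauchy_schwarz order_trans by blast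
        moreover have "v t \<bullet> (\<gamma> t - c0) = v t \<bullet> (\<gamma> t - \<gamma> a) + (\<gamma> a - c0) \<bullet> v t"
          by (simp add: inner_diff_right inner_diff_left inner_commute)
        ultimately have "norm (v t) * (r / 2) \<le> (\<gamma> a - c0) \<bullet> v t" using rv[of t] by (simp add: algebra_simps)
        then show "norm (v t) \<le> 2 / r * ((\<gamma> a - c0) \<bullet> v t)" using K(3) by (simp add: field_simps)
      qed
      then have "(\<lambda>t. norm (v t)) integrable_on {a..b}" by (simp add: absolutely_integrable_on_def)
      moreover have "(\<lambda>t. norm (v t)) integrable_on {0..a}" using Suc by (simp add: a_def)
      ultimately have "(\<lambda>t. norm (v t)) integrable_on {0..b}"
        using Henstock_Kurzweil_Integration.integrable_combine[OF ab(1,2)] by blast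
      then show ?case by (simp add: b_def)
    qed (use integrable_on_refl[of "\<lambda>t. norm (v t)" 0] in simp)
    from this[of n] show ?thesis using n(1) by simp
  qed
  with vint have va: "v absolutely_integrable_on {0..1}" by (simp add: absolutely_integrable_on_def)
  have \<gamma>v: "rot_velocity \<gamma> v" unfolding rot_velocity_def
  proof (intro conjI ballI va)
    fix t :: real assume t: "t \<in> {0..1}"
    have "integral {0..t} v = - cstruct (\<gamma> t - \<gamma> 0)" using vi[OF t] by (rule integral_unique)
    then have "cstruct (integral {0..t} v) = cstruct (- cstruct (\<gamma> t - \<gamma> 0))" by (rule arg_cong)
    also have "\<dots> = \<gamma> t - \<gamma> 0" unfolding linear_neg[OF linear_cstruct] cstruct_cstruct by simp
    finally show "\<gamma> t = \<gamma> 0 + cstruct (integral {0..t} v)" by simp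
  qed
  have sup: "support_fun K (v t) = \<gamma> t \<bullet> v t" if t: "t \<in> {0..1}" for t
  proof (rule antisym)
    show "support_fun K (v t) \<le> \<gamma> t \<bullet> v t"
      using nc_v[of t] by (intro support_fun_le[OF Kne]) (auto simp: normal_cone_def inner_diff_right inner_commute)
    show "\<gamma> t \<bullet> v t \<le> support_fun K (v t)"
      using support_fun_ge[OF bK \<gamma>K[OF t], of "v t"] by (simp add: inner_commute)
  qed
  have L: "integral {0..1} (\<lambda>t. support_fun K (v t)) = 2 * area \<gamma> v"
    using Henstock_Kurzweil_Integration.integral_cong[of "{0..1}" "\<lambda>t. support_fun K (v t)" "\<lambda>t. \<gamma> t \<bullet> v t"] sup
    by (simp add: area_def)
  have pos: "area \<gamma> v > 0"
  proof (rule ccontr)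
    assume "\<not> area \<gamma> v > 0"
    then have a0: "area (\<lambda>t. \<gamma> t + - c0) v \<le> 0" using area_add_const(2)[OF \<gamma>v cl] by (metis not_less)
    have "integral {0..1} (\<lambda>t. r * norm (v t)) \<le> integral {0..1} (\<lambda>t. (\<gamma> t + - c0) \<bullet> v t)"
    proof (rule integral_le)
      show "(\<lambda>t. r * norm (v t)) integrable_on {0..1}"
        using rot_velocity_integrable(3)[OF \<gamma>v, of 0 1] by (intro integrable_on_mult_right) auto
      show "(\<lambda>t. (\<gamma> t + - c0) \<bullet> v t) integrable_on {0..1}"
        using absolutely_integrable_inner[OF rot_velocity_continuous[OF area_add_const(1)[OF \<gamma>v cl, of "- c0"]] va]
        by (auto simp: absolutely_integrable_on_def)
      show "r * norm (v t) \<le> (\<gamma> t + - c0) \<bullet> v t" for t using rv[of t] by (simp add: inner_commute)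
    qed
    then have "r * integral {0..1} (\<lambda>t. norm (v t)) \<le> 0" using a0 by (simp add: area_def)
    then have n0: "integral {0..1} (\<lambda>t. norm (v t)) \<le> 0" using K(3) by (simp add: mult_le_0_iff)
    have "\<gamma> t = \<gamma> 0" if t: "t \<in> {0..1}" for t
    proof -
      have "norm (\<gamma> t - \<gamma> 0) = norm (integral {0..t} v)" using rot_velocity_diff[OF \<gamma>v, of 0 t] t by simp
      also have "\<dots> \<le> integral {0..t} (\<lambda>t. norm (v t))"
        by (rule Henstock_Kurzweil_Integration.integral_norm_bound_integral)
          (use rot_velocity_integrable[OF \<gamma>v, of 0 t] t in auto)
      also have "\<dots> \<le> integral {0..1} (\<lambda>t. norm (v t))"
        by (rule integral_subset_le) (use rot_velocity_integrable(3)[OF \<gamma>v] t in auto)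
      finally have "norm (\<gamma> t - \<gamma> 0) \<le> 0" using n0 by linarith
      then show ?thesis by simp
    qed
    then show False using nc unfolding constant_on_def by blast
  qed
  show thesis by (rule that[OF \<gamma>v cl N(1) der action_eq_area[OF N(1) der] pos L])
qed

text \<open>Near-constant-speed parametrisation and scaling turn the area bound \<open>M\<close> for
  support speed at most 1 into \<open>area \<le> M * length\<^sup>2\<close>. A closed characteristic
  of action \<open>A\<close> has support length \<open>2 * A\<close>, hence
  \<open>A \<le> 4 * M * A\<^sup>2\<close> and \<open>A \<ge> 1 / (4 * M)\<close>; the curve built
  from the maximiser attains this value.\<close>

lemma capacity_centered:
  fixes K :: "'n::finite phase set"
  assumes K: "compact K" "convex K" "cball 0 r \<subseteq> K" "r > 0"
  shows "c_EHZ K > 0" "\<exists>\<gamma>. gen_closed_characteristic K \<gamma> \<and> action \<gamma> = c_EHZ K"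
    "\<And>x v. rot_velocity x v \<Longrightarrow> x 0 = x 1 \<Longrightarrow> 4 * c_EHZ K * area x v \<le> (integral {0..1} (\<lambda>t. support_fun K (v t)))\<^sup>2"
proof -
  note bK = compact_imp_bounded[OF K(1)]
  have K0: "0 \<in> K" using K by auto
  then have Kne: "K \<noteq> {}" by auto
  obtain \<gamma>0 M where M: "M > 0" "gen_closed_characteristic K \<gamma>0" "action \<gamma>0 = 1 / (4 * M)"
    "\<And>x v. rot_velocity x v \<Longrightarrow> x 0 = x 1 \<Longrightarrow> \<forall>t\<in>{0..1}. support_fun K (v t) \<le> 1 \<Longrightarrow> area x v \<le> M"
    by (rule exists_closed_characteristic[OF K]) (rule that)
  have iso: "area x v \<le> M * (integral {0..1} (\<lambda>t. support_fun K (v t)))\<^sup>2"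
    if x: "rot_velocity x v" "x 0 = x 1" for x v
  proof -
    define L where "L = integral {0..1} (\<lambda>t. support_fun K (v t))"
    have L: "L \<ge> 0" unfolding L_def
      using absolutely_integrable_support_fun[OF K(1) Kne rot_velocity_integrable(1)[OF x(1), of 0 1]]
      by (intro Henstock_Kurzweil_Integration.integral_nonneg) (auto simp: absolutely_integrable_on_def support_fun_nonneg[OF bK K0])
    have *: "area x v \<le> M * (L + \<epsilon>)\<^sup>2" if \<epsilon>: "\<epsilon> > 0" for \<epsilon>
    proof -
      obtain y u C where y: "rot_velocity y u" "y 0 = y 1" "C-lipschitz_on {0..1} y" "area y u = area x v"
        "\<And>t. t \<in> {0..1} \<Longrightarrow> support_fun K (u t) \<le> integral {0..1} (\<lambda>t. support_fun K (v t)) + \<epsilon>"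
        by (rule reparametrize[OF x K(1) K0 \<epsilon>]) (rule that)
      define \<Lambda> where "\<Lambda> = L + \<epsilon>"
      have \<Lambda>: "\<Lambda> > 0" using L \<epsilon> by (simp add: \<Lambda>_def)
      have "area (\<lambda>t. (1/\<Lambda>) *\<^sub>R y t) (\<lambda>t. (1/\<Lambda>) *\<^sub>R u t) \<le> M"
      proof (rule M(4)[OF rot_velocity_scaleR[OF y(1)]])
        show "\<forall>t\<in>{0..1}. support_fun K ((1/\<Lambda>) *\<^sub>R u t) \<le> 1"
          using support_fun_scaleR[OF K(1) Kne, of "1/\<Lambda>"] y(5)[folded L_def] \<Lambda> by (auto simp: \<Lambda>_def divide_le_eq)
      qed (use y in simp)
      then have "(1/\<Lambda>)\<^sup>2 * area x v \<le> M" by (simp only: area_scaleR y(4))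
      then show ?thesis using \<Lambda> by (simp add: \<Lambda>_def[symmetric] power_divide divide_le_eq)
    qed
    have "((\<lambda>\<epsilon>. M * (L + \<epsilon>)\<^sup>2) \<longlongrightarrow> M * (L + 0)\<^sup>2) (at_right 0)" by (intro tendsto_intros)
    moreover have "\<forall>\<^sub>F \<epsilon> in at_right 0. area x v \<le> M * (L + \<epsilon>)\<^sup>2"
      by (rule eventually_mono[OF eventually_at_right_real[of 0 1]]) (auto intro: *)
    ultimately have "area x v \<le> M * (L + 0)\<^sup>2" by (rule tendsto_lowerbound) simp
    then show ?thesis by (simp add: L_def)
  qed
  have "1 / (4 * M) \<le> action \<gamma>" if \<gamma>: "gen_closed_characteristic K \<gamma>" for \<gamma>
  proof -
    obtain v N where v: "rot_velocity \<gamma> v" "\<gamma> 0 = \<gamma> 1" "negligible N"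
      "\<And>t. t \<in> {0..1} - N \<Longrightarrow> (\<gamma> has_vector_derivative cstruct (v t)) (at t within {0..1})"
      "action \<gamma> = area \<gamma> v" "area \<gamma> v > 0"
      "integral {0..1} (\<lambda>t. support_fun K (v t)) = 2 * area \<gamma> v"
      by (rule gen_closed_characteristic_curve[OF K(1,3,4) \<gamma>]) (rule that)
    have "area \<gamma> v \<le> M * (2 * area \<gamma> v)\<^sup>2" using iso[OF v(1,2)] v(7) by simp
    then have "area \<gamma> v * 1 \<le> area \<gamma> v * (4 * M * area \<gamma> v)" by (simp add: power2_eq_square algebra_simps)
    then have "1 \<le> 4 * M * area \<gamma> v" using v(6) by (simp only: mult_le_cancel_left_pos)
    then show ?thesis using M(1) v(5) by (simp add: divide_le_eq mult.commute)
  qed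
  then have c: "c_EHZ K = 1 / (4 * M)"
    unfolding c_EHZ_def using M(2,3) by (intro cInf_eq_minimum) (auto intro!: image_eqI[of _ _ \<gamma>0])
  show "c_EHZ K > 0" using c M(1) by simp
  show "\<exists>\<gamma>. gen_closed_characteristic K \<gamma> \<and> action \<gamma> = c_EHZ K" using c M by auto
  show "4 * c_EHZ K * area x v \<le> (integral {0..1} (\<lambda>t. support_fun K (v t)))\<^sup>2" if "rot_velocity x v" "x 0 = x 1" for x v
    using iso[OF that] c M(1) by (simp add: divide_le_eq mult.commute)
qed

section \<open>Translation invariance of the capacity\<close>

lemma normal_cone_translation: "normal_cone ((+) a ` K) (a + x) = normal_cone K x"
  by (auto simp: normal_cone_def)

lemma gen_closed_characteristic_translation:
  assumes "gen_closed_characteristic K \<gamma>"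
  shows "gen_closed_characteristic ((+) a ` K) (\<lambda>t. a + \<gamma> t)"
  unfolding gen_closed_characteristic_def
proof (intro conjI)
  note \<gamma> = assms[unfolded gen_closed_characteristic_def]
  show "abs_continuous_on 0 1 (\<lambda>t. a + \<gamma> t)" using \<gamma> by (simp add: abs_continuous_on_def)
  show "a + \<gamma> 0 = a + \<gamma> 1" using \<gamma> by simp
  show "\<not> (\<lambda>t. a + \<gamma> t) constant_on {0..1}" using \<gamma> unfolding constant_on_def by (metis add_left_cancel)
  show "(\<lambda>t. a + \<gamma> t) ` {0..1} \<subseteq> frontier ((+) a ` K)" using \<gamma> by (auto simp: frontier_translation)
  have "AE t in lebesgue_on {0..1}. \<exists>v\<in>normal_cone K (\<gamma> t). (\<gamma> has_vector_derivative cstruct v) (at t within {0..1})"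
    using \<gamma> by blast
  then show "AE t in lebesgue_on {0..1}. \<exists>v\<in>normal_cone ((+) a ` K) (a + \<gamma> t).
      ((\<lambda>t. a + \<gamma> t) has_vector_derivative cstruct v) (at t within {0..1})"
    unfolding normal_cone_translation
    by (rule eventually_mono) (auto simp: has_vector_derivative_add_const add.commute[of a] intro!: bexI)
qed

lemma convex_body_cball:
  assumes "convex_body K" obtains c0 r where "cball c0 r \<subseteq> K" "r > 0"
  using assms unfolding convex_body_def by (meson ex_in_conv mem_interior_cball)

lemma support_fun_translation:
  assumes "compact K" "K \<noteq> {}"
  shows "support_fun ((+) a ` K) u = a \<bullet> u + support_fun K u"
proof (rule antisym)
  note bK = compact_imp_bounded[OF assms(1)]
  show "support_fun ((+) a ` K) u \<le> a \<bullet> u + support_fun K u"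
    using assms support_fun_ge[OF bK, of _ u] by (intro support_fun_le) (auto simp: inner_add_right inner_commute[of u a])
  obtain w where "w \<in> K" "support_fun K u = u \<bullet> w" using support_fun_attained[OF assms] by blast
  then show "a \<bullet> u + support_fun K u \<le> support_fun ((+) a ` K) u"
    using support_fun_ge[of "(+) a ` K" "a + w" u] bK by (simp add: bounded_translation inner_add_right inner_commute[of u a])
qed

text \<open>Translates an interior point of \<open>K\<close> to the origin. Actions of closed curves
  are unchanged, and the support length changes by the inner product of the shift with the integral
  of \<open>v\<close>, which is 0. Thus the origin may lie anywhere, in particular on the frontier
  of \<open>K\<close>.\<close>

theorem capacity_characterization:
  fixes K :: "'n::finite phase set"
  assumes "convex_body K"
  shows "c_EHZ K > 0"
    "\<exists>x v. rot_velocity x v \<and> x 0 = x 1 \<and> area x v = c_EHZ K \<and> integral {0..1} (\<lambda>t. support_fun K (v t)) = 2 * c_EHZ K"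
    "\<And>x v. rot_velocity x v \<Longrightarrow> x 0 = x 1 \<Longrightarrow> 4 * c_EHZ K * area x v \<le> (integral {0..1} (\<lambda>t. support_fun K (v t)))\<^sup>2"
proof -
  obtain c0 r where c0: "cball c0 r \<subseteq> K" "r > 0" by (rule convex_body_cball[OF assms]) (rule that)
  have K: "compact K" "convex K" using assms by (auto simp: convex_body_def)
  have Kne: "K \<noteq> {}" using c0 by auto
  define K' where "K' = (+) (- c0) ` K"
  have KK': "K = (+) c0 ` K'" by (simp add: K'_def image_image)
  have K': "compact K'" "convex K'" unfolding K'_def by (intro compact_translation convex_translation K)+
  have "cball 0 r = (+) (- c0) ` cball c0 r" using cball_translation[of "- c0" c0 r] by simp
  then have c0': "cball 0 r \<subseteq> K'" using c0(1) unfolding K'_def by (metis image_mono)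
  note cap = capacity_centered[OF K' c0' c0(2)]
  have act: "gen_closed_characteristic ((+) a ` L) (\<lambda>t. a + \<gamma> t) \<and> action (\<lambda>t. a + \<gamma> t) = action \<gamma>"
    if \<gamma>: "gen_closed_characteristic L \<gamma>" and L: "compact L" "cball p r \<subseteq> L" for L \<gamma> a p
  proof -
    obtain v N where v: "rot_velocity \<gamma> v" "\<gamma> 0 = \<gamma> 1" "negligible N"
      "\<And>t. t \<in> {0..1} - N \<Longrightarrow> (\<gamma> has_vector_derivative cstruct (v t)) (at t within {0..1})"
      "action \<gamma> = area \<gamma> v" "area \<gamma> v > 0"
      "integral {0..1} (\<lambda>t. support_fun L (v t)) = 2 * area \<gamma> v"
      by (rule gen_closed_characteristic_curve[OF L c0(2) \<gamma>]) (rule that)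
    have "action (\<lambda>t. a + \<gamma> t) = area (\<lambda>t. a + \<gamma> t) v"
      using v(4) by (intro action_eq_area[OF v(3)]) (simp add: has_vector_derivative_add_const add.commute[of a])
    also have "\<dots> = action \<gamma>" using area_add_const(2)[OF v(1,2), of a] v(5) by (simp add: add.commute[of a])
    finally show ?thesis using gen_closed_characteristic_translation[OF \<gamma>] by simp
  qed
  have "action ` {\<gamma>. gen_closed_characteristic K \<gamma>} = action ` {\<gamma>. gen_closed_characteristic K' \<gamma>}"
  proof (intro equalityI subsetI)
    fix q assume "q \<in> action ` {\<gamma>. gen_closed_characteristic K \<gamma>}"
    then obtain \<gamma> where "gen_closed_characteristic K \<gamma>" "q = action \<gamma>" by auto
    with act[OF this(1) K(1) c0(1), of "- c0"] show "q \<in> action ` {\<gamma>. gen_closed_characteristic K' \<gamma>}"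
      unfolding K'_def by (intro image_eqI[of _ _ "\<lambda>t. - c0 + \<gamma> t"]) auto
  next
    fix q assume "q \<in> action ` {\<gamma>. gen_closed_characteristic K' \<gamma>}"
    then obtain \<gamma> where "gen_closed_characteristic K' \<gamma>" "q = action \<gamma>" by auto
    with act[OF this(1) K'(1) c0', of c0] show "q \<in> action ` {\<gamma>. gen_closed_characteristic K \<gamma>}"
      unfolding KK' by (intro image_eqI[of _ _ "\<lambda>t. c0 + \<gamma> t"]) auto
  qed
  then have c: "c_EHZ K = c_EHZ K'" by (simp add: c_EHZ_def)
  have L: "integral {0..1} (\<lambda>t. support_fun K' (v t)) = integral {0..1} (\<lambda>t. support_fun K (v t))"
    if x: "rot_velocity x v" "x 0 = x 1" for x v
  proof -
    note va = rot_velocity_integrable(1)[OF x(1), of 0 1, simplified]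
    have "((\<lambda>t. (- c0) \<bullet> v t + support_fun K (v t)) has_integral (- c0) \<bullet> integral {0..1} v + integral {0..1} (\<lambda>t. support_fun K (v t))) {0..1}"
      using absolutely_integrable_support_fun[OF K(1) Kne va]
      by (intro has_integral_add has_integral_inner_const va integrable_integral) (auto simp: absolutely_integrable_on_def)
    moreover have "support_fun K' u = (- c0) \<bullet> u + support_fun K u" for u
      unfolding K'_def by (rule support_fun_translation[OF K(1) Kne])
    ultimately show ?thesis using rot_velocity_closed[OF x] by (simp add: integral_unique)
  qed
  show "c_EHZ K > 0" using cap(1) c by simp
  show "4 * c_EHZ K * area x v \<le> (integral {0..1} (\<lambda>t. support_fun K (v t)))\<^sup>2" if "rot_velocity x v" "x 0 = x 1" for x v
    using cap(3)[OF that] c L[OF that] by simp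
  obtain \<gamma> where \<gamma>: "gen_closed_characteristic K' \<gamma>" "action \<gamma> = c_EHZ K'" using cap(2) by blast
  obtain v N where v: "rot_velocity \<gamma> v" "\<gamma> 0 = \<gamma> 1" "negligible N"
      "\<And>t. t \<in> {0..1} - N \<Longrightarrow> (\<gamma> has_vector_derivative cstruct (v t)) (at t within {0..1})"
      "action \<gamma> = area \<gamma> v" "area \<gamma> v > 0"
      "integral {0..1} (\<lambda>t. support_fun K' (v t)) = 2 * area \<gamma> v"
    by (rule gen_closed_characteristic_curve[OF K'(1) c0' c0(2) \<gamma>(1)]) (rule that)
  then show "\<exists>x v. rot_velocity x v \<and> x 0 = x 1 \<and> area x v = c_EHZ K \<and> integral {0..1} (\<lambda>t. support_fun K (v t)) = 2 * c_EHZ K"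
    using L[OF v(1,2)] \<gamma>(2) c by - (rule exI[of _ \<gamma>], rule exI[of _ v], simp)
qed

subsection \<open>The planar unit ball of the p-norm\<close>

text \<open>Only nonnegative coordinates occur, since they serve as scale factors of
  \<open>K\<close> and \<open>T\<close>.\<close>

definition pball :: "ereal \<Rightarrow> (real \<times> real) set" where
  "pball p = {(a, b). 0 \<le> a \<and> 0 \<le> b \<and>
     (if p = \<infinity> then a \<le> 1 \<and> b \<le> 1 else a powr real_of_ereal p + b powr real_of_ereal p \<le> 1)}"

lemma ereal_ge_1_cases:
  assumes "1 \<le> (p :: ereal)"
  obtains "p = \<infinity>" | q where "p = ereal q" "1 \<le> q"
  using assms by (cases p) auto

lemma mem_pball_ereal: "(a, b) \<in> pball (ereal q) \<longleftrightarrow> 0 \<le> a \<and> 0 \<le> b \<and> a powr q + b powr q \<le> 1"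
  by (simp add: pball_def)

lemma mem_pball_infinity: "(a, b) \<in> pball \<infinity> \<longleftrightarrow> 0 \<le> a \<and> 0 \<le> b \<and> a \<le> 1 \<and> b \<le> 1"
  by (simp add: pball_def)

lemma pball_le_1:
  assumes "1 \<le> p" "(a, b) \<in> pball p" shows "0 \<le> a" "a \<le> 1" "0 \<le> b" "b \<le> 1"
proof -
  have "0 \<le> a \<and> a \<le> 1 \<and> 0 \<le> b \<and> b \<le> 1"
    using assms(1)
  proof (cases p rule: ereal_ge_1_cases)
    case (2 q)
    have *: "x \<le> 1" if "0 \<le> x" "x powr q \<le> 1" for x
    proof (rule ccontr)
      assume "\<not> x \<le> 1"
      then have "1 powr q < x powr q" using 2 by (intro powr_less_mono2) auto
      then show False using that by simp
    qed
    have "a powr q \<le> 1" "b powr q \<le> 1"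
      using assms(2) 2 powr_ge_zero[of a q] powr_ge_zero[of b q] by (auto simp: mem_pball_ereal simp del: powr_ge_zero)
    then show ?thesis using assms(2) 2 * by (auto simp: mem_pball_ereal)
  qed (use assms(2) in \<open>auto simp: mem_pball_infinity\<close>)
  then show "0 \<le> a" "a \<le> 1" "0 \<le> b" "b \<le> 1" by auto
qed

lemma pball_half:
  assumes "1 \<le> p" shows "(1/2, 1/2) \<in> pball p"
  using assms
proof (cases p rule: ereal_ge_1_cases)
  case (2 q)
  have "(1/2) powr q \<le> (1/2::real) powr 1" using 2 by (intro powr_mono') auto
  then show ?thesis using 2 by (simp add: mem_pball_ereal)
qed (simp add: mem_pball_infinity)

lemma pball_axes: "1 \<le> p \<Longrightarrow> (1, 0) \<in> pball p" "1 \<le> p \<Longrightarrow> (0, 1) \<in> pball p"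
  by (auto elim!: ereal_ge_1_cases simp: mem_pball_ereal mem_pball_infinity)

text \<open>If one argument is 0, the claim reduces to
  \<open>(c * z) powr q \<le> c * z powr q\<close> for \<open>c\<close> in \<open>[0, 1]\<close>,
  that is, to \<open>c powr q \<le> c\<close>.\<close>

lemma powr_convex_nonneg:
  fixes x y :: real
  assumes "1 \<le> q" "0 \<le> x" "0 \<le> y" "0 \<le> l" "0 \<le> m" "l + m = 1"
  shows "(l * x + m * y) powr q \<le> l * x powr q + m * y powr q"
proof -
  have *: "(c * z) powr q \<le> c * z powr q" if "0 \<le> c" "c \<le> 1" "0 \<le> z" for c z :: real
  proof -
    have "c powr q \<le> c powr 1" using assms(1) that by (intro powr_mono') auto
    then show ?thesis using that by (simp add: powr_mult mult_right_mono)
  qed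
  consider "x = 0" | "y = 0" | "x > 0" "y > 0" using assms by linarith
  then show ?thesis
  proof cases
    case 3
    then show ?thesis using powr_convex[OF assms(1)] assms(4-6) unfolding convex_on_def by simp
  qed (use *[of l x] *[of m y] assms in auto)
qed

lemma convex_pball:
  assumes "1 \<le> p" shows "convex (pball p)"
  using assms
proof (cases p rule: ereal_ge_1_cases)
  case 1
  have "pball p = {0..1} \<times> {0..1}" unfolding 1 by (auto simp: mem_pball_infinity)
  then show ?thesis by (simp add: convex_Times)
next
  case (2 q)
  show ?thesis unfolding 2(1)
  proof (rule convexI, clarsimp simp: mem_pball_ereal)
    fix a b a' b' l m :: real
    assume *: "0 \<le> l" "0 \<le> m" "l + m = 1" "0 \<le> a" "0 \<le> b" "a powr q + b powr q \<le> 1"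
      "0 \<le> a'" "0 \<le> b'" "a' powr q + b' powr q \<le> 1"
    have conv: "(l * x + m * y) powr q \<le> l * x powr q + m * y powr q" if "0 \<le> x" "0 \<le> y" for x y
      by (rule powr_convex_nonneg[OF 2(2) that *(1-3)])
    have "(l * a + m * a') powr q + (l * b + m * b') powr q
        \<le> l * (a powr q + b powr q) + m * (a' powr q + b' powr q)"
      using conv[of a a'] conv[of b b'] * by (simp add: algebra_simps)
    also have "\<dots> \<le> l * 1 + m * 1" using * by (intro add_mono mult_left_mono) auto
    finally show "(l * a + m * a') powr q + (l * b + m * b') powr q \<le> 1" using * by simp
  qed
qed

lemma compact_pball:
  assumes "1 \<le> p" shows "compact (pball p)"
  using assms
proof (cases p rule: ereal_ge_1_cases)
  case 1
  have "pball p = {0..1} \<times> {0..1}" unfolding 1 by (auto simp: mem_pball_infinity)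
  then show ?thesis by (simp add: compact_Times)
next
  case (2 q)
  have "pball p = {z \<in> {0..1} \<times> {0..1}. fst z powr q + snd z powr q \<le> 1}"
  proof (rule set_eqI)
    fix z :: "real \<times> real"
    obtain a b where z: "z = (a, b)" by (cases z)
    show "z \<in> pball p \<longleftrightarrow> z \<in> {z \<in> {0..1} \<times> {0..1}. fst z powr q + snd z powr q \<le> 1}"
      using pball_le_1[OF assms, of a b] by (auto simp: z 2(1) mem_pball_ereal)
  qed
  moreover have cl: "closed {z \<in> {0..1::real} \<times> {0..1::real}. fst z powr q + snd z powr q \<le> 1}"
  proof (rule continuous_on_closed_Collect_le)
    have pc: "continuous_on A (\<lambda>z. f z powr q)" if "continuous_on A f" "\<And>z. z \<in> A \<Longrightarrow> 0 \<le> f z"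
      for A :: "(real \<times> real) set" and f
      by (rule continuous_on_powr'[OF that(1) continuous_on_const]) (use that(2) 2 in auto)
    show "continuous_on ({0..1::real} \<times> {0..1::real}) (\<lambda>z. fst z powr q + snd z powr q)"
      by (intro continuous_on_add pc continuous_on_fst continuous_on_snd continuous_on_id) auto
  qed (auto intro: closed_Times)
  moreover have "bounded {z \<in> {0..1::real} \<times> {0..1::real}. fst z powr q + snd z powr q \<le> 1}"
    by (rule bounded_subset[of "{0..1} \<times> {0..1}"]) (auto intro: bounded_Times)
  ultimately show ?thesis by (simp add: compact_eq_bounded_closed)
qed

text \<open>The tangent at 1 to a concave power, read off from Young's inequality with second factor
  1. The exponents \<open>1/q\<close> and \<open>q/2\<close> give the two comparisons between the
  ellipse and the p-ball for \<open>q < 2\<close>.\<close>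

lemma powr_le_affine:
  fixes x :: real assumes "0 \<le> \<alpha>" "\<alpha> \<le> 1" "0 \<le> x"
  shows "x powr \<alpha> \<le> \<alpha> * x + (1 - \<alpha>)"
proof (cases "x = 0")
  case False
  then show ?thesis using Youngs_inequality_0[of \<alpha> "1 - \<alpha>" x 1] assms by simp
qed (use assms in simp)

text \<open>
  The ellipse with weights \<open>k\<close>, \<open>\<tau>\<close> and level \<open>r2\<close> is the largest one inside the unit ball of the p-norm;
  \<open>(a0, b0)\<close> is a contact point, and the fifth conclusion says that the two sets have a common
  supporting line there.
\<close>

lemma pball_inscribed_ellipse:
  assumes k: "k > 0" "\<tau> > 0" and p: "1 \<le> p"
  obtains r2 a0 b0 where "r2 > 0" "0 \<le> a0" "0 \<le> b0" "k * a0\<^sup>2 + \<tau> * b0\<^sup>2 = r2"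
    "\<And>a b. (a, b) \<in> pball p \<Longrightarrow> k * a0 * a + \<tau> * b0 * b \<le> r2"
    "\<And>a b. 0 \<le> a \<Longrightarrow> 0 \<le> b \<Longrightarrow> k * a\<^sup>2 + \<tau> * b\<^sup>2 \<le> r2 \<Longrightarrow> (a, b) \<in> pball p"
    "\<not> (p = 2 \<and> k = \<tau>) \<Longrightarrow> \<exists>a b. (a, b) \<in> pball p \<and> k * a\<^sup>2 + \<tau> * b\<^sup>2 > r2"
proof (cases "2 \<le> p")
  case True
  \<comment> \<open>For \<open>p \<ge> 2\<close> the p-ball contains the quarter disc. The ellipse
    of level \<open>min k \<tau>\<close> lies in the disc and touches its circle at the end of the
    axis with the smaller weight, which also belongs to the p-sphere.\<close>
  have sub: "(a, b) \<in> pball p" if ab: "0 \<le> a" "0 \<le> b" "a\<^sup>2 + b\<^sup>2 \<le> 1" for a b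
  proof -
    have "a\<^sup>2 \<le> 1" "b\<^sup>2 \<le> 1" using ab zero_le_power2[of a] zero_le_power2[of b] by linarith+
    then have le1: "a \<le> 1" "b \<le> 1" by (auto simp: power2_le_iff_abs_le[of 1, simplified] abs_square_le_1)
    show ?thesis using p
    proof (cases p rule: ereal_ge_1_cases)
      case 1
      then show ?thesis using ab le1 by (simp add: mem_pball_infinity)
    next
      case (2 q)
      then have "2 \<le> q" using True by simp
      then have "a powr q \<le> a powr 2" "b powr q \<le> b powr 2"
        using ab le1 powr_mono'[of 2 q a] powr_mono'[of 2 q b] by blast+
      moreover have "a powr 2 = a\<^sup>2" "b powr 2 = b\<^sup>2" using ab by auto
      ultimately show ?thesis using 2 ab by (simp add: mem_pball_ereal)
    qed
  qed
  \<comment> \<open>With different weights the end of the axis with the larger weight lies outside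
    the ellipse. With equal weights and \<open>p > 2\<close> the diagonal point of the p-sphere lies
    outside the disc.\<close>
  have strict: "\<exists>a b. (a, b) \<in> pball p \<and> k * a\<^sup>2 + \<tau> * b\<^sup>2 > min k \<tau>" if ne: "\<not> (p = 2 \<and> k = \<tau>)"
  proof (cases "k = \<tau>")
    case False
    then consider "k < \<tau>" | "\<tau> < k" by linarith
    then show ?thesis
    proof cases
      case 1
      then show ?thesis using pball_axes(2)[OF p] by - (rule exI[of _ 0], rule exI[of _ 1], auto)
    next
      case 2
      then show ?thesis using pball_axes(1)[OF p] by - (rule exI[of _ 1], rule exI[of _ 0], auto)
    qed
  next
    case eq: True
    then have "p \<noteq> 2" using ne by simp
    show ?thesis using p
    proof (cases p rule: ereal_ge_1_cases)
      case 1
      then show ?thesis using eq k by - (rule exI[of _ 1], rule exI[of _ 1], auto simp: mem_pball_infinity)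
    next
      case (2 q)
      then have q: "q > 2" using True \<open>p \<noteq> 2\<close> by (auto simp: less_le)
      define a where "a = (1/2::real) powr (1/q)"
      have "(a, a) \<in> pball p" using q by (simp add: 2(1) mem_pball_ereal a_def powr_powr)
      moreover have "a\<^sup>2 > 1/2"
      proof -
        have "a\<^sup>2 = (1/2) powr (2/q)" by (simp add: a_def powr_power)
        also have "\<dots> > (1/2) powr 1" using q by (intro powr_less_mono') auto
        finally show ?thesis by simp
      qed
      ultimately show ?thesis using eq k by - (rule exI[of _ a], rule exI[of _ a], auto)
    qed
  qed
  show thesis
  proof (cases "k \<le> \<tau>")
    case kt: True
    show thesis
    proof (rule that[of k 1 0])
      show "k * 1 * a + \<tau> * 0 * b \<le> k" if "(a, b) \<in> pball p" for a b using pball_le_1[OF p that] k by simp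
      show "(a, b) \<in> pball p" if "0 \<le> a" "0 \<le> b" "k * a\<^sup>2 + \<tau> * b\<^sup>2 \<le> k" for a b
      proof (rule sub[OF that(1,2)])
        have "k * b\<^sup>2 \<le> \<tau> * b\<^sup>2" using kt by (intro mult_right_mono) auto
        then have "k * (a\<^sup>2 + b\<^sup>2) \<le> k * 1" using that(3) by (simp add: distrib_left)
        then show "a\<^sup>2 + b\<^sup>2 \<le> 1" using k by (simp only: mult_le_cancel_left_pos)
      qed
      show "\<exists>a b. (a, b) \<in> pball p \<and> k < k * a\<^sup>2 + \<tau> * b\<^sup>2" if "\<not> (p = 2 \<and> k = \<tau>)"
        using strict[OF that] kt by (simp add: min_def)
    qed (use k in auto)
  next
    case kt: False
    show thesis
    proof (rule that[of \<tau> 0 1])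
      show "k * 0 * a + \<tau> * 1 * b \<le> \<tau>" if "(a, b) \<in> pball p" for a b using pball_le_1[OF p that] k by simp
      show "(a, b) \<in> pball p" if "0 \<le> a" "0 \<le> b" "k * a\<^sup>2 + \<tau> * b\<^sup>2 \<le> \<tau>" for a b
      proof (rule sub[OF that(1,2)])
        have "\<tau> * a\<^sup>2 \<le> k * a\<^sup>2" using kt by (intro mult_right_mono) auto
        then have "\<tau> * (a\<^sup>2 + b\<^sup>2) \<le> \<tau> * 1" using that(3) by (simp add: distrib_left)
        then show "a\<^sup>2 + b\<^sup>2 \<le> 1" using k by (simp only: mult_le_cancel_left_pos)
      qed
      show "\<exists>a b. (a, b) \<in> pball p \<and> \<tau> < k * a\<^sup>2 + \<tau> * b\<^sup>2" if "\<not> (p = 2 \<and> k = \<tau>)"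
        using strict[OF that] kt by (simp add: min_def)
    qed (use k in auto)
  qed
next
  case False
  then obtain q where q: "p = ereal q" "1 \<le> q" "q < 2"
    using ereal_ge_1_cases[OF p] by force
  \<comment> \<open>Lagrange's condition for minimising
    \<open>k * a\<^sup>2 + \<tau> * b\<^sup>2\<close> on the curve where the q-th powers add up to 1
    says that \<open>c * \<alpha> c powr (2 - q)\<close> is the same number \<open>r2\<close> for
    both weights \<open>c\<close>. Hence the q-th power \<open>A c\<close> of the contact coordinate
    is \<open>(r2 / c) powr s\<close>, and \<open>A k + A \<tau> = 1\<close> forces
    \<open>r2 = S powr (- (1/s))\<close>.\<close>
  define s where "s = q / (2 - q)"
  have s: "s > 0" "(2 - q) / q = 1 / s" using q by (auto simp: s_def)
  define S where "S = k powr (-s) + \<tau> powr (-s)"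
  have S: "S > 0" using k by (simp add: S_def add_pos_pos)
  define r2 where "r2 = S powr (- (1/s))"
  have r2: "r2 > 0" using S by (simp add: r2_def)
  define A where "A c = c powr (-s) / S" for c :: real
  have A: "A c > 0" if "c > 0" for c using that S by (simp add: A_def)
  have A1: "A k + A \<tau> = 1" using S by (simp add: A_def S_def add_divide_distrib[symmetric])
  define \<alpha> where "\<alpha> c = A c powr (1/q)" for c
  have \<alpha>: "\<alpha> c > 0" "\<alpha> c powr q = A c" "c * (\<alpha> c)\<^sup>2 = r2 * A c" if c: "c > 0" for c
  proof -
    show 1: "\<alpha> c > 0" using A[OF c] by (simp add: \<alpha>_def)
    show 2: "\<alpha> c powr q = A c" using A[OF c] q by (simp add: \<alpha>_def powr_powr)
    have "c * \<alpha> c powr (2 - q) = c * A c powr (1/s)"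
      using s(2) q by (simp add: \<alpha>_def powr_powr)
    also have "A c powr (1/s) = (c powr (-s)) powr (1/s) / S powr (1/s)"
      using S by (simp add: A_def powr_divide)
    also have "\<dots> = c powr (-1) * r2"
    proof -
      have "(c powr (-s)) powr (1/s) = c powr (-1)" unfolding powr_powr using s(1) by simp
      then show ?thesis unfolding r2_def powr_minus_divide[of S] by simp
    qed
    also have "c * (c powr (-1) * r2) = r2" using c by (simp add: powr_minus)
    finally have "c * \<alpha> c powr (2 - q) = r2" .
    moreover have "(\<alpha> c)\<^sup>2 = \<alpha> c powr (2 - q) * \<alpha> c powr q" using 1 by (simp add: powr_add[symmetric])
    ultimately show "c * (\<alpha> c)\<^sup>2 = r2 * A c" using 2 by simp
  qed
  \<comment> \<open>\<open>lin\<close> and \<open>quad\<close> are \<open>powr_le_affine\<close> in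
    the variable \<open>x = a / \<alpha> c\<close>, for which the contact point is
    \<open>x = 1\<close>. Added over the two weights they give the supporting line and the inclusion
    of the ellipse.\<close>
  have lin: "c * \<alpha> c * a \<le> r2 * (a powr q / q + (1 - 1/q) * A c)" if c: "c > 0" and a: "0 \<le> a" for c a
  proof -
    define x where "x = a / \<alpha> c"
    have x: "x \<ge> 0" "a = x * \<alpha> c" using a \<alpha>(1)[OF c] by (auto simp: x_def)
    have "x \<le> (1/q) * x powr q + (1 - 1/q)"
      using powr_le_affine[of "1/q" "x powr q"] q x by (simp add: powr_powr)
    then have "(r2 * A c) * x \<le> (r2 * A c) * ((1/q) * x powr q + (1 - 1/q))"
      using r2 A[OF c] by (intro mult_left_mono) auto
    moreover have "c * \<alpha> c * a = (r2 * A c) * x" using x \<alpha>(3)[OF c] by (simp add: power2_eq_square mult_ac)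
    moreover have "a powr q = x powr q * A c" using x \<alpha>[OF c] by (simp add: powr_mult)
    ultimately show ?thesis by (simp add: algebra_simps)
  qed
  have quad: "a powr q \<le> (q/2) * (c * a\<^sup>2 / r2) + (1 - q/2) * A c" if c: "c > 0" and a: "0 \<le> a" for c a
  proof -
    define x where "x = a / \<alpha> c"
    have x: "x \<ge> 0" "a = x * \<alpha> c" using a \<alpha>(1)[OF c] by (auto simp: x_def)
    have "(x\<^sup>2) powr (q/2) = x powr q"
      using x(1) by (cases "x = 0") (simp_all add: powr_powr powr_numeral[symmetric] del: powr_numeral)
    then have "x powr q \<le> (q/2) * x\<^sup>2 + (1 - q/2)"
      using powr_le_affine[of "q/2" "x\<^sup>2"] q by simp
    then have "A c * x powr q \<le> A c * ((q/2) * x\<^sup>2 + (1 - q/2))" using A[OF c] by (intro mult_left_mono) auto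
    moreover have "a powr q = A c * x powr q" using x \<alpha>[OF c] by (simp add: powr_mult)
    moreover have "c * a\<^sup>2 / r2 = A c * x\<^sup>2" using x \<alpha>(3)[OF c] r2 by (simp add: power_mult_distrib field_simps)
    ultimately show ?thesis by (simp add: algebra_simps)
  qed
  show thesis
  proof (rule that[of r2 "\<alpha> k" "\<alpha> \<tau>"])
    show "k * (\<alpha> k)\<^sup>2 + \<tau> * (\<alpha> \<tau>)\<^sup>2 = r2"
      using \<alpha>(3) k A1 by (simp add: distrib_left[symmetric])
    show "k * \<alpha> k * a + \<tau> * \<alpha> \<tau> * b \<le> r2" if "(a, b) \<in> pball p" for a b
    proof -
      have ab: "0 \<le> a" "0 \<le> b" "a powr q + b powr q \<le> 1" using that q by (auto simp: mem_pball_ereal)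
      have "k * \<alpha> k * a + \<tau> * \<alpha> \<tau> * b \<le> r2 * ((a powr q + b powr q) / q + (1 - 1/q) * (A k + A \<tau>))"
        using lin[OF k(1) ab(1)] lin[OF k(2) ab(2)] by (simp add: algebra_simps add_divide_distrib)
      also have "\<dots> \<le> r2 * (1 / q + (1 - 1/q))"
        unfolding A1 using ab(3) q r2 by (intro mult_left_mono add_right_mono) (auto simp: divide_right_mono)
      finally show ?thesis by simp
    qed
    show "(a, b) \<in> pball p" if "0 \<le> a" "0 \<le> b" "k * a\<^sup>2 + \<tau> * b\<^sup>2 \<le> r2" for a b
    proof -
      have "a powr q + b powr q \<le> (q/2) * ((k * a\<^sup>2 + \<tau> * b\<^sup>2) / r2) + (1 - q/2) * (A k + A \<tau>)"
        using quad[OF k(1) that(1)] quad[OF k(2) that(2)] by (simp add: algebra_simps add_divide_distrib)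
      also have "\<dots> \<le> (q/2) * 1 + (1 - q/2)"
        unfolding A1 using that(3) q r2 by (intro add_mono mult_left_mono) auto
      finally show ?thesis using that q by (simp add: mem_pball_ereal)
    qed
    \<comment> \<open>For \<open>p < 2\<close> the end of an axis is always a witness: the contact
      coordinate \<open>\<alpha> k\<close> is below 1, so its square is less than its q-th power,
      and this says \<open>r2 < k\<close>.\<close>
    show "\<exists>a b. (a, b) \<in> pball p \<and> r2 < k * a\<^sup>2 + \<tau> * b\<^sup>2"
    proof (intro exI conjI)
      show "(1, 0) \<in> pball p" by (rule pball_axes[OF p])
      have "A k < 1" using A1 A[OF k(2)] by simp
      have "\<alpha> k < 1" unfolding \<alpha>_def using powr_less_mono2[of "1/q" "A k" 1] A[OF k(1)] \<open>A k < 1\<close> q by simp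
      have "r2 * A k < k * A k"
      proof -
        have "\<alpha> k powr 2 < \<alpha> k powr q" using \<open>\<alpha> k < 1\<close> \<alpha>(1)[OF k(1)] q by (intro powr_less_mono') auto
        then have "(\<alpha> k)\<^sup>2 < A k" using \<alpha>[OF k(1)] by simp
        then show ?thesis using \<alpha>(3)[OF k(1)] k(1) by (metis mult_strict_left_mono)
      qed
      then show "r2 < k * 1\<^sup>2 + \<tau> * 0\<^sup>2" using A[OF k(1)] by simp
    qed
  qed (use r2 \<alpha>(1) k in \<open>auto intro: less_imp_le\<close>)
qed

subsection \<open>Volumes\<close>

text \<open>A relabelling of coordinates between two different types. It maps boxes to boxes with
  the same side lengths, and Lebesgue measure is characterised by its values on boxes.\<close>

lemma emeasure_basis_bijection_image:
  fixes f :: "'a::euclidean_space \<Rightarrow> 'b::euclidean_space"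
  assumes f: "linear f" "bij_betw f Basis Basis" and S: "S \<in> sets borel"
  shows "emeasure lborel (f ` S) = emeasure lborel S"
proof -
  define g where "g y = (\<Sum>b\<in>Basis. (y \<bullet> f b) *\<^sub>R b)" for y
  have ff: "f c \<bullet> f b = (if c = b then 1 else 0)" if "c \<in> Basis" "b \<in> Basis" for c b
    using bij_betwE[OF f(2)] that inj_onD[OF bij_betw_imp_inj_on[OF f(2)], of c b] by (auto simp: inner_Basis)
  have inn: "f x \<bullet> f b = x \<bullet> b" if b: "b \<in> Basis" for x b
  proof -
    have "f x = f (\<Sum>c\<in>Basis. (x \<bullet> c) *\<^sub>R c)" by (simp add: euclidean_representation)
    also have "\<dots> = (\<Sum>c\<in>Basis. (x \<bullet> c) *\<^sub>R f c)" using f(1) by (simp add: linear_sum linear_cmul)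
    also have "\<dots> \<bullet> f b = (\<Sum>c\<in>Basis. if c = b then x \<bullet> c else 0)"
      unfolding inner_sum_left by (rule sum.cong[OF refl]) (simp add: ff[OF _ b])
    finally show ?thesis using b by simp
  qed
  have gf: "g (f x) = x" for x by (simp add: g_def inn euclidean_representation)
  have fg: "f (g y) = y" for y
  proof (rule euclidean_eqI)
    fix b' :: 'b assume "b' \<in> Basis"
    then obtain b where b: "b \<in> Basis" "b' = f b" using f(2) by (auto simp: bij_betw_def)
    have "f (g y) \<bullet> b' = g y \<bullet> b" using inn[OF b(1)] b(2) by simp
    also have "\<dots> = y \<bullet> b'" using b by (simp add: g_def)
    finally show "f (g y) \<bullet> b' = y \<bullet> b'" .
  qed
  have img: "g -` A = f ` A" for A using gf fg by (metis (no_types, lifting) antisym image_subset_iff subsetI vimageE vimageI2 image_eqI)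
  have gm: "g \<in> borel_measurable borel"
    unfolding g_def[abs_def] by (intro borel_measurable_continuous_onI continuous_intros)
  then have gm': "g \<in> measurable lborel borel" by simp
  have "distr lborel borel g = (lborel :: 'a measure)"
  proof (rule lborel_eqI[symmetric])
    fix l u :: 'a assume lu: "\<And>b. b \<in> Basis \<Longrightarrow> l \<bullet> b \<le> u \<bullet> b"
    have fB: "f ` Basis = Basis" using f(2) by (simp add: bij_betw_def)
    have "f ` box l u = box (f l) (f u)"
    proof (intro equalityI subsetI)
      fix y assume "y \<in> f ` box l u"
      then show "y \<in> box (f l) (f u)" unfolding mem_box fB[symmetric] by (auto simp: inn mem_box)
    next
      fix y assume y: "y \<in> box (f l) (f u)"
      have "g y \<in> box l u" unfolding mem_box
      proof
        fix b :: 'a assume b: "b \<in> Basis"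
        then have "f b \<in> Basis" using fB by blast
        then have "f l \<bullet> f b < y \<bullet> f b \<and> y \<bullet> f b < f u \<bullet> f b" using y by (simp add: mem_box)
        then show "l \<bullet> b < g y \<bullet> b \<and> g y \<bullet> b < u \<bullet> b" using inn[OF b] fg by metis
      qed
      then show "y \<in> f ` box l u" using fg by (metis imageI)
    qed
    then have "emeasure (distr lborel borel g) (box l u) = emeasure lborel (box (f l) (f u))"
      by (simp add: emeasure_distr[OF gm'] img)
    also have "\<dots> = ennreal (\<Prod>b'\<in>Basis. (f u - f l) \<bullet> b')"
    proof (rule emeasure_lborel_box)
      show "f l \<bullet> b' \<le> f u \<bullet> b'" if "b' \<in> Basis" for b'
        using that lu inn unfolding fB[symmetric] by auto
    qed
    also have "(\<Prod>b'\<in>Basis. (f u - f l) \<bullet> b') = (\<Prod>b\<in>Basis. (f u - f l) \<bullet> f b)"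
      by (rule prod.reindex_bij_betw[OF f(2), symmetric])
    also have "\<dots> = (\<Prod>b\<in>Basis. (u - l) \<bullet> b)"
      by (rule prod.cong[OF refl]) (simp add: inner_diff_left inn)
    finally show "emeasure (distr lborel borel g) (box l u) = (\<Prod>b\<in>Basis. (u - l) \<bullet> b)" .
  qed simp
  then have "emeasure lborel S = emeasure (distr lborel borel g) S" by simp
  also have "\<dots> = emeasure lborel (f ` S)" using S by (simp add: emeasure_distr[OF gm'] img)
  finally show ?thesis ..
qed

lemma vec_join_zero [simp]: "vec_join 0 0 = 0"
  by (simp add: vec_join_def vec_eq_iff split: sum.split)

lemma vec_join_axis [simp]:
  "vec_join (axis i x) 0 = axis (Inl i) x" "vec_join 0 (axis j x) = axis (Inr j) x"
  by (simp_all add: vec_join_def axis_def vec_eq_iff split: sum.split)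

lemma linear_phase_join: "linear (case_prod phase_join)"
  by (rule linearI) (auto simp: phase_join_def vec_join_def vec_eq_iff split: sum.split)

lemma phase_join_simps:
  "phase_join (x + x') (y + y') = phase_join x y + phase_join x' y'"
  "phase_join (c *\<^sub>R x) (c *\<^sub>R y) = c *\<^sub>R phase_join x y"
  using linear_add[OF linear_phase_join, of "(x, y)" "(x', y')"] linear_cmul[OF linear_phase_join, of c "(x, y)"]
  by auto

lemma Basis_phase_iff: "u \<in> (Basis :: 'n::finite phase set) \<longleftrightarrow> (\<exists>i. u = (axis i 1, 0) \<or> u = (0, axis i 1))"
  unfolding Basis_prod_def Basis_vec_def by auto

text \<open>Surjectivity is a count: an injective image of one basis inside the other, and the
  dimensions agree.\<close>

lemma bij_betw_phase_join_Basis: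
  "bij_betw (case_prod (phase_join :: 'n::finite phase \<Rightarrow> 'm::finite phase \<Rightarrow> _)) Basis Basis"
proof -
  let ?f = "case_prod (phase_join :: 'n phase \<Rightarrow> 'm phase \<Rightarrow> _)"
  have inj: "inj_on ?f Basis" using bij_phase_join by (auto simp: bij_def intro: inj_on_subset)
  have sub: "?f ` Basis \<subseteq> Basis"
  proof (rule image_subsetI)
    fix u :: "'n phase \<times> 'm phase" assume u: "u \<in> Basis"
    obtain z w where zw: "u = (z, w)" by (rule prod.exhaust)
    from u consider "z \<in> Basis" "w = 0" | "z = 0" "w \<in> Basis" unfolding zw Basis_prod_def by blast
    then show "?f u \<in> Basis"
      by cases (auto simp: zw Basis_phase_iff phase_join_def)
  qed
  have "card (?f ` Basis) = card (Basis :: ('n + 'm) phase set)"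
    unfolding card_image[OF inj] by simp
  with sub have "?f ` Basis = Basis" by (intro card_subset_eq) auto
  with inj show ?thesis by (simp add: bij_betw_def)
qed

lemma emeasure_phase_join_image:
  assumes "S \<in> sets borel"
  shows "emeasure lborel (case_prod phase_join ` S) = emeasure lborel S"
  by (rule emeasure_basis_bijection_image[OF linear_phase_join bij_betw_phase_join_Basis assms])

section \<open>Volume through the integral of exp(-gauge^2)\<close>

text \<open>For compact \<open>A\<close> that is star-shaped about 0 this is
  \<open>exp (- g\<^sup>2)\<close> with \<open>g\<close> the gauge of \<open>A\<close>, written as
  the integral of \<open>exp (-r)\<close> over all \<open>r \<ge> g\<^sup>2\<close>. Points in no
  dilate of \<open>A\<close>, which exist when 0 is on the boundary of a convex body, get the value
  0 automatically.\<close>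

definition sqrt_exp_transform :: "'a::euclidean_space set \<Rightarrow> 'a \<Rightarrow> ennreal" where
  "sqrt_exp_transform A x = (\<integral>\<^sup>+r. ennreal (exp (-r)) * indicator {r. 0 \<le> r \<and> x \<in> (*\<^sub>R) (sqrt r) ` A} r \<partial>lborel)"

text \<open>The graph is a countable union of compact sets: with \<open>s = sqrt r\<close> it is
  swept out by \<open>(s\<^sup>2, s *\<^sub>R a)\<close> for \<open>s\<close> in
  \<open>[0, N]\<close> and \<open>a\<close> in \<open>A\<close>.\<close>

lemma dilation_graph_borel:
  fixes A :: "'a::euclidean_space set"
  assumes "compact A"
  shows "{(r, x). 0 \<le> r \<and> x \<in> (*\<^sub>R) (sqrt r) ` A} \<in> sets (lborel \<Otimes>\<^sub>M lborel)"
proof -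
  have eq: "{(r, x). 0 \<le> r \<and> x \<in> (*\<^sub>R) (sqrt r) ` A} = (\<Union>N::nat. (\<lambda>(s, a). (s\<^sup>2, s *\<^sub>R a)) ` ({0..real N} \<times> A))" (is "?L = ?R")
  proof (intro equalityI subsetI)
    fix z assume "z \<in> ?L"
    then obtain r a where z: "z = (r, sqrt r *\<^sub>R a)" "0 \<le> r" "a \<in> A" by auto
    obtain N :: nat where "sqrt r \<le> real N" using real_arch_simple by blast
    with z show "z \<in> ?R" by (intro UN_I[of N] image_eqI[of _ _ "(sqrt r, a)"]) auto
  next
    fix z assume "z \<in> ?R"
    then obtain N :: nat where "z \<in> (\<lambda>(s, a). (s\<^sup>2, s *\<^sub>R a)) ` ({0..real N} \<times> A)" by blast
    then obtain w where w: "w \<in> {0..real N} \<times> A" "z = (\<lambda>(s, a). (s\<^sup>2, s *\<^sub>R a)) w" by blast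
    then have "z = ((fst w)\<^sup>2, sqrt ((fst w)\<^sup>2) *\<^sub>R snd w)" "snd w \<in> A" by (auto simp: case_prod_unfold)
    then show "z \<in> ?L" by (auto intro: imageI)
  qed
  have "compact ((\<lambda>(s, a). (s\<^sup>2, s *\<^sub>R a)) ` ({0..real N} \<times> A))" for N :: nat
    using assms by (intro compact_continuous_image compact_Times) (auto simp: case_prod_unfold intro!: continuous_intros)
  then have "?R \<in> sets borel" by (intro sets.countable_UN) (auto intro: borel_compact)
  moreover have "sets (lborel \<Otimes>\<^sub>M lborel) = sets (borel :: (real \<times> 'a) measure)"
    by (simp only: lborel_prod sets_lborel)
  ultimately show ?thesis unfolding eq by simp
qed

text \<open>Tonelli: the slice at level \<open>r\<close> has volume \<open>r ^ d\<close> times that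
  of \<open>A\<close>, because the dimension is \<open>2 * d\<close>, and the integral of
  \<open>r ^ d * exp (-r)\<close> is \<open>d!\<close>. This is the factorial in the systolic
  ratio.\<close>

lemma nn_integral_sqrt_exp_transform:
  fixes A :: "'a::euclidean_space set"
  assumes A: "compact A" and d: "DIM('a) = 2 * d"
  shows "(\<integral>\<^sup>+x. sqrt_exp_transform A x \<partial>lborel) = fact d * emeasure lborel A"
proof -
  define G where "G = {(r, x). 0 \<le> r \<and> x \<in> (*\<^sub>R) (sqrt r) ` A}"
  have G: "G \<in> sets (lborel \<Otimes>\<^sub>M lborel)" unfolding G_def by (rule dilation_graph_borel[OF A])
  have "(\<integral>\<^sup>+x. sqrt_exp_transform A x \<partial>lborel)
      = (\<integral>\<^sup>+x. (\<integral>\<^sup>+r. ennreal (exp (-r)) * indicator G (r, x) \<partial>lborel) \<partial>lborel)"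
    unfolding sqrt_exp_transform_def by (intro nn_integral_cong) (auto simp: G_def split: split_indicator)
  also have "\<dots> = (\<integral>\<^sup>+r. (\<integral>\<^sup>+x. ennreal (exp (-r)) * indicator G (r, x) \<partial>lborel) \<partial>lborel)"
  proof (rule lborel_pair.Fubini')
    have [measurable]: "G \<in> sets (lborel \<Otimes>\<^sub>M lborel)" by (rule G)
    show "(\<lambda>(r, x). ennreal (exp (-r)) * indicator G (r, x)) \<in> borel_measurable (lborel \<Otimes>\<^sub>M lborel)"
      by measurable
  qed
  also have "\<dots> = (\<integral>\<^sup>+r. ennreal (r ^ d * exp (-r)) * indicator {0..} r * emeasure lborel A \<partial>lborel)"
  proof (rule nn_integral_cong)
    fix r :: real
    show "(\<integral>\<^sup>+x. ennreal (exp (-r)) * indicator G (r, x) \<partial>lborel)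
        = ennreal (r ^ d * exp (-r)) * indicator {0..} r * emeasure lborel A"
    proof (cases "0 \<le> r")
      case True
      have cA: "(*\<^sub>R) (sqrt r) ` A \<in> sets borel" using A by (intro borel_compact compact_scaling)
      have "(\<integral>\<^sup>+x. ennreal (exp (-r)) * indicator G (r, x) \<partial>lborel)
          = (\<integral>\<^sup>+x. ennreal (exp (-r)) * indicator ((*\<^sub>R) (sqrt r) ` A) x \<partial>lborel)"
        using True by (intro nn_integral_cong) (auto simp: G_def split: split_indicator)
      also have "\<dots> = ennreal (exp (-r)) * emeasure lborel ((*\<^sub>R) (sqrt r) ` A)"
        using cA by (simp add: nn_integral_cmult)
      also have "emeasure lborel ((*\<^sub>R) (sqrt r) ` A) = ennreal (r ^ d) * emeasure lborel A"
      proof -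
        have "emeasure lborel ((*\<^sub>R) (sqrt r) ` A) = emeasure lebesgue ((*\<^sub>R) (sqrt r) ` A)" using cA by simp
        also have "\<dots> = ennreal (\<bar>sqrt r\<bar> ^ DIM('a)) * emeasure lebesgue A"
          using emeasure_lebesgue_affine[of "sqrt r" 0 A] by (simp add: image_image ennreal_power)
        also have "\<bar>sqrt r\<bar> ^ DIM('a) = r ^ d" using True by (simp add: d power_mult)
        also have "emeasure lebesgue A = emeasure lborel A" using borel_compact[OF A] by simp
        finally show ?thesis .
      qed
      finally show ?thesis using True by (simp add: ennreal_mult mult_ac)
    qed (simp add: G_def)
  qed
  also have "\<dots> = (\<integral>\<^sup>+r. ennreal (r ^ d * exp (-r)) * indicator {0..} r \<partial>lborel) * emeasure lborel A"
    by (rule nn_integral_multc) measurable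
  also have "\<dots> = fact d * emeasure lborel A"
    unfolding nn_intergal_power_times_exp_Ici by (metis ennreal_of_nat_eq_real_of_nat of_nat_fact)
  finally show ?thesis .
qed

lemma nn_integral_exp_atLeast: "(\<integral>\<^sup>+r. ennreal (exp (-r)) * indicator {g..} r \<partial>lborel) = ennreal (exp (-g))"
proof -
  have "(\<integral>\<^sup>+r. ennreal (exp (-r)) * indicator {g..} r \<partial>lborel) = ennreal (0 - (- exp (-g)))"
  proof (rule nn_integral_FTC_atLeast)
    show "((\<lambda>r::real. - exp (-r)) \<longlongrightarrow> 0) at_top"
      by (rule tendsto_eq_intros exp_at_bot[THEN filterlim_compose] filterlim_uminus_at_bot_at_top | simp)+
  qed (auto intro!: derivative_eq_intros)
  then show ?thesis by simp
qed

text \<open>\<open>g\<close> is the squared gauge at \<open>x\<close>. The known dilation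
  \<open>r0\<close> confines the factors to a compact range, so a least one is attained;
  star-shapedness makes every larger factor admissible.\<close>

lemma dilation_threshold:
  fixes A :: "'a::euclidean_space set"
  assumes A: "compact A" and star: "\<And>a c. a \<in> A \<Longrightarrow> 0 \<le> c \<Longrightarrow> c \<le> 1 \<Longrightarrow> c *\<^sub>R a \<in> A"
    and r0: "0 \<le> r0" "x \<in> (*\<^sub>R) (sqrt r0) ` A"
  obtains g where "0 \<le> g" "\<And>r. 0 \<le> r \<Longrightarrow> x \<in> (*\<^sub>R) (sqrt r) ` A \<longleftrightarrow> g \<le> r"
proof -
  define C where "C = {z \<in> {0..sqrt r0} \<times> A. fst z *\<^sub>R snd z = x}"
  have "compact C"
  proof -
    have "closed {z :: real \<times> 'a. fst z *\<^sub>R snd z = x}"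
      by (intro closed_Collect_eq continuous_intros)
    then have "compact (({0..sqrt r0} \<times> A) \<inter> {z. fst z *\<^sub>R snd z = x})" using A by (intro compact_Int_closed compact_Times) auto
    moreover have "C = ({0..sqrt r0} \<times> A) \<inter> {z. fst z *\<^sub>R snd z = x}" unfolding C_def by blast
    ultimately show ?thesis by simp
  qed
  then have cf: "compact (fst ` C)" by (intro compact_continuous_image continuous_intros)
  obtain a0 where "a0 \<in> A" "x = sqrt r0 *\<^sub>R a0" using r0(2) by auto
  then have "(sqrt r0, a0) \<in> C" using r0(1) by (simp add: C_def)
  then have "sqrt r0 \<in> fst ` C" by force
  then obtain s where s: "s \<in> fst ` C" "\<And>s'. s' \<in> fst ` C \<Longrightarrow> s \<le> s'"
    using compact_attains_inf[OF cf] by blast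
  then obtain a where a: "0 \<le> s" "s \<le> sqrt r0" "a \<in> A" "s *\<^sub>R a = x" by (auto simp: C_def)
  show thesis
  proof (rule that[of "s\<^sup>2"])
    fix r :: real assume r: "0 \<le> r"
    show "x \<in> (*\<^sub>R) (sqrt r) ` A \<longleftrightarrow> s\<^sup>2 \<le> r"
    proof
      assume "x \<in> (*\<^sub>R) (sqrt r) ` A"
      then obtain b where b: "b \<in> A" "x = sqrt r *\<^sub>R b" by auto
      have "s \<le> sqrt r"
      proof (cases "sqrt r \<le> sqrt r0")
        case True
        then have "(sqrt r, b) \<in> C" using b r by (simp add: C_def)
        then show ?thesis using s(2) by force
      next
        case False
        then have "sqrt r0 \<le> sqrt r" by (simp del: real_sqrt_le_iff)
        with a(2) show ?thesis by (rule order_trans)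
      qed
      then have "s\<^sup>2 \<le> (sqrt r)\<^sup>2" using a(1) by (intro power_mono) auto
      then show "s\<^sup>2 \<le> r" using r by simp
    next
      assume "s\<^sup>2 \<le> r"
      then have le: "s \<le> sqrt r" by (rule real_le_rsqrt)
      show "x \<in> (*\<^sub>R) (sqrt r) ` A"
      proof (cases "sqrt r = 0")
        case True
        then have "s = 0" using le a(1) by simp
        then show ?thesis using True a by auto
      next
        case False
        then have "sqrt r > 0" using r by simp
        have "x = sqrt r *\<^sub>R ((s / sqrt r) *\<^sub>R a)" using a(4) False by simp
        moreover have "(s / sqrt r) *\<^sub>R a \<in> A" using star[OF a(3)] a(1) le \<open>sqrt r > 0\<close> by (simp add: divide_le_eq)
        ultimately show ?thesis by blast
      qed
    qed
  qed simp
qed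

lemma sqrt_exp_transform_threshold:
  assumes "0 \<le> g" "\<And>r. 0 \<le> r \<Longrightarrow> x \<in> (*\<^sub>R) (sqrt r) ` A \<longleftrightarrow> g \<le> r"
  shows "sqrt_exp_transform A x = ennreal (exp (-g))"
proof -
  have "{r. 0 \<le> r \<and> x \<in> (*\<^sub>R) (sqrt r) ` A} = {g..}" using assms by auto
  then show ?thesis by (simp add: sqrt_exp_transform_def nn_integral_exp_atLeast)
qed

text \<open>The 2-product on the plain product type, where Tonelli applies;
  \<open>phase_join\<close> transports it afterwards. Taking the whole quarter disc and not only its
  arc gives the same set when the factors are star-shaped about 0.\<close>

definition prod2 :: "'a::real_vector set \<Rightarrow> 'b::real_vector set \<Rightarrow> ('a \<times> 'b) set" where
  "prod2 A B = {(a *\<^sub>R x, b *\<^sub>R y) | a b x y. 0 \<le> a \<and> 0 \<le> b \<and> a\<^sup>2 + b\<^sup>2 \<le> 1 \<and> x \<in> A \<and> y \<in> B}"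

lemma compact_prod2:
  fixes A :: "'a::euclidean_space set" and B :: "'b::euclidean_space set"
  assumes "compact A" "compact B" shows "compact (prod2 A B)"
proof -
  define Q where "Q = {z :: real \<times> real. 0 \<le> fst z \<and> 0 \<le> snd z \<and> (fst z)\<^sup>2 + (snd z)\<^sup>2 \<le> 1}"
  have "closed Q" unfolding Q_def
    by (intro closed_Collect_conj closed_Collect_le continuous_intros)
  moreover have "bounded Q"
  proof (rule bounded_subset[of "cball 0 1"])
    show "Q \<subseteq> cball 0 1" by (auto simp: Q_def norm_prod_def)
  qed simp
  ultimately have "compact Q" by (simp add: compact_eq_bounded_closed)
  then have "compact ((\<lambda>(z, x, y). (fst z *\<^sub>R x, snd z *\<^sub>R y)) ` (Q \<times> A \<times> B))"
    using assms by (intro compact_continuous_image compact_Times) (auto simp: case_prod_unfold intro!: continuous_intros)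
  moreover have "(\<lambda>(z, x, y). (fst z *\<^sub>R x, snd z *\<^sub>R y)) ` (Q \<times> A \<times> B) = prod2 A B"
    unfolding prod2_def Q_def by (force simp: image_iff)
  ultimately show ?thesis by simp
qed

text \<open>The squared gauge of a 2-product is the sum of the squared gauges, and the exponential
  turns the sum into a product. If one gauge is infinite, both sides vanish.\<close>

lemma sqrt_exp_transform_prod2:
  fixes A :: "'a::euclidean_space set" and B :: "'b::euclidean_space set"
  assumes A: "compact A" "\<And>a c. a \<in> A \<Longrightarrow> 0 \<le> c \<Longrightarrow> c \<le> 1 \<Longrightarrow> c *\<^sub>R a \<in> A"
    and B: "compact B" "\<And>b c. b \<in> B \<Longrightarrow> 0 \<le> c \<Longrightarrow> c \<le> 1 \<Longrightarrow> c *\<^sub>R b \<in> B"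
  shows "sqrt_exp_transform (prod2 A B) (x, y) = sqrt_exp_transform A x * sqrt_exp_transform B y"
proof -
  have mem: "(x, y) \<in> (*\<^sub>R) (sqrt r) ` prod2 A B \<longleftrightarrow>
      (\<exists>s t. 0 \<le> s \<and> 0 \<le> t \<and> s + t \<le> r \<and> x \<in> (*\<^sub>R) (sqrt s) ` A \<and> y \<in> (*\<^sub>R) (sqrt t) ` B)" if r: "0 \<le> r" for r
  proof
    assume "(x, y) \<in> (*\<^sub>R) (sqrt r) ` prod2 A B"
    then obtain a b k h where *: "0 \<le> a" "0 \<le> b" "a\<^sup>2 + b\<^sup>2 \<le> 1" "k \<in> A" "h \<in> B"
      "x = sqrt r *\<^sub>R a *\<^sub>R k" "y = sqrt r *\<^sub>R b *\<^sub>R h" by (auto simp: prod2_def)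
    have "r * (a\<^sup>2 + b\<^sup>2) \<le> r * 1" using * r by (intro mult_left_mono) auto
    then have "r * a\<^sup>2 + r * b\<^sup>2 \<le> r" by (simp add: distrib_left)
    moreover have "sqrt (r * a\<^sup>2) = sqrt r * a" "sqrt (r * b\<^sup>2) = sqrt r * b" using * by (auto simp: real_sqrt_mult)
    ultimately show "\<exists>s t. 0 \<le> s \<and> 0 \<le> t \<and> s + t \<le> r \<and> x \<in> (*\<^sub>R) (sqrt s) ` A \<and> y \<in> (*\<^sub>R) (sqrt t) ` B"
      using * r by - (rule exI[of _ "r * a\<^sup>2"], rule exI[of _ "r * b\<^sup>2"], auto)
  next
    assume "\<exists>s t. 0 \<le> s \<and> 0 \<le> t \<and> s + t \<le> r \<and> x \<in> (*\<^sub>R) (sqrt s) ` A \<and> y \<in> (*\<^sub>R) (sqrt t) ` B"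
    then obtain s t k h where *: "0 \<le> s" "0 \<le> t" "s + t \<le> r" "k \<in> A" "h \<in> B" "x = sqrt s *\<^sub>R k" "y = sqrt t *\<^sub>R h"
      by auto
    show "(x, y) \<in> (*\<^sub>R) (sqrt r) ` prod2 A B"
    proof (cases "r = 0")
      case True
      then have "x = 0" "y = 0" using * by auto
      moreover have "(0 *\<^sub>R k, 0 *\<^sub>R h) \<in> prod2 A B" unfolding prod2_def using * by force
      ultimately show ?thesis using True
        by (intro image_eqI[of _ _ "(0 *\<^sub>R k, 0 *\<^sub>R h)"]) (simp_all add: zero_prod_def)
    next
      case False
      then have r0: "r > 0" using r by simp
      define a where "a = sqrt s / sqrt r"
      define b where "b = sqrt t / sqrt r"
      have "a\<^sup>2 + b\<^sup>2 = (s + t) / r" using * r0 by (simp add: a_def b_def power_divide add_divide_distrib)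
      then have "a\<^sup>2 + b\<^sup>2 \<le> 1" using * r0 by simp
      then have "(a *\<^sub>R k, b *\<^sub>R h) \<in> prod2 A B" unfolding prod2_def using * r0 by (force simp: a_def b_def)
      moreover have "(x, y) = sqrt r *\<^sub>R (a *\<^sub>R k, b *\<^sub>R h)" using * r0 by (simp add: a_def b_def)
      ultimately show ?thesis by blast
    qed
  qed
  show ?thesis
  proof (cases "(\<exists>s\<ge>0. x \<in> (*\<^sub>R) (sqrt s) ` A) \<and> (\<exists>t\<ge>0. y \<in> (*\<^sub>R) (sqrt t) ` B)")
    case True
    then obtain s t where st: "0 \<le> s" "x \<in> (*\<^sub>R) (sqrt s) ` A" "0 \<le> t" "y \<in> (*\<^sub>R) (sqrt t) ` B" by blast
    obtain g where g: "0 \<le> g" "\<And>r. 0 \<le> r \<Longrightarrow> x \<in> (*\<^sub>R) (sqrt r) ` A \<longleftrightarrow> g \<le> r"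
      by (rule dilation_threshold[OF A st(1,2)], assumption+) (rule that)
    obtain h where h: "0 \<le> h" "\<And>r. 0 \<le> r \<Longrightarrow> y \<in> (*\<^sub>R) (sqrt r) ` B \<longleftrightarrow> h \<le> r"
      by (rule dilation_threshold[OF B st(3,4)], assumption+) (rule that)
    have "(x, y) \<in> (*\<^sub>R) (sqrt r) ` prod2 A B \<longleftrightarrow> g + h \<le> r" if r: "0 \<le> r" for r
    proof -
      have "(x, y) \<in> (*\<^sub>R) (sqrt r) ` prod2 A B \<longleftrightarrow> (\<exists>s t. 0 \<le> s \<and> 0 \<le> t \<and> s + t \<le> r \<and> g \<le> s \<and> h \<le> t)"
        unfolding mem[OF r] by (simp add: g(2) h(2) cong: conj_cong)
      also have "\<dots> \<longleftrightarrow> g + h \<le> r"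
      proof
        assume "g + h \<le> r"
        then show "\<exists>s t. 0 \<le> s \<and> 0 \<le> t \<and> s + t \<le> r \<and> g \<le> s \<and> h \<le> t"
          using g(1) h(1) by - (rule exI[of _ g], rule exI[of _ h], auto)
      qed auto
      finally show ?thesis .
    qed
    then have "sqrt_exp_transform (prod2 A B) (x, y) = ennreal (exp (- (g + h)))"
      using g(1) h(1) by (intro sqrt_exp_transform_threshold) auto
    moreover have "sqrt_exp_transform A x = ennreal (exp (-g))" by (rule sqrt_exp_transform_threshold[OF g])
    moreover have "sqrt_exp_transform B y = ennreal (exp (-h))" by (rule sqrt_exp_transform_threshold[OF h])
    ultimately show ?thesis by (simp add: ennreal_mult[symmetric] exp_add[symmetric])
  next
    case False
    have e: "sqrt_exp_transform A x = 0" if "\<not> (\<exists>s\<ge>0. x \<in> (*\<^sub>R) (sqrt s) ` A)" for A :: "'c::euclidean_space set" and x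
    proof -
      have "{r. 0 \<le> r \<and> x \<in> (*\<^sub>R) (sqrt r) ` A} = {}" using that by auto
      then show ?thesis by (simp add: sqrt_exp_transform_def)
    qed
    have "\<not> (\<exists>r\<ge>0. (x, y) \<in> (*\<^sub>R) (sqrt r) ` prod2 A B)" using False mem by blast
    then have "sqrt_exp_transform (prod2 A B) (x, y) = 0" by (rule e)
    moreover have "sqrt_exp_transform A x = 0 \<or> sqrt_exp_transform B y = 0" using False e[of x A] e[of y B] by blast
    ultimately show ?thesis by auto
  qed
qed

lemma sqrt_exp_transform_measurable:
  assumes "compact A" shows "sqrt_exp_transform A \<in> borel_measurable lborel"
proof -
  define G where "G = {(r, x). 0 \<le> r \<and> x \<in> (*\<^sub>R) (sqrt r) ` A}"
  have [measurable]: "G \<in> sets (lborel \<Otimes>\<^sub>M lborel)" unfolding G_def by (rule dilation_graph_borel[OF assms])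
  have "(\<lambda>x. \<integral>\<^sup>+r. (\<lambda>(x, r). ennreal (exp (-r)) * indicator G (r, x)) (x, r) \<partial>lborel) \<in> borel_measurable lborel"
    by (rule lborel.borel_measurable_nn_integral_fst) measurable
  moreover have "sqrt_exp_transform A = (\<lambda>x. \<integral>\<^sup>+r. (\<lambda>(x, r). ennreal (exp (-r)) * indicator G (r, x)) (x, r) \<partial>lborel)"
    unfolding sqrt_exp_transform_def[abs_def] by (intro ext nn_integral_cong) (auto simp: G_def split: split_indicator)
  ultimately show ?thesis by simp
qed

text \<open>Integrate the product rule over both factors. On the volume side this is what singles
  out the exponent 2: the normalisation by factorials becomes exactly multiplicative.\<close>

theorem emeasure_prod2:
  fixes A :: "'a::euclidean_space set" and B :: "'b::euclidean_space set"
  assumes A: "compact A" "\<And>a c. a \<in> A \<Longrightarrow> 0 \<le> c \<Longrightarrow> c \<le> 1 \<Longrightarrow> c *\<^sub>R a \<in> A"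
    and B: "compact B" "\<And>b c. b \<in> B \<Longrightarrow> 0 \<le> c \<Longrightarrow> c \<le> 1 \<Longrightarrow> c *\<^sub>R b \<in> B"
    and d: "DIM('a) = 2 * n" "DIM('b) = 2 * m"
  shows "fact (n + m) * emeasure lborel (prod2 A B) = (fact n * emeasure lborel A) * (fact m * emeasure lborel B)"
proof -
  note mA = sqrt_exp_transform_measurable[OF A(1)] and mB = sqrt_exp_transform_measurable[OF B(1)]
  have mP: "sqrt_exp_transform (prod2 A B) \<in> borel_measurable (lborel \<Otimes>\<^sub>M lborel)"
    using sqrt_exp_transform_measurable[OF compact_prod2[OF A(1) B(1)]] by (simp add: lborel_prod)
  have "fact (n + m) * emeasure lborel (prod2 A B) = (\<integral>\<^sup>+z. sqrt_exp_transform (prod2 A B) z \<partial>lborel)"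
    using d by (intro nn_integral_sqrt_exp_transform[symmetric] compact_prod2 A(1) B(1)) simp
  also have "\<dots> = (\<integral>\<^sup>+x. (\<integral>\<^sup>+y. sqrt_exp_transform (prod2 A B) (x, y) \<partial>lborel) \<partial>lborel)"
    unfolding lborel.nn_integral_fst[OF mP] lborel_prod ..
  also have "\<dots> = (\<integral>\<^sup>+x. (\<integral>\<^sup>+y. sqrt_exp_transform A x * sqrt_exp_transform B y \<partial>lborel) \<partial>lborel)"
    by (simp only: sqrt_exp_transform_prod2[OF A B])
  also have "\<dots> = (\<integral>\<^sup>+x. sqrt_exp_transform A x * (fact m * emeasure lborel B) \<partial>lborel)"
    unfolding nn_integral_cmult[OF mB] nn_integral_sqrt_exp_transform[OF B(1) d(2)] ..
  also have "\<dots> = (fact n * emeasure lborel A) * (fact m * emeasure lborel B)"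
    unfolding nn_integral_multc[OF mA] nn_integral_sqrt_exp_transform[OF A(1) d(1)] ..
  finally show ?thesis .
qed

subsection \<open>The p-product\<close>

lemma phase_join_zero: "phase_join 0 0 = 0"
  by (simp add: phase_join_def zero_prod_def)

lemma convex_scaled_member:
  assumes "convex K" "0 \<in> K" "x \<in> K" "0 \<le> c" "c \<le> d"
  obtains x' where "x' \<in> K" "c *\<^sub>R x = d *\<^sub>R x'"
proof (cases "d = 0")
  case True
  then show thesis using assms by (intro that[of x]) auto
next
  case False
  then have d: "d > 0" using assms by simp
  have "(c / d) *\<^sub>R x + (1 - c / d) *\<^sub>R 0 \<in> K"
    using assms d by (intro convexD) (auto simp: divide_le_eq)
  then show thesis using d by (intro that[of "(c / d) *\<^sub>R x"]) auto
qed

text \<open>The defining union runs over part of the boundary of the planar ball only. Smaller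
  coefficients can be absorbed into the bodies, which are convex and contain 0; the solid form makes
  compactness and convexity accessible.\<close>

lemma p_product_eq_pball:
  assumes p: "1 \<le> p" and K: "convex K" "0 \<in> K" and T: "convex T" "0 \<in> T"
  shows "p_product p K T = {phase_join (a *\<^sub>R x) (b *\<^sub>R y) | a b x y. (a, b) \<in> pball p \<and> x \<in> K \<and> y \<in> T}"
    (is "_ = ?R")
  using p
proof (cases p rule: ereal_ge_1_cases)
  case 1
  have inf: "p_product \<infinity> K T = {phase_join x y | x y. x \<in> K \<and> y \<in> T}" by (simp add: p_product_def)
  have one: "(1, 1) \<in> pball \<infinity>" by (simp add: mem_pball_infinity)
  have "phase_join (a *\<^sub>R x) (b *\<^sub>R y) \<in> p_product p K T" if xy: "(a, b) \<in> pball \<infinity>" "x \<in> K" "y \<in> T" for a b x y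
  proof -
    have ab: "0 \<le> a" "a \<le> 1" "0 \<le> b" "b \<le> 1" using xy(1) by (auto simp: mem_pball_infinity)
    obtain x' where "x' \<in> K" "a *\<^sub>R x = 1 *\<^sub>R x'" by (rule convex_scaled_member[OF K xy(2) ab(1,2)])
    moreover obtain y' where "y' \<in> T" "b *\<^sub>R y = 1 *\<^sub>R y'" by (rule convex_scaled_member[OF T xy(3) ab(3,4)])
    ultimately have "phase_join (a *\<^sub>R x) (b *\<^sub>R y) = phase_join x' y' \<and> x' \<in> K \<and> y' \<in> T" by simp
    then show ?thesis unfolding 1 inf by blast
  qed
  moreover have "u \<in> ?R" if u: "u \<in> p_product p K T" for u
  proof -
    obtain x y where "u = phase_join x y" "x \<in> K" "y \<in> T" using u unfolding 1 inf by blast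
    then have "u = phase_join (1 *\<^sub>R x) (1 *\<^sub>R y) \<and> (1, 1) \<in> pball p \<and> x \<in> K \<and> y \<in> T" using one 1 by simp
    then show ?thesis by blast
  qed
  ultimately show ?thesis unfolding 1 by blast
next
  case (2 q)
  have pinf: "p \<noteq> \<infinity>" "real_of_ereal p = q" using 2 by auto
  have fin: "p_product p K T = (\<Union>t\<in>{0..1}. {phase_join ((1 - t) powr (1 / q) *\<^sub>R x) (t powr (1 / q) *\<^sub>R y) | x y. x \<in> K \<and> y \<in> T})"
    using pinf by (simp add: p_product_def)
  have mem: "u \<in> p_product p K T \<longleftrightarrow> (\<exists>t x y. 0 \<le> t \<and> t \<le> 1 \<and> x \<in> K \<and> y \<in> T \<and>
      u = phase_join ((1 - t) powr (1 / q) *\<^sub>R x) (t powr (1 / q) *\<^sub>R y))" for u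
    unfolding fin UN_iff mem_Collect_eq Bex_def atLeastAtMost_iff by blast
  have pw: "(s powr (1 / q)) powr q = s" if "0 \<le> s" for s using that 2 by (simp add: powr_powr)
  have wp: "(s powr q) powr (1 / q) = s" if "0 \<le> s" for s using that 2 by (simp add: powr_powr)
  show ?thesis
  proof (intro equalityI subsetI)
    fix u assume "u \<in> p_product p K T"
    then obtain t x y where t: "0 \<le> t" "t \<le> 1" "x \<in> K" "y \<in> T"
      "u = phase_join ((1 - t) powr (1 / q) *\<^sub>R x) (t powr (1 / q) *\<^sub>R y)" unfolding mem by blast
    have "((1 - t) powr (1 / q), t powr (1 / q)) \<in> pball p"
      using t unfolding 2(1) mem_pball_ereal by (simp add: pw)
    with t show "u \<in> ?R" by blast
  next
    fix u assume "u \<in> ?R"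
    then obtain a b x y where u: "u = phase_join (a *\<^sub>R x) (b *\<^sub>R y)" "(a, b) \<in> pball p" "x \<in> K" "y \<in> T" by blast
    have ab: "0 \<le> a" "0 \<le> b" "a powr q + b powr q \<le> 1" using u(2) 2 by (auto simp: mem_pball_ereal)
    \<comment> \<open>Keeps the first coefficient exactly and enlarges the second from
      \<open>b\<close> to \<open>t powr (1 / q)\<close>; the excess is absorbed into
      \<open>y'\<close>.\<close>
    define t where "t = 1 - a powr q"
    have t: "0 \<le> t" "t \<le> 1" "b powr q \<le> t" "1 - t = a powr q"
      using ab powr_ge_zero[of a q] powr_ge_zero[of b q] by (auto simp: t_def simp del: powr_ge_zero)
    have "b \<le> t powr (1 / q)" using powr_mono2[of "1/q" "b powr q" t] t 2 wp[OF ab(2)] by simp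
    then obtain y' where y': "y' \<in> T" "b *\<^sub>R y = t powr (1 / q) *\<^sub>R y'"
      by (rule convex_scaled_member[OF T u(4) ab(2)])
    have "u = phase_join ((1 - t) powr (1 / q) *\<^sub>R x) (t powr (1 / q) *\<^sub>R y')"
      using u(1) y'(2) t(4) wp[OF ab(1)] by simp
    then show "u \<in> p_product p K T" unfolding mem using t(1,2) u(3) y'(1) by blast
  qed
qed

text \<open>In a convex combination the two factors combine separately: each gives a point of its
  body scaled by the combined coefficient, and the pair of coefficients stays in the convex planar
  ball. An interior exists because \<open>(1/2, 1/2)\<close> lies in every p-ball, so the product
  contains half of \<open>K \<times> T\<close>.\<close>

lemma convex_body_p_product:
  fixes K :: "'n::finite phase set" and T :: "'m::finite phase set"
  assumes p: "1 \<le> p" and K: "convex_body K" "0 \<in> K" and T: "convex_body T" "0 \<in> T"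
  shows "convex_body (p_product p K T)"
proof -
  have cK: "compact K" "convex K" "interior K \<noteq> {}" and cT: "compact T" "convex T" "interior T \<noteq> {}"
    using K T by (auto simp: convex_body_def)
  note P = p_product_eq_pball[OF p cK(2) K(2) cT(2) T(2)]
  have "compact (p_product p K T)"
  proof -
    have "continuous_on A (case_prod phase_join)" for A :: "('n phase \<times> 'm phase) set"
      using linear_phase_join by (intro linear_continuous_on) (simp add: linear_conv_bounded_linear)
    then have "compact (case_prod phase_join ` (\<lambda>(z, x, y). (fst z *\<^sub>R x, snd z *\<^sub>R y)) ` (pball p \<times> K \<times> T))"
      using cK cT compact_pball[OF p]
      by (intro compact_continuous_image compact_Times) (auto simp: case_prod_unfold intro!: continuous_intros)
    also have "case_prod phase_join ` (\<lambda>(z, x, y). (fst z *\<^sub>R x, snd z *\<^sub>R y)) ` (pball p \<times> K \<times> T) = p_product p K T"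
      unfolding P by (force simp: image_iff)
    finally show ?thesis .
  qed
  moreover have "convex (p_product p K T)"
  proof (rule convexI)
    fix u v and l m :: real assume uv: "u \<in> p_product p K T" "v \<in> p_product p K T" and lm: "0 \<le> l" "0 \<le> m" "l + m = 1"
    obtain a b x y where u: "u = phase_join (a *\<^sub>R x) (b *\<^sub>R y)" "(a, b) \<in> pball p" "x \<in> K" "y \<in> T" using uv(1) unfolding P by blast
    obtain a' b' x' y' where v: "v = phase_join (a' *\<^sub>R x') (b' *\<^sub>R y')" "(a', b') \<in> pball p" "x' \<in> K" "y' \<in> T" using uv(2) unfolding P by blast
    have comb: "\<exists>z\<in>A. l *\<^sub>R c *\<^sub>R w + m *\<^sub>R c' *\<^sub>R w' = (l * c + m * c') *\<^sub>R z"
      if A: "convex A" "w \<in> A" "w' \<in> A" and c: "0 \<le> c" "0 \<le> c'" for A :: "'c::real_vector set" and w w' c c'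
    proof (cases "l * c + m * c' = 0")
      case True
      then have "l * c = 0" "m * c' = 0" using lm c by (simp_all add: add_nonneg_eq_0_iff)
      then show ?thesis using A(2) True by (intro bexI[of _ w]) auto
    next
      case False
      define s where "s = l * c + m * c'"
      have s: "s > 0" "l * c / s + m * c' / s = 1" using False lm c by (auto simp: s_def add_divide_distrib[symmetric] less_le)
      have "(l * c / s) *\<^sub>R w + (m * c' / s) *\<^sub>R w' \<in> A"
        using s lm c by (intro convexD[OF A]) auto
      moreover have "l *\<^sub>R c *\<^sub>R w + m *\<^sub>R c' *\<^sub>R w' = s *\<^sub>R ((l * c / s) *\<^sub>R w + (m * c' / s) *\<^sub>R w')"
        using s(1) by (simp add: scaleR_add_right)
      ultimately show ?thesis unfolding s_def[symmetric] by blast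
    qed
    have ab: "0 \<le> a" "0 \<le> b" "0 \<le> a'" "0 \<le> b'" using pball_le_1[OF p u(2)] pball_le_1[OF p v(2)] by auto
    obtain x'' where x'': "x'' \<in> K" "l *\<^sub>R a *\<^sub>R x + m *\<^sub>R a' *\<^sub>R x' = (l * a + m * a') *\<^sub>R x''"
      using comb[OF cK(2) u(3) v(3) ab(1,3)] by blast
    obtain y'' where y'': "y'' \<in> T" "l *\<^sub>R b *\<^sub>R y + m *\<^sub>R b' *\<^sub>R y' = (l * b + m * b') *\<^sub>R y''"
      using comb[OF cT(2) u(4) v(4) ab(2,4)] by blast
    have "(l * a + m * a', l * b + m * b') \<in> pball p"
      using convexD[OF convex_pball[OF p] u(2) v(2) lm] by simp
    moreover have "l *\<^sub>R u + m *\<^sub>R v = phase_join ((l * a + m * a') *\<^sub>R x'') ((l * b + m * b') *\<^sub>R y'')"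
      unfolding u(1) v(1) phase_join_simps(2)[symmetric] phase_join_simps(1)[symmetric] x''(2) y''(2) ..
    ultimately show "l *\<^sub>R u + m *\<^sub>R v \<in> p_product p K T" unfolding P using x''(1) y''(1) by blast
  qed
  moreover have "interior (p_product p K T) \<noteq> {}"
  proof -
    define U where "U = case_prod phase_join ` (*\<^sub>R) (1/2) ` (interior K \<times> interior T)"
    have "surj (case_prod (phase_join :: 'n phase \<Rightarrow> 'm phase \<Rightarrow> _))" by (rule bij_is_surj[OF bij_phase_join])
    moreover have "open ((*\<^sub>R) (1/2) ` (interior K \<times> interior T))"
      by (intro open_scaling open_Times) auto
    ultimately have "open U" unfolding U_def
      by (intro open_surjective_linear_image[OF _ linear_phase_join])
    moreover have "U \<subseteq> p_product p K T"
    proof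
      fix u assume "u \<in> U"
      then obtain x y where "x \<in> interior K" "y \<in> interior T" "u = phase_join ((1/2) *\<^sub>R x) ((1/2) *\<^sub>R y)"
        unfolding U_def by auto
      then have "x \<in> K" "y \<in> T" "u = phase_join ((1/2) *\<^sub>R x) ((1/2) *\<^sub>R y)" using interior_subset by auto
      then show "u \<in> p_product p K T" unfolding P using pball_half[OF p] by blast
    qed
    moreover have "U \<noteq> {}" unfolding U_def using cK(3) cT(3) by auto
    ultimately show ?thesis using interior_maximal by blast
  qed
  ultimately show ?thesis by (simp add: convex_body_def)
qed

subsection \<open>Curves in the product\<close>

lemma rot_velocity_linear:
  fixes L :: "'n::finite phase \<Rightarrow> 'm::finite phase"
  assumes x: "rot_velocity x v" and L: "linear L" "\<And>z. L (cstruct z) = cstruct (L z)"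
  shows "rot_velocity (\<lambda>t. L (x t)) (\<lambda>t. L (v t))"
  unfolding rot_velocity_def
proof (intro conjI ballI)
  have bL: "bounded_linear L" using L(1) by (simp add: linear_conv_bounded_linear)
  show "(\<lambda>t. L (v t)) absolutely_integrable_on {0..1}"
    using absolutely_integrable_linear[OF rot_velocity_integrable(1)[OF x, of 0 1] bL] by (simp add: o_def)
  fix t :: real assume t: "t \<in> {0..1}"
  have "L (x t) = L (x 0 + cstruct (integral {0..t} v))" by (simp only: rot_velocity_eq[OF x t, symmetric])
  also have "\<dots> = L (x 0) + cstruct (L (integral {0..t} v))" using L by (simp add: linear_add)
  also have "L (integral {0..t} v) = integral {0..t} (\<lambda>t. L (v t))"
    using integral_linear[OF rot_velocity_integrable(2)[OF x, of 0 t] bL] t by (simp add: o_def)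
  finally show "L (x t) = L (x 0) + cstruct (integral {0..t} (\<lambda>t. L (v t)))" .
qed

lemma rot_velocity_add:
  assumes x: "rot_velocity x v" and y: "rot_velocity y w"
  shows "rot_velocity (\<lambda>t. x t + y t) (\<lambda>t. v t + w t)"
  unfolding rot_velocity_def
proof (intro conjI ballI)
  show "(\<lambda>t. v t + w t) absolutely_integrable_on {0..1}"
    by (rule set_integral_add(1)) (use rot_velocity_integrable(1)[OF x, of 0 1] rot_velocity_integrable(1)[OF y, of 0 1] in auto)
  fix t :: real assume t: "t \<in> {0..1}"
  have "integral {0..t} (\<lambda>t. v t + w t) = integral {0..t} v + integral {0..t} w"
    using rot_velocity_integrable(2)[OF x, of 0 t] rot_velocity_integrable(2)[OF y, of 0 t] t
    by (intro Henstock_Kurzweil_Integration.integral_add) auto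
  note i = this
  have "x t + y t = (x 0 + cstruct (integral {0..t} v)) + (y 0 + cstruct (integral {0..t} w))"
    by (simp only: rot_velocity_eq[OF x t, symmetric] rot_velocity_eq[OF y t, symmetric])
  also have "\<dots> = x 0 + y 0 + cstruct (integral {0..t} (\<lambda>t. v t + w t))" unfolding i by simp
  finally show "x t + y t = x 0 + y 0 + cstruct (integral {0..t} (\<lambda>t. v t + w t))" .
qed

lemma cstruct_phase_join: "cstruct (phase_join z w) = phase_join (cstruct z) (cstruct w)"
  by (simp add: cstruct_def phase_join_def vec_join_def vec_eq_iff split: sum.split)

lemma rot_velocity_phase_join:
  assumes x: "rot_velocity x v" and y: "rot_velocity y w"
  shows "rot_velocity (\<lambda>t. phase_join (x t) (y t)) (\<lambda>t. phase_join (v t) (w t))"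
    "area (\<lambda>t. phase_join (x t) (y t)) (\<lambda>t. phase_join (v t) (w t)) = area x v + area y w"
proof -
  have sum: "phase_join a b = phase_join a 0 + phase_join 0 b" for a b
    using phase_join_simps(1)[of a 0 0 b] by simp
  have L1: "linear (\<lambda>z. phase_join z 0)"
    by (rule linearI) (simp_all add: phase_join_simps(1)[symmetric] phase_join_simps(2)[symmetric])
  have L2: "linear (\<lambda>z. phase_join 0 z)"
    by (rule linearI) (simp_all add: phase_join_simps(1)[symmetric] phase_join_simps(2)[symmetric])
  have "rot_velocity (\<lambda>t. phase_join (x t) 0 + phase_join 0 (y t)) (\<lambda>t. phase_join (v t) 0 + phase_join 0 (w t))"
    by (intro rot_velocity_add rot_velocity_linear[OF x L1] rot_velocity_linear[OF y L2]) (simp_all add: cstruct_phase_join)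
  then show "rot_velocity (\<lambda>t. phase_join (x t) (y t)) (\<lambda>t. phase_join (v t) (w t))"
    by (simp only: sum[symmetric])
  have "(\<lambda>t. x t \<bullet> v t) integrable_on {0..1}" "(\<lambda>t. y t \<bullet> w t) integrable_on {0..1}"
    using absolutely_integrable_inner[OF rot_velocity_continuous[OF x] rot_velocity_integrable(1)[OF x, of 0 1]]
      absolutely_integrable_inner[OF rot_velocity_continuous[OF y] rot_velocity_integrable(1)[OF y, of 0 1]]
    by (auto simp: absolutely_integrable_on_def)
  then show "area (\<lambda>t. phase_join (x t) (y t)) (\<lambda>t. phase_join (v t) (w t)) = area x v + area y w"
    by (simp add: area_def inner_phase_join Henstock_Kurzweil_Integration.integral_add add_divide_distrib)
qed

definition phase_left :: "('n::finite + 'm::finite) phase \<Rightarrow> 'n phase" where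
  "phase_left u = ((\<chi> a. fst u $ Inl a), (\<chi> a. snd u $ Inl a))"

definition phase_right :: "('n::finite + 'm::finite) phase \<Rightarrow> 'm phase" where
  "phase_right u = ((\<chi> b. fst u $ Inr b), (\<chi> b. snd u $ Inr b))"

lemma phase_join_left_right [simp]: "phase_join (phase_left u) (phase_right u) = u"
  by (simp add: phase_join_def phase_left_def phase_right_def vec_join_def vec_eq_iff prod_eq_iff split: sum.split)

lemma rot_velocity_left_right:
  fixes \<gamma> :: "real \<Rightarrow> ('n::finite + 'm::finite) phase"
  assumes "rot_velocity \<gamma> v"
  shows "rot_velocity (\<lambda>t. phase_left (\<gamma> t)) (\<lambda>t. phase_left (v t))"
    "rot_velocity (\<lambda>t. phase_right (\<gamma> t)) (\<lambda>t. phase_right (v t))"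
proof -
  have "linear (phase_left :: ('n + 'm) phase \<Rightarrow> _)" "linear (phase_right :: ('n + 'm) phase \<Rightarrow> _)"
    by (rule linearI; simp add: phase_left_def phase_right_def vec_eq_iff)+
  from rot_velocity_linear[OF assms this(1)] rot_velocity_linear[OF assms this(2)]
  show "rot_velocity (\<lambda>t. phase_left (\<gamma> t)) (\<lambda>t. phase_left (v t))"
    "rot_velocity (\<lambda>t. phase_right (\<gamma> t)) (\<lambda>t. phase_right (v t))"
    by (simp_all add: phase_left_def phase_right_def cstruct_def vec_eq_iff)
qed

subsection \<open>The capacity of the product\<close>

text \<open>A bound at every \<open>t\<close> is what allows two loops to be joined in a common
  parameter: the support function of the product at the joined velocity has to be estimated for each
  \<open>t\<close>, which the two integrals alone do not permit.\<close>

lemma fast_curve: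
  fixes K :: "'n::finite phase set"
  assumes K: "convex_body K" "0 \<in> K" and "\<epsilon> > 0"
  obtains x v where "rot_velocity x v" "x 0 = x 1" "area x v = c_EHZ K"
    "\<And>t. t \<in> {0..1} \<Longrightarrow> support_fun K (v t) \<le> 2 * c_EHZ K + \<epsilon>"
proof -
  have cK: "compact K" using K(1) by (simp add: convex_body_def)
  obtain x v where x: "rot_velocity x v" "x 0 = x 1" "area x v = c_EHZ K"
    "integral {0..1} (\<lambda>t. support_fun K (v t)) = 2 * c_EHZ K"
    using capacity_characterization(2)[OF K(1)] by blast
  obtain y u C where "rot_velocity y u" "y 0 = y 1" "C-lipschitz_on {0..1} y" "area y u = area x v"
    "\<And>t. t \<in> {0..1} \<Longrightarrow> support_fun K (u t) \<le> integral {0..1} (\<lambda>t. support_fun K (v t)) + \<epsilon>"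
    by (rule reparametrize[OF x(1,2) cK K(2) assms(3)]) (rule that)
  then show thesis using x by (intro that[of y u]) auto
qed

text \<open>The test loop with components \<open>a0 *\<^sub>R x\<close> and
  \<open>b0 *\<^sub>R y\<close> has area \<open>r2\<close>. By the supporting line its support
  function is at most \<open>2 * r2\<close> up to a multiple of \<open>\<epsilon>\<close>, and the
  isoperimetric inequality leaves \<open>4 * c * r2 \<le> (2 * r2)\<^sup>2\<close> in the limit,
  with \<open>c\<close> the capacity of the product.\<close>

lemma capacity_p_product_le:
  fixes K :: "'n::finite phase set" and T :: "'m::finite phase set"
  assumes p: "1 \<le> p" and K: "convex_body K" "0 \<in> K" and T: "convex_body T" "0 \<in> T"
    and r2: "0 \<le> a0" "0 \<le> b0" "c_EHZ K * a0\<^sup>2 + c_EHZ T * b0\<^sup>2 = r2" "r2 > 0"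
      "\<And>a b. (a, b) \<in> pball p \<Longrightarrow> c_EHZ K * a0 * a + c_EHZ T * b0 * b \<le> r2"
  shows "c_EHZ (p_product p K T) \<le> r2"
proof -
  have cK: "compact K" "convex K" "K \<noteq> {}" and cT: "compact T" "convex T" "T \<noteq> {}" using K T by (auto simp: convex_body_def)
  note P = p_product_eq_pball[OF p cK(2) K(2) cT(2) T(2)]
  define PK where "PK = p_product p K T"
  have PK: "convex_body PK" unfolding PK_def by (rule convex_body_p_product[OF p K T])
  have cP: "compact PK" "PK \<noteq> {}" using PK by (auto simp: convex_body_def)
  define k where "k = c_EHZ K"
  define \<tau> where "\<tau> = c_EHZ T"
  have *: "4 * c_EHZ PK * r2 \<le> (2 * r2 + \<epsilon> * (a0 + b0))\<^sup>2" if \<epsilon>: "\<epsilon> > 0" for \<epsilon>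
  proof -
    obtain x v where x: "rot_velocity x v" "x 0 = x 1" "area x v = c_EHZ K"
      "\<And>t. t \<in> {0..1} \<Longrightarrow> support_fun K (v t) \<le> 2 * c_EHZ K + \<epsilon>"
      by (rule fast_curve[OF K \<epsilon>]) (rule that)
    obtain y w where y: "rot_velocity y w" "y 0 = y 1" "area y w = c_EHZ T"
      "\<And>t. t \<in> {0..1} \<Longrightarrow> support_fun T (w t) \<le> 2 * c_EHZ T + \<epsilon>"
      by (rule fast_curve[OF T \<epsilon>]) (rule that)
    define z where "z t = phase_join (a0 *\<^sub>R x t) (b0 *\<^sub>R y t)" for t
    define u where "u t = phase_join (a0 *\<^sub>R v t) (b0 *\<^sub>R w t)" for t
    note j = rot_velocity_phase_join[OF rot_velocity_scaleR[OF x(1), of a0] rot_velocity_scaleR[OF y(1), of b0]]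
    have z: "rot_velocity z u" unfolding z_def[abs_def] u_def[abs_def] by (rule j(1))
    have "area z u = r2"
      unfolding z_def[abs_def] u_def[abs_def] j(2) area_scaleR x(3) y(3) using r2(3) by (simp add: mult.commute)
    have sup: "support_fun PK (u t) \<le> 2 * r2 + \<epsilon> * (a0 + b0)" if t: "t \<in> {0..1}" for t
    proof (rule support_fun_le[OF cP(2)])
      fix q assume "q \<in> PK"
      then obtain a b x' y' where q: "q = phase_join (a *\<^sub>R x') (b *\<^sub>R y')" "(a, b) \<in> pball p" "x' \<in> K" "y' \<in> T"
        unfolding PK_def P by blast
      note ab = pball_le_1[OF p q(2)]
      have "v t \<bullet> x' \<le> 2 * k + \<epsilon>" "w t \<bullet> y' \<le> 2 * \<tau> + \<epsilon>"
        using support_fun_ge[OF compact_imp_bounded[OF cK(1)] q(3), of "v t"] x(4)[OF t]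
          support_fun_ge[OF compact_imp_bounded[OF cT(1)] q(4), of "w t"] y(4)[OF t] by (auto simp: k_def \<tau>_def)
      then have m: "(a0 * a) * (v t \<bullet> x') \<le> (a0 * a) * (2 * k + \<epsilon>)" "(b0 * b) * (w t \<bullet> y') \<le> (b0 * b) * (2 * \<tau> + \<epsilon>)"
        using ab r2(1,2) by (intro mult_left_mono; simp)+
      have "u t \<bullet> q = (a0 * a) * (v t \<bullet> x') + (b0 * b) * (w t \<bullet> y')"
        unfolding u_def q(1) inner_phase_join by simp
      also have "\<dots> \<le> (a0 * a) * (2 * k + \<epsilon>) + (b0 * b) * (2 * \<tau> + \<epsilon>)" by (rule add_mono[OF m])
      also have "\<dots> = 2 * (k * a0 * a + \<tau> * b0 * b) + \<epsilon> * (a0 * a + b0 * b)"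
        by (simp add: algebra_simps)
      also have "\<dots> \<le> 2 * r2 + \<epsilon> * (a0 + b0)"
      proof (rule add_mono)
        show "2 * (k * a0 * a + \<tau> * b0 * b) \<le> 2 * r2" using r2(5)[OF q(2)] by (simp add: k_def \<tau>_def)
        show "\<epsilon> * (a0 * a + b0 * b) \<le> \<epsilon> * (a0 + b0)"
          using ab r2(1,2) \<epsilon> by (intro mult_left_mono add_mono mult_left_le) auto
      qed
      finally show "u t \<bullet> q \<le> 2 * r2 + \<epsilon> * (a0 + b0)" .
    qed
    have si: "(\<lambda>t. support_fun PK (u t)) integrable_on {0..1}"
      using absolutely_integrable_support_fun[OF cP rot_velocity_integrable(1)[OF z, of 0 1]]
      by (auto simp: absolutely_integrable_on_def)
    have P0: "0 \<in> PK"
    proof -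
      have "phase_join ((1/2) *\<^sub>R 0) ((1/2) *\<^sub>R 0) \<in> PK" unfolding PK_def P using pball_half[OF p] K(2) T(2) by blast
      then show ?thesis by (simp only: scaleR_zero_right phase_join_zero)
    qed
    have "integral {0..1} (\<lambda>t. support_fun PK (u t)) \<le> integral {0..1} (\<lambda>t::real. 2 * r2 + \<epsilon> * (a0 + b0))"
      by (rule integral_le[OF si _ sup]) auto
    then have "integral {0..1} (\<lambda>t. support_fun PK (u t)) \<le> 2 * r2 + \<epsilon> * (a0 + b0)" by simp
    moreover have "0 \<le> integral {0..1} (\<lambda>t. support_fun PK (u t))"
      by (rule Henstock_Kurzweil_Integration.integral_nonneg[OF si]) (rule support_fun_nonneg[OF compact_imp_bounded[OF cP(1)] P0])
    ultimately have "(integral {0..1} (\<lambda>t. support_fun PK (u t)))\<^sup>2 \<le> (2 * r2 + \<epsilon> * (a0 + b0))\<^sup>2"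
      by (intro power_mono) auto
    moreover have "4 * c_EHZ PK * area z u \<le> (integral {0..1} (\<lambda>t. support_fun PK (u t)))\<^sup>2"
      by (rule capacity_characterization(3)[OF PK z]) (use x(2) y(2) in \<open>simp add: z_def\<close>)
    ultimately show ?thesis using \<open>area z u = r2\<close> by simp
  qed
  have "((\<lambda>\<epsilon>. (2 * r2 + \<epsilon> * (a0 + b0))\<^sup>2) \<longlongrightarrow> (2 * r2 + 0 * (a0 + b0))\<^sup>2) (at_right 0)" by (intro tendsto_intros)
  moreover have "\<forall>\<^sub>F \<epsilon> in at_right 0. 4 * c_EHZ PK * r2 \<le> (2 * r2 + \<epsilon> * (a0 + b0))\<^sup>2"
    by (rule eventually_mono[OF eventually_at_right_real[of 0 1]]) (auto intro: *)
  ultimately have "4 * c_EHZ PK * r2 \<le> (2 * r2 + 0 * (a0 + b0))\<^sup>2" by (rule tendsto_lowerbound) simp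
  then have "(4 * r2) * c_EHZ PK \<le> (4 * r2) * r2" by (simp add: power2_eq_square mult_ac)
  then show ?thesis using r2(4) by (simp add: PK_def)
qed

lemma mem_pball_2: "(a, b) \<in> pball 2 \<longleftrightarrow> 0 \<le> a \<and> 0 \<le> b \<and> a\<^sup>2 + b\<^sup>2 \<le> 1"
proof -
  have e: "pball 2 = pball (ereal 2)" by simp
  have "(a, b) \<in> pball (ereal 2) \<longleftrightarrow> 0 \<le> a \<and> 0 \<le> b \<and> a powr 2 + b powr 2 \<le> 1" by (rule mem_pball_ereal)
  also have "\<dots> \<longleftrightarrow> 0 \<le> a \<and> 0 \<le> b \<and> a\<^sup>2 + b\<^sup>2 \<le> 1" by auto
  finally show ?thesis by (simp only: e)
qed

text \<open>Splits a minimal loop of the product into its two projections. Their areas add up to the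
  capacity, and the squares of their support lengths add up to at most the square of its length. As
  the capacities of the factors agree, both isoperimetric inequalities carry the same constant and
  can be added.\<close>

lemma capacity_2_product_ge:
  fixes K :: "'n::finite phase set" and T :: "'m::finite phase set"
  assumes K: "convex_body K" "0 \<in> K" and T: "convex_body T" "0 \<in> T" and eq: "c_EHZ K = c_EHZ T"
  shows "c_EHZ K \<le> c_EHZ (p_product 2 K T)"
proof -
  have p: "1 \<le> (2 :: ereal)" by simp
  have cK: "compact K" "convex K" "K \<noteq> {}" and cT: "compact T" "convex T" "T \<noteq> {}" using K T by (auto simp: convex_body_def)
  note P = p_product_eq_pball[OF p cK(2) K(2) cT(2) T(2)]
  define PK where "PK = p_product 2 K T"
  have PK: "convex_body PK" unfolding PK_def by (rule convex_body_p_product[OF p K T])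
  have cP: "compact PK" "PK \<noteq> {}" using PK by (auto simp: convex_body_def)
  have c: "c_EHZ PK > 0" by (rule capacity_characterization(1)[OF PK])
  obtain z u where z: "rot_velocity z u" "z 0 = z 1" "area z u = c_EHZ PK"
    "integral {0..1} (\<lambda>t. support_fun PK (u t)) = 2 * c_EHZ PK"
    using capacity_characterization(2)[OF PK] by blast
  define x where "x t = phase_left (z t)" for t
  define v where "v t = phase_left (u t)" for t
  define y where "y t = phase_right (z t)" for t
  define w where "w t = phase_right (u t)" for t
  have x: "rot_velocity x v" "x 0 = x 1" and y: "rot_velocity y w" "y 0 = y 1"
    using rot_velocity_left_right[OF z(1)] z(2) by (auto simp: x_def[abs_def] v_def[abs_def] y_def[abs_def] w_def[abs_def])
  have zj: "z = (\<lambda>t. phase_join (x t) (y t))" "u = (\<lambda>t. phase_join (v t) (w t))" by (auto simp: x_def v_def y_def w_def)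
  have ar: "area x v + area y w = c_EHZ PK" using rot_velocity_phase_join(2)[OF x(1) y(1)] z(3) unfolding zj by simp
  define LK where "LK = integral {0..1} (\<lambda>t. support_fun K (v t))"
  define LT where "LT = integral {0..1} (\<lambda>t. support_fun T (w t))"
  have iK: "(\<lambda>t. support_fun K (v t)) integrable_on {0..1}" and iT: "(\<lambda>t. support_fun T (w t)) integrable_on {0..1}"
    and iP: "(\<lambda>t. support_fun PK (u t)) integrable_on {0..1}"
    using absolutely_integrable_support_fun[OF cK(1,3) rot_velocity_integrable(1)[OF x(1), of 0 1]]
      absolutely_integrable_support_fun[OF cT(1,3) rot_velocity_integrable(1)[OF y(1), of 0 1]]
      absolutely_integrable_support_fun[OF cP rot_velocity_integrable(1)[OF z(1), of 0 1]]
    by (auto simp: absolutely_integrable_on_def)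
  have L0: "LK \<ge> 0" "LT \<ge> 0" unfolding LK_def LT_def
    by (intro Henstock_Kurzweil_Integration.integral_nonneg iK iT support_fun_nonneg compact_imp_bounded cK cT K T)+
  \<comment> \<open>The integral Minkowski inequality by duality: a fixed \<open>(a, b)\<close> in
    the quarter disc is integrated first, and afterwards the unit vector in direction
    \<open>(LK, LT)\<close> is inserted.\<close>
  have lin: "a * LK + b * LT \<le> 2 * c_EHZ PK" if ab: "(a, b) \<in> pball 2" for a b
  proof -
    have "((\<lambda>t. a * support_fun K (v t) + b * support_fun T (w t)) has_integral a * LK + b * LT) {0..1}"
      unfolding LK_def LT_def by (intro has_integral_add has_integral_mult_right integrable_integral iK iT)
    moreover have "a * support_fun K (v t) + b * support_fun T (w t) \<le> support_fun PK (u t)" for t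
    proof -
      obtain x' where x': "x' \<in> K" "support_fun K (v t) = v t \<bullet> x'" by (rule support_fun_attained[OF cK(1,3)])
      obtain y' where y': "y' \<in> T" "support_fun T (w t) = w t \<bullet> y'" by (rule support_fun_attained[OF cT(1,3)])
      have "phase_join (a *\<^sub>R x') (b *\<^sub>R y') \<in> PK" unfolding PK_def P using ab x' y' by blast
      from support_fun_ge[OF compact_imp_bounded[OF cP(1)] this, of "u t"]
      show ?thesis unfolding zj(2) inner_phase_join x'(2) y'(2) by simp
    qed
    ultimately have "a * LK + b * LT \<le> integral {0..1} (\<lambda>t. support_fun PK (u t))"
      by (intro has_integral_le[OF _ integrable_integral[OF iP]]) auto
    then show ?thesis using z(4) by simp
  qed
  have "LK\<^sup>2 + LT\<^sup>2 \<le> (2 * c_EHZ PK)\<^sup>2"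
  proof (cases "LK\<^sup>2 + LT\<^sup>2 = 0")
    case False
    define N where "N = sqrt (LK\<^sup>2 + LT\<^sup>2)"
    have N: "N > 0" "N\<^sup>2 = LK\<^sup>2 + LT\<^sup>2" using False by (auto simp: N_def add_nonneg_eq_0_iff sum_power2_gt_zero_iff)
    have "(LK / N, LT / N) \<in> pball 2"
      unfolding mem_pball_2 using N L0 by (simp add: power_divide add_divide_distrib[symmetric])
    from lin[OF this] have "(LK\<^sup>2 + LT\<^sup>2) / N \<le> 2 * c_EHZ PK" by (simp add: power2_eq_square add_divide_distrib)
    moreover have "(LK\<^sup>2 + LT\<^sup>2) / N = N" using N(1) unfolding N(2)[symmetric] by (simp add: power2_eq_square)
    ultimately have "N \<le> 2 * c_EHZ PK" by simp
    then have "N\<^sup>2 \<le> (2 * c_EHZ PK)\<^sup>2" using N(1) by (intro power_mono) auto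
    then show ?thesis using N(2) by simp
  qed simp
  moreover have "4 * c_EHZ K * area x v \<le> LK\<^sup>2" unfolding LK_def by (rule capacity_characterization(3)[OF K(1) x])
  moreover have "4 * c_EHZ K * area y w \<le> LT\<^sup>2" unfolding LT_def eq by (rule capacity_characterization(3)[OF T(1) y])
  moreover have "4 * c_EHZ K * c_EHZ PK = 4 * c_EHZ K * area x v + 4 * c_EHZ K * area y w"
    unfolding ar[symmetric] by (simp add: distrib_left)
  ultimately have "4 * c_EHZ K * c_EHZ PK \<le> (2 * c_EHZ PK)\<^sup>2" by linarith
  then have "(4 * c_EHZ PK) * c_EHZ K \<le> (4 * c_EHZ PK) * c_EHZ PK" by (simp add: power2_eq_square mult_ac)
  then show ?thesis using c by (simp add: PK_def)
qed

subsection \<open>Comparison of volumes\<close>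

text \<open>A point of \<open>A\<close> off the closed set \<open>B\<close> is a limit of interior
  points of \<open>A\<close>, so a nonempty open part of \<open>A\<close> misses
  \<open>B\<close>.\<close>

lemma measure_strict_mono_convex:
  fixes A B :: "'a::euclidean_space set"
  assumes A: "compact A" "convex A" "interior A \<noteq> {}" and B: "compact B" "B \<subseteq> A" and z: "z \<in> A" "z \<notin> B"
  shows "measure lebesgue B < measure lebesgue A"
proof -
  have "z \<in> closure (interior A)" using convex_closure_interior[OF A(2,3)] z(1) closure_subset by blast
  moreover have "open (- B)" using compact_imp_closed[OF B(1)] by (simp add: open_Compl)
  ultimately have "interior A \<inter> - B \<noteq> {}" using z(2) by (metis ComplI closure_iff_nhds_not_empty subset_refl inf_commute)
  moreover define U where "U = interior A \<inter> - B"
  ultimately have U: "open U" "U \<noteq> {}" "U \<subseteq> A" "U \<inter> B = {}" using \<open>open (- B)\<close> interior_subset by auto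
  have m: "A \<in> lmeasurable" "B \<in> lmeasurable" "U \<in> lmeasurable"
  proof -
    show "A \<in> lmeasurable" "B \<in> lmeasurable" using A(1) B(1) by (auto intro: lmeasurable_compact)
    show "U \<in> lmeasurable"
      by (rule lmeasurable_open[OF bounded_subset[OF compact_imp_bounded[OF A(1)] U(3)] U(1)])
  qed
  have "measure lebesgue U \<noteq> 0"
    using open_not_negligible[OF U(1,2)] m(3) by (auto simp: negligible_iff_measure)
  then have "measure lebesgue U > 0" by (simp add: less_le)
  then have "measure lebesgue B < measure lebesgue B + measure lebesgue U" by simp
  also have "\<dots> = measure lebesgue (B \<union> U)" using measure_Un_AE[of B U lebesgue] U(4) m
    by (subst measure_Un3) (auto simp: Int_commute)
  also have "\<dots> \<le> measure lebesgue A" using m U B by (intro measure_mono_fmeasurable) (auto simp: fmeasurableD)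
  finally show ?thesis .
qed

text \<open>The volume formula in real numbers; \<open>(\<alpha>\<^sup>2) ^ CARD('n)\<close> is the
  Jacobian of scaling by \<open>\<alpha>\<close> in dimension \<open>2 * CARD('n)\<close>.\<close>

lemma measure_prod2_scaled:
  fixes K :: "'n::finite phase set" and T :: "'m::finite phase set"
  assumes K: "compact K" "convex K" "0 \<in> K" and T: "compact T" "convex T" "0 \<in> T" and "0 \<le> \<alpha>" "0 \<le> \<beta>"
  shows "compact (case_prod phase_join ` prod2 ((*\<^sub>R) \<alpha> ` K) ((*\<^sub>R) \<beta> ` T))"
    "fact (CARD('n) + CARD('m)) * measure lebesgue (case_prod phase_join ` prod2 ((*\<^sub>R) \<alpha> ` K) ((*\<^sub>R) \<beta> ` T))
      = (fact CARD('n) * ((\<alpha>\<^sup>2) ^ CARD('n) * measure lebesgue K)) * (fact CARD('m) * ((\<beta>\<^sup>2) ^ CARD('m) * measure lebesgue T))"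
proof -
  define A where "A = (*\<^sub>R) \<alpha> ` K"
  define B where "B = (*\<^sub>R) \<beta> ` T"
  have A: "compact A" "convex A" "0 \<in> A" and B: "compact B" "convex B" "0 \<in> B"
    unfolding A_def B_def using K T by (auto intro: compact_scaling convex_scaling image_eqI[of _ _ 0])
  have star: "c *\<^sub>R a \<in> S" if S: "convex S" "0 \<in> S" "a \<in> S" and c: "0 \<le> c" "c \<le> 1" for S :: "'c::real_vector set" and a c
    using convexD[OF S(1) S(3,2), of c "1 - c"] c by simp
  note cP = compact_prod2[OF A(1) B(1)]
  show comp: "compact (case_prod phase_join ` prod2 A B)"
    using linear_phase_join by (intro compact_continuous_image cP linear_continuous_on) (simp add: linear_conv_bounded_linear)
  have fin: "emeasure lborel S = ennreal (measure lebesgue S)" if "compact S" for S :: "'c::euclidean_space set"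
  proof -
    have "emeasure lborel S = ennreal (measure lborel S)"
      using emeasure_compact_finite[OF that] by (simp add: emeasure_eq_ennreal_measure less_top)
    then show ?thesis using borel_compact[OF that] by (simp add: measure_completion)
  qed
  have "fact (CARD('n) + CARD('m)) * emeasure lborel (prod2 A B) = (fact CARD('n) * emeasure lborel A) * (fact CARD('m) * emeasure lborel B)"
    by (rule emeasure_prod2[OF A(1) star[OF A(2,3)] B(1) star[OF B(2,3)]]) auto
  moreover have "emeasure lborel (prod2 A B) = emeasure lborel (case_prod phase_join ` prod2 A B)"
    using emeasure_phase_join_image[OF borel_compact[OF cP]] by simp
  moreover have f: "(fact i :: ennreal) = ennreal (fact i)" for i
    by (metis ennreal_of_nat_eq_real_of_nat of_nat_fact)
  ultimately have "ennreal (fact (CARD('n) + CARD('m)) * measure lebesgue (case_prod phase_join ` prod2 A B))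
      = ennreal ((fact CARD('n) * measure lebesgue A) * (fact CARD('m) * measure lebesgue B))"
    by (simp add: fin[OF comp] fin[OF A(1)] fin[OF B(1)] f ennreal_mult)
  then have "fact (CARD('n) + CARD('m)) * measure lebesgue (case_prod phase_join ` prod2 A B)
      = (fact CARD('n) * measure lebesgue A) * (fact CARD('m) * measure lebesgue B)"
    by (subst (asm) ennreal_inj) auto
  moreover have pow2: "(c\<^sup>2) ^ i = c ^ (i + i)" for c :: real and i
    by (simp add: power_mult[symmetric] mult_2)
  moreover have "measure lebesgue A = (\<alpha>\<^sup>2) ^ CARD('n) * measure lebesgue K"
    using measure_lebesgue_affine[of \<alpha> 0 K] \<open>0 \<le> \<alpha>\<close> by (simp add: A_def pow2)
  moreover have "measure lebesgue B = (\<beta>\<^sup>2) ^ CARD('m) * measure lebesgue T"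
    using measure_lebesgue_affine[of \<beta> 0 T] \<open>0 \<le> \<beta>\<close> by (simp add: B_def pow2)
  ultimately show "fact (CARD('n) + CARD('m)) * measure lebesgue (case_prod phase_join ` prod2 A B)
      = (fact CARD('n) * ((\<alpha>\<^sup>2) ^ CARD('n) * measure lebesgue K)) * (fact CARD('m) * ((\<beta>\<^sup>2) ^ CARD('m) * measure lebesgue T))"
    by simp
qed

lemma convex_body_measure_pos: "convex_body K \<Longrightarrow> measure lebesgue (K :: 'a::euclidean_space set) > 0"
  using measure_strict_mono_convex[of K "{}"] interior_subset unfolding convex_body_def by fastforce

lemma sys_ratio_power:
  fixes K :: "'n::finite phase set"
  assumes "convex_body K"
  shows "sys_ratio K ^ CARD('n) = c_EHZ K ^ CARD('n) / (fact CARD('n) * measure lebesgue K)"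
  using convex_body_measure_pos[OF assms] by (simp add: sys_ratio_def power_divide)

theorem theorem1p2:
  fixes K :: "'n::finite phase set" and T :: "'m::finite phase set" and p :: ereal
  assumes "convex_body K" and "convex_body T" and "0 \<in> K" and "0 \<in> T" and "1 \<le> p"
  shows "sys_ratio (p_product p K T) ^ (CARD('n) + CARD('m))
           \<le> sys_ratio K ^ CARD('n) * sys_ratio T ^ CARD('m) \<and>
         (sys_ratio (p_product p K T) ^ (CARD('n) + CARD('m))
           = sys_ratio K ^ CARD('n) * sys_ratio T ^ CARD('m)
          \<longleftrightarrow> c_EHZ K = c_EHZ T \<and> p = 2)"
proof -
  define n where "n = CARD('n)"
  define m where "m = CARD('m)"
  define k where "k = c_EHZ K"
  define \<tau> where "\<tau> = c_EHZ T"
  define VK where "VK = fact n * measure lebesgue K"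
  define VT where "VT = fact m * measure lebesgue T"
  define P where "P = p_product p K T"
  have K: "compact K" "convex K" "interior K \<noteq> {}" and T: "compact T" "convex T" "interior T \<noteq> {}"
    using assms(1,2) by (auto simp: convex_body_def)
  have k: "k > 0" "\<tau> > 0" using capacity_characterization(1) assms(1,2) by (auto simp: k_def \<tau>_def)
  have V: "VK > 0" "VT > 0" using convex_body_measure_pos[OF assms(1)] convex_body_measure_pos[OF assms(2)] by (auto simp: VK_def VT_def)
  have Pb: "convex_body P" unfolding P_def by (rule convex_body_p_product[OF assms(5,1,3,2,4)])
  then have P: "compact P" "convex P" "interior P \<noteq> {}" by (auto simp: convex_body_def)
  note Peq = p_product_eq_pball[OF assms(5) K(2) assms(3) T(2) assms(4), folded P_def]
  have cP: "c_EHZ P > 0" by (rule capacity_characterization(1)[OF Pb])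
  define VP where "VP = fact (n + m) * measure lebesgue P"
  have VP: "VP > 0" using convex_body_measure_pos[OF Pb] by (simp add: VP_def)
  have lhs: "sys_ratio P ^ (n + m) = c_EHZ P ^ (n + m) / VP"
    using sys_ratio_power[OF Pb] by (simp add: n_def m_def VP_def)
  have rhs: "sys_ratio K ^ n * sys_ratio T ^ m = k ^ n * \<tau> ^ m / (VK * VT)"
    using sys_ratio_power[OF assms(1)] sys_ratio_power[OF assms(2)] by (simp add: n_def m_def k_def \<tau>_def VK_def VT_def)
  obtain r2 a0 b0 where r2: "r2 > 0" "0 \<le> a0" "0 \<le> b0" "k * a0\<^sup>2 + \<tau> * b0\<^sup>2 = r2"
    "\<And>a b. (a, b) \<in> pball p \<Longrightarrow> k * a0 * a + \<tau> * b0 * b \<le> r2"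
    "\<And>a b. 0 \<le> a \<Longrightarrow> 0 \<le> b \<Longrightarrow> k * a\<^sup>2 + \<tau> * b\<^sup>2 \<le> r2 \<Longrightarrow> (a, b) \<in> pball p"
    "\<not> (p = 2 \<and> k = \<tau>) \<Longrightarrow> \<exists>a b. (a, b) \<in> pball p \<and> k * a\<^sup>2 + \<tau> * b\<^sup>2 > r2"
    by (rule pball_inscribed_ellipse[OF k assms(5)]) (rule that)
  have cle: "c_EHZ P \<le> r2"
    unfolding P_def by (rule capacity_p_product_le[OF assms(5,1,3,2,4) r2(2,3) _ r2(1)]) (use r2(4,5) in \<open>auto simp: k_def \<tau>_def\<close>)
  \<comment> \<open>The semi-axes of the inscribed ellipse. Accordingly \<open>C\<close> consists of
    the points with scale factors \<open>(a * \<alpha>, b * \<beta>)\<close> in the ellipse.\<close>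
  define \<alpha> where "\<alpha> = sqrt (r2 / k)"
  define \<beta> where "\<beta> = sqrt (r2 / \<tau>)"
  have \<alpha>: "\<alpha> > 0" "k * \<alpha>\<^sup>2 = r2" "\<beta> > 0" "\<tau> * \<beta>\<^sup>2 = r2" using k r2(1) by (auto simp: \<alpha>_def \<beta>_def)
  define C where "C = case_prod phase_join ` prod2 ((*\<^sub>R) \<alpha> ` K) ((*\<^sub>R) \<beta> ` T)"
  have Ccomp: "compact C" and CV: "fact (n + m) * measure lebesgue C = (\<alpha>\<^sup>2) ^ n * (\<beta>\<^sup>2) ^ m * (VK * VT)"
    using measure_prod2_scaled[OF K(1,2) assms(3) T(1,2) assms(4), of \<alpha> \<beta>] \<alpha>
    by (auto simp: C_def n_def m_def VK_def VT_def)
  have Cmem: "\<exists>a b x y. u = phase_join ((a * \<alpha>) *\<^sub>R x) ((b * \<beta>) *\<^sub>R y) \<and> 0 \<le> a \<and> 0 \<le> b \<and> a\<^sup>2 + b\<^sup>2 \<le> 1 \<and> x \<in> K \<and> y \<in> T"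
    if u: "u \<in> C" for u
  proof -
    obtain z where z: "z \<in> prod2 ((*\<^sub>R) \<alpha> ` K) ((*\<^sub>R) \<beta> ` T)" "u = case_prod phase_join z"
      using u unfolding C_def by blast
    then obtain a b x' y' where w: "z = (a *\<^sub>R x', b *\<^sub>R y')" "0 \<le> a" "0 \<le> b" "a\<^sup>2 + b\<^sup>2 \<le> 1"
      "x' \<in> (*\<^sub>R) \<alpha> ` K" "y' \<in> (*\<^sub>R) \<beta> ` T" unfolding prod2_def by blast
    then obtain x y where "x' = \<alpha> *\<^sub>R x" "y' = \<beta> *\<^sub>R y" "x \<in> K" "y \<in> T" by blast
    moreover from this have "u = phase_join ((a * \<alpha>) *\<^sub>R x) ((b * \<beta>) *\<^sub>R y)" using w(1) z(2) by simp
    ultimately show ?thesis using w(2-4) by blast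
  qed
  have ell: "k * (a * \<alpha>)\<^sup>2 + \<tau> * (b * \<beta>)\<^sup>2 = r2 * (a\<^sup>2 + b\<^sup>2)" for a b
  proof -
    have "k * (a * \<alpha>)\<^sup>2 + \<tau> * (b * \<beta>)\<^sup>2 = (k * \<alpha>\<^sup>2) * a\<^sup>2 + (\<tau> * \<beta>\<^sup>2) * b\<^sup>2" by (simp add: power_mult_distrib mult_ac)
    then show ?thesis unfolding \<alpha> by (simp add: distrib_left)
  qed
  have ell': "k * (a * \<alpha>)\<^sup>2 + \<tau> * (b * \<beta>)\<^sup>2 \<le> r2" if "a\<^sup>2 + b\<^sup>2 \<le> 1" for a b
    using mult_left_mono[OF that, of r2] r2(1) by (simp add: ell)
  have CP: "C \<subseteq> P"
  proof
    fix u assume "u \<in> C"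
    then obtain a b x y where u: "u = phase_join ((a * \<alpha>) *\<^sub>R x) ((b * \<beta>) *\<^sub>R y)" "0 \<le> a" "0 \<le> b" "a\<^sup>2 + b\<^sup>2 \<le> 1" "x \<in> K" "y \<in> T"
      using Cmem by blast
    have "(a * \<alpha>, b * \<beta>) \<in> pball p" by (rule r2(6)) (use u \<alpha> ell' in auto)
    then show "u \<in> P" unfolding Peq using u by blast
  qed
  have VCP: "fact (n + m) * measure lebesgue C \<le> VP"
    using CP Ccomp P(1) unfolding VP_def
    by (intro mult_left_mono measure_mono_fmeasurable) (auto intro: lmeasurable_compact fmeasurableD)
  have VC: "fact (n + m) * measure lebesgue C = r2 ^ (n + m) * (VK * VT) / (k ^ n * \<tau> ^ m)"
  proof -
    have "\<alpha>\<^sup>2 = r2 / k" "\<beta>\<^sup>2 = r2 / \<tau>" using \<alpha> k by (auto simp: field_simps)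
    then show ?thesis unfolding CV by (simp add: power_divide power_add)
  qed
  define VC' where "VC' = fact (n + m) * measure lebesgue C"
  have VC'0: "VC' > 0" unfolding VC'_def VC using r2(1) V k by simp
  \<comment> \<open>The weights \<open>k\<close> and \<open>\<tau>\<close> cancel against the
    scaling factors \<open>\<alpha>\<^sup>2 = r2 / k\<close> and
    \<open>\<beta>\<^sup>2 = r2 / \<tau>\<close>. The right-hand side has become the systolic
    expression of \<open>C\<close> with \<open>r2\<close> as capacity, so it remains to compare
    \<open>c_EHZ P\<close> with \<open>r2\<close> and the two volumes.\<close>
  have rhs': "sys_ratio K ^ n * sys_ratio T ^ m = r2 ^ (n + m) / VC'"
    unfolding rhs VC'_def VC using r2(1) V k by simp
  have num: "c_EHZ P ^ (n + m) \<le> r2 ^ (n + m)" using cle cP by (intro power_mono) auto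
  have le: "sys_ratio P ^ (n + m) \<le> sys_ratio K ^ n * sys_ratio T ^ m"
    unfolding lhs rhs' using num VCP VC'0 r2(1) by (intro frac_le) (auto simp: VC'_def)
  have strict: "sys_ratio P ^ (n + m) < sys_ratio K ^ n * sys_ratio T ^ m" if ne: "\<not> (p = 2 \<and> k = \<tau>)"
  proof -
    obtain a b where ab: "(a, b) \<in> pball p" "k * a\<^sup>2 + \<tau> * b\<^sup>2 > r2" using r2(7)[OF ne] by blast
    have ab0: "0 \<le> a" "0 \<le> b" using pball_le_1[OF assms(5) ab(1)] by auto
    \<comment> \<open>A point of maximal norm tests the scale factors: if
      \<open>a *\<^sub>R x\<close> is also a nonnegative multiple of some \<open>x'\<close> in
      \<open>K\<close>, that multiple is at least \<open>a\<close>. So scale factors outside the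
      ellipse, applied to such points, lead outside \<open>C\<close>.\<close>
    have far: "\<exists>x\<in>A. x \<noteq> 0 \<and> (\<forall>x'\<in>A. norm x' \<le> norm x)" if A: "compact A" "interior A \<noteq> {}" for A :: "'c::euclidean_space set"
    proof -
      have "A \<noteq> {}" using A(2) interior_subset by blast
      then obtain x where x: "x \<in> A" "\<And>x'. x' \<in> A \<Longrightarrow> norm x' \<le> norm x"
        using continuous_attains_sup[OF A(1), of norm] by (auto intro: continuous_intros)
      have "x \<noteq> 0"
      proof
        assume "x = 0"
        then have "A \<subseteq> {0}" using x(2) by force
        then have "interior A \<subseteq> interior {0}" by (rule interior_mono)
        then show False using A(2) by simp
      qed
      with x show ?thesis by blast
    qed
    obtain x where x: "x \<in> K" "x \<noteq> 0" "\<And>x'. x' \<in> K \<Longrightarrow> norm x' \<le> norm x" using far[OF K(1,3)] by blast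
    obtain y where y: "y \<in> T" "y \<noteq> 0" "\<And>y'. y' \<in> T \<Longrightarrow> norm y' \<le> norm y" using far[OF T(1,3)] by blast
    have ge: "s \<le> t" if "s *\<^sub>R v = t *\<^sub>R v'" "norm v' \<le> norm v" "v \<noteq> 0" "0 \<le> s" "0 \<le> t"
      for s t :: real and v v' :: "'c::real_normed_vector"
    proof -
      have "s * norm v = t * norm v'" using arg_cong[OF that(1), of norm] that(4,5) by simp
      also have "\<dots> \<le> t * norm v" using that by (intro mult_left_mono)
      finally show ?thesis using that(3) by simp
    qed
    define z where "z = phase_join (a *\<^sub>R x) (b *\<^sub>R y)"
    have "z \<in> P" unfolding Peq z_def using ab(1) x(1) y(1) by blast
    moreover have "z \<notin> C"
    proof
      assume "z \<in> C"
      then obtain s t x' y' where u: "z = phase_join ((s * \<alpha>) *\<^sub>R x') ((t * \<beta>) *\<^sub>R y')" "0 \<le> s" "0 \<le> t" "s\<^sup>2 + t\<^sup>2 \<le> 1" "x' \<in> K" "y' \<in> T"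
        using Cmem by blast
      have "(a *\<^sub>R x, b *\<^sub>R y) = ((s * \<alpha>) *\<^sub>R x', (t * \<beta>) *\<^sub>R y')"
        using bij_is_inj[OF bij_phase_join] u(1) unfolding z_def inj_def by (metis (mono_tags, lifting) case_prod_conv)
      then have "a \<le> s * \<alpha>" "b \<le> t * \<beta>"
        using ge[of a x "s * \<alpha>" x'] ge[of b y "t * \<beta>" y'] x y u ab0 \<alpha> by auto
      then have "k * a\<^sup>2 + \<tau> * b\<^sup>2 \<le> k * (s * \<alpha>)\<^sup>2 + \<tau> * (t * \<beta>)\<^sup>2"
        using k ab0 by (intro add_mono mult_left_mono power_mono) auto
      also have "\<dots> \<le> r2" by (rule ell'[OF u(4)])
      finally show False using ab(2) by simp
    qed
    ultimately have "measure lebesgue C < measure lebesgue P"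
      by (rule measure_strict_mono_convex[OF P Ccomp CP])
    then have "VC' < VP" by (simp add: VC'_def VP_def)
    have "sys_ratio P ^ (n + m) \<le> r2 ^ (n + m) / VP" unfolding lhs using num VP by (simp add: divide_right_mono)
    also have "\<dots> < r2 ^ (n + m) / VC'" using \<open>VC' < VP\<close> VC'0 r2(1) by (intro divide_strict_left_mono) auto
    finally show ?thesis unfolding rhs' .
  qed
  \<comment> \<open>For \<open>p = 2\<close> the contact point of the ellipse lies in the disc, so
    \<open>r2 \<le> k\<close>. Together with \<open>k \<le> c_EHZ P \<le> r2\<close> all three
    numbers agree, both scalings are 1, and \<open>C\<close> is the product itself.\<close>
  have eq: "sys_ratio P ^ (n + m) = sys_ratio K ^ n * sys_ratio T ^ m" if e: "k = \<tau>" "p = 2"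
  proof -
    have kc: "k \<le> c_EHZ P"
      unfolding P_def k_def e(2) by (rule capacity_2_product_ge[OF assms(1,3,2,4)]) (use e in \<open>simp add: k_def \<tau>_def\<close>)
    have "(a0, b0) \<in> pball p" by (rule r2(6)) (use r2 in auto)
    then have "a0\<^sup>2 + b0\<^sup>2 \<le> 1" unfolding e(2) mem_pball_2 by simp
    then have "k * (a0\<^sup>2 + b0\<^sup>2) \<le> k * 1" using k by (intro mult_left_mono) auto
    then have "r2 \<le> k" using r2(4) e by (simp add: distrib_left)
    then have c: "c_EHZ P = r2" "r2 = k" using kc cle by auto
    have "\<alpha> = 1" "\<beta> = 1" using c(2) e k by (auto simp: \<alpha>_def \<beta>_def)
    have "P \<subseteq> C"
    proof
      fix u assume "u \<in> P"
      then obtain a b x y where u: "u = phase_join (a *\<^sub>R x) (b *\<^sub>R y)" "(a, b) \<in> pball p" "x \<in> K" "y \<in> T"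
        unfolding Peq by blast
      have "0 \<le> a \<and> 0 \<le> b \<and> a\<^sup>2 + b\<^sup>2 \<le> 1" using u(2) unfolding e(2) mem_pball_2 .
      then have "(a *\<^sub>R x, b *\<^sub>R y) \<in> prod2 K T" unfolding prod2_def using u by blast
      then have "u \<in> case_prod phase_join ` prod2 K T" using u(1) by (intro image_eqI[of _ _ "(a *\<^sub>R x, b *\<^sub>R y)"]) auto
      then show "u \<in> C" by (simp add: C_def \<open>\<alpha> = 1\<close> \<open>\<beta> = 1\<close>)
    qed
    then have "P = C" using CP by blast
    then show ?thesis unfolding lhs rhs' c(1) by (simp add: VP_def VC'_def)
  qed
  have "sys_ratio P ^ (n + m) = sys_ratio K ^ n * sys_ratio T ^ m \<longleftrightarrow> k = \<tau> \<and> p = 2"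
    using eq strict by (metis less_irrefl)
  with le show ?thesis by (simp add: P_def n_def m_def k_def \<tau>_def)
qed

end
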